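(* Let $d\ge 1$ be an integer, let $\mathcal{C}_d$ be the algebra of covariants of the binary form of degree $d$, and let $\mathcal{P}(\mathcal{C}_d,z)$ be its Poincaré series. Then $$ \deg(\mathcal{C}_d)=\lim_{z\to 1}(1-z)^d\,\mathcal{P}(\mathcal{C}_d,z)=\frac{1}{d!}\sum_{0\le j<d/2}(-1)^j\binom{d}{j}\left(\frac d2-j\right)^{d-1}, $$ and $$ \psi(\mathcal{C}_d)=\lim_{z\to 1}\frac{d}{dz}\Bigl(-(1-z)^d\,\mathcal{P}(\mathcal{C}_d,z)\Bigr)=\frac12\deg(\mathcal{C}_d), $$ where $\frac{d}{dz}$ denotes the derivative with respect to $z$.
   Context: For an integer $n\ge 1$, $V_n$ denotes the standard $(n+1)$-dimensional irreducible complex representation of $SL_2=SL_2(\mathbb{C})$ (binary forms of degree $n$). The algebra of covariants of the binary $d$-form is $\mathcal{C}_d\cong\mathbb{C}[V_1\oplus V_d]^{SL_2}$, the algebra of $SL_2$-invariant polynomial functions on $V_1\oplus V_d$. It is graded by the degree of a covariant in the coefficients of the form, i.e. by the degree in the coordinates of $V_d$: $\mathcal{C}_d=(\mathcal{C}_d)_0+(\mathcal{C}_d)_1+\cdots$, with $(\mathcal{C}_d)_0\cong\mathbb{C}$ and every $(\mathcal{C}_d)_i$ finite-dimensional; it is finitely generated. Its Poincaré series is $\mathcal{P}(\mathcal{C}_d,z)=\sum_{i\ge 0}\dim((\mathcal{C}_d)_i)\,z^i$, which is the power series expansion of a rational function. The transcendence degree over $\mathbb{C}$ of the quotient field of $\mathcal{C}_d$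 equals $d$, which is the order of the pole of $\mathcal{P}(\mathcal{C}_d,z)$ at $z=1$. The numbers $\deg(\mathcal{C}_d)$ and $\psi(\mathcal{C}_d)$ are the first two coefficients of the Laurent expansion at $z=1$: $$\mathcal{P}(\mathcal{C}_d,z)=\frac{\deg(\mathcal{C}_d)}{(1-z)^d}+\frac{\psi(\mathcal{C}_d)}{(1-z)^{d-1}}+\cdots.$$
   Formalization: The last equality ψ(C_d) = ½ deg(C_d) is stated only for d ≥ 2, since it fails for d = 1: there the Poincaré series is 1/(1−z), so deg = 1 and ψ = 0; both limits and the formula for deg are stated for all d ≥ 1. *)

theory Defs
  imports "HOL-Complex_Analysis.Complex_Analysis" "HOL-Library.Function_Algebras"
begin

section \<open>Binary forms and the action of SL(2,C)\<close>

type_synonym bform = "complex^2 \<Rightarrow> complex"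

definition binary_form :: "nat \<Rightarrow> (nat \<Rightarrow> complex) \<Rightarrow> bform" where
  "binary_form n a = (\<lambda>v. \<Sum>k\<le>n. a k * (v $ 1) ^ (n - k) * (v $ 2) ^ k)"

definition V :: "nat \<Rightarrow> bform set" where
  "V n = range (binary_form n)"

definition SL2 :: "(complex^2^2) set" where
  "SL2 = {g. det g = 1}"

definition act :: "complex^2^2 \<Rightarrow> bform \<Rightarrow> bform" where
  "act g f = (\<lambda>v. f (matrix_inv g *v v))"


section \<open>Polynomial functions on $V_1 \oplus V_d$\<close>

text \<open>
  A direct sum is modelled by pairs, and a function on it by a total function that vanishes
  outside \<open>V 1 \<times> V d\<close>, so that every function on \<open>V 1 \<times> V d\<close> has exactly one representative.
  The coordinates of a pair of forms are their coefficients \<open>x 0, x 1\<close> and \<open>a 0, \<dots>, a d\<close>.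
  The set \<open>E\<close> contains the exponents \<open>(r, s)\<close> of the monomials that are allowed to occur.
\<close>

definition polynomial_functions ::
    "nat \<Rightarrow> ((nat \<Rightarrow> nat) \<times> (nat \<Rightarrow> nat)) set \<Rightarrow> (bform \<times> bform \<Rightarrow> complex) set" where
  "polynomial_functions d E =
     {F. (\<exists>M c. finite M \<and> M \<subseteq> E \<and>
            (\<forall>x a. F (binary_form 1 x, binary_form d a) =
               (\<Sum>(r, s)\<in>M. c (r, s) * (\<Prod>j\<le>1. x j ^ r j) * (\<Prod>j\<le>d. a j ^ s j)))) \<and>
         (\<forall>p. p \<notin> V 1 \<times> V d \<longrightarrow> F p = 0)}"

definition covariants :: "nat \<Rightarrow> (bform \<times> bform \<Rightarrow> complex) set" where
  "covariants d =
     {F \<in> polynomial_functions d UNIV.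
        \<forall>g\<in>SL2. \<forall>l\<in>V 1. \<forall>f\<in>V d. F (act g l, act g f) = F (l, f)}"

text \<open>Only the degree in the coordinates of \<open>V d\<close> counts for the grading.\<close>

definition covariants_component :: "nat \<Rightarrow> nat \<Rightarrow> (bform \<times> bform \<Rightarrow> complex) set" where
  "covariants_component d i =
     covariants d \<inter> polynomial_functions d {(r, s). (\<Sum>j\<le>d. s j) = i}"


section \<open>The Poincare series\<close>

abbreviation (input) fun_scale :: "complex \<Rightarrow> ('a \<Rightarrow> complex) \<Rightarrow> 'a \<Rightarrow> complex" where
  "fun_scale \<equiv> \<lambda>c F p. c * F p"

lemma vector_space_fun_scale: "vector_space fun_scale"
  by unfold_locales (auto simp: algebra_simps fun_eq_iff)

definition poincare_series :: "nat \<Rightarrow> complex fps" where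
  "poincare_series d =
     Abs_fps (\<lambda>i. of_nat (vector_space.dim fun_scale (covariants_component d i)))"

text \<open>
  The rational function whose power series expansion is \<open>poincare_series d\<close>. Coprimality of
  numerator and denominator makes the function unique: its value is \<open>0\<close> (division by zero)
  exactly at its poles and zeros.
\<close>

definition poincare_fun :: "nat \<Rightarrow> complex \<Rightarrow> complex" where
  "poincare_fun d =
     (THE R. \<exists>p q. q \<noteq> 0 \<and> coprime p q \<and>
        poincare_series d * fps_of_poly q = fps_of_poly p \<and>
        R = (\<lambda>z. poly p z / poly q z))"

text \<open>
  The Laurent expansion at \<open>z = 1\<close> is taken in the variable \<open>t = 1 - z\<close>.
\<close>

definition poincare_laurent :: "nat \<Rightarrow> complex fls" where
  "poincare_laurent d = laurent_expansion (\<lambda>t. poincare_fun d (1 - t)) 0"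

definition deg_cov :: "nat \<Rightarrow> complex" where
  "deg_cov d = fls_nth (poincare_laurent d) (- int d)"

definition psi_cov :: "nat \<Rightarrow> complex" where
  "psi_cov d = fls_nth (poincare_laurent d) (- (int d - 1))"

end

theory Submission
  imports Defs "HOL-Computational_Algebra.Field_as_Ring" "HOL-Computational_Algebra.Polynomial_Factorial"
begin

text \<open>
  A covariant is a polynomial \<open>F(x, a)\<close> in the coefficients \<open>x\<close> of a linear form and \<open>a\<close> of a form of
  degree \<open>d\<close> that the group leaves invariant. The proof turns the dimension of the component of
  degree \<open>i\<close> in \<open>a\<close> into a number of monomials, sums the resulting power series in closed form, and
  reads the Laurent coefficients off that closed form.

  \<^emph>\<open>Dimension.\<close> Give the coefficient \<open>a k\<close> the weight \<open>d - 2 k\<close> and the coefficients of the linear form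
  the weights \<open>1\<close> and \<open>-1\<close>. A torus element forces \<open>F\<close> to have weight \<open>0\<close>, and invariance under the
  upper unipotent matrices says that the raising operator \<open>E\<close> of the Lie algebra sl2 kills \<open>F\<close>.
  Conversely, a polynomial of weight \<open>0\<close> killed by \<open>E\<close> is killed by the lowering operator as well
  (\<open>F_zero_if_E_zero\<close>), hence is constant along both unipotent one-parameter groups, and these
  generate the special linear group. As \<open>E\<close> maps weight \<open>0\<close> onto weight \<open>2\<close>
  (\<open>E_surjective_above_0\<close>), the dimension is the number of monomials of weight \<open>0\<close> minus the number
  of those of weight \<open>2\<close>; cancelling the variables \<open>x\<close> leaves the monomials in \<open>a\<close> alone, of degree
  \<open>i\<close> and of weight \<open>0\<close> or \<open>1\<close> (\<open>dim_covariants_component\<close>).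

  \<^emph>\<open>Series.\<close> The generating function of these monomials by weight is a Gaussian binomial coefficient in
  the square of the variable. Its partial fraction expansion (\<open>gauss_series_eq\<close>) gives the Poincare
  series as a sum over \<open>2 j < d\<close>, where the \<open>j\<close>-th summand takes every \<open>(d - 2 j)\<close>-th coefficient of an
  explicit rational function (\<open>poincare_series_nth\<close>; this is Springer's formula). Keeping every
  \<open>n\<close>-th coefficient preserves rationality, and the denominators obtained have exactly \<open>d\<close> factors
  \<open>1 - z ^ (2 m)\<close>. Near \<open>1\<close> the Poincare series is therefore \<open>pole_numerator d z / (1 - z) ^ d\<close>
  with an analytic numerator \<open>h\<close>, whence \<open>deg = h(1)\<close> and \<open>psi = - h'(1)\<close>.

  \<^emph>\<open>Values.\<close> Averaging over the \<open>n\<close>-th roots of unity expresses the value and the derivative at \<open>1\<close> of each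
  summand by the untwisted numerator at these roots. There it vanishes doubly except at \<open>1\<close>
  and \<open>-1\<close> (\<open>springer_numerator_double_root\<close>). For the value only the root \<open>1\<close> counts, which gives
  the formula for \<open>deg\<close>. For the derivative the summands add up to \<open>- h(1) / 2\<close> plus an error that
  for even \<open>d\<close> is cancelled by the root \<open>-1\<close>; for odd \<open>d\<close> it is an alternating sum that vanishes
  as a \<open>d\<close>-th difference of a polynomial of degree \<open>d - 2\<close> (\<open>alternating_half_sum\<close>).
\<close>

section \<open>Weight spaces of a finite-dimensional representation of the Lie algebra sl2\<close>

text \<open>
  The map is required to be linear on the subspace only: the intended operators are given by derivatives
  and are additive on polynomial functions, but not on all functions.
\<close>

lemma (in vector_space) rank_nullity_on_subspace:
  assumes B: "independent B" "finite B" and C: "independent C" "finite C"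
    and T_add: "\<And>x y. x \<in> span B \<Longrightarrow> y \<in> span B \<Longrightarrow> T (x + y) = T x + T y"
    and T_scale: "\<And>c x. x \<in> span B \<Longrightarrow> T (scale c x) = scale c (T x)"
    and T_image: "T ` span B = span C"
  obtains D where "independent D" "finite D" "span D = {x \<in> span B. T x = 0}"
    "card D + card C = card B"
proof -
  define K where "K = {x \<in> span B. T x = 0}"
  have T0: "T 0 = 0"
    using T_scale[OF span_zero, of 0] by simp
  have K_sub: "subspace K"
    unfolding K_def subspace_def
    by (auto simp: T0 T_add T_scale span_zero span_add span_scale)
  obtain D where D: "D \<subseteq> K" "independent D" "K \<subseteq> span D"
    using basis_exists by metis
  have DB: "D \<subseteq> span B" using D K_def by auto
  have finD: "finite D" using independent_span_bound[OF B(2) D(2) DB] by simp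
  have spanD: "span D = K" using D K_sub span_subspace by blast
  have T_sum: "T (\<Sum>x\<in>S. scale (f x) (g x)) = (\<Sum>x\<in>S. scale (f x) (T (g x)))"
    if "finite S" "\<And>x. x \<in> S \<Longrightarrow> g x \<in> span B" for S :: "'b set" and f g
    using that
  proof (induction S rule: finite_induct)
    case (insert a S)
    have "(\<Sum>x\<in>S. scale (f x) (g x)) \<in> span B"
      using insert by (intro span_sum span_scale) auto
    then show ?case using insert by (simp add: T_add T_scale span_scale)
  qed (simp add: T0)
  have "\<forall>c\<in>C. \<exists>x\<in>span B. T x = c"
    using T_image span_base by (metis imageE)
  then obtain r where r: "\<And>c. c \<in> C \<Longrightarrow> r c \<in> span B" "\<And>c. c \<in> C \<Longrightarrow> T (r c) = c"
    by metis
  have inj_r: "inj_on r C" by (metis inj_onI r(2))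
  have disj: "D \<inter> r ` C = {}"
  proof -
    have "0 \<notin> C" using C dependent_zero by blast
    then show ?thesis using D(1) r unfolding K_def by force
  qed
  have rCB: "r ` C \<subseteq> span B" using r by auto
  have split: "(\<Sum>x\<in>D \<union> r ` C. scale (f x) x) =
      (\<Sum>x\<in>D. scale (f x) x) + (\<Sum>c\<in>C. scale (f (r c)) (r c))" for f
    using disj finD C by (simp add: sum.union_disjoint sum.reindex inj_r)
  have inD: "(\<Sum>x\<in>D. scale (f x) x) \<in> K" for f
    by (metis (no_types, lifting) spanD span_base span_scale span_sum)
  have "independent (D \<union> r ` C)"
  proof (rule independent_if_scalars_zero)
    fix f x assume 0: "(\<Sum>x\<in>D \<union> r ` C. scale (f x) x) = 0" and x: "x \<in> D \<union> r ` C"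
    have "(\<Sum>c\<in>C. scale (f (r c)) (r c)) \<in> span B"
      using r by (intro span_sum span_scale) auto
    then have "T (\<Sum>x\<in>D \<union> r ` C. scale (f x) x) = (\<Sum>c\<in>C. scale (f (r c)) (T (r c)))"
      using inD[of f] unfolding split by (simp add: K_def T_add T_sum C r)
    also have "\<dots> = (\<Sum>c\<in>C. scale (f (r c)) c)" by (intro sum.cong) (auto simp: r)
    finally have "(\<Sum>c\<in>C. scale (f (r c)) c) = 0" using 0 T0 by simp
    then have fC: "f (r c) = 0" if "c \<in> C" for c
      using independentD[OF C(1) C(2) order.refl, of "\<lambda>c. f (r c)"] that by blast
    then have "(\<Sum>x\<in>D. scale (f x) x) = 0" using 0 unfolding split by simp
    then have "f x = 0" if "x \<in> D" for x
      using independentD[OF D(2) finD order.refl, of f] that by blast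
    then show "f x = 0" using x fC by auto
  qed (use finD C in auto)
  moreover have "span (D \<union> r ` C) = span B"
  proof
    show "span (D \<union> r ` C) \<subseteq> span B" using DB rCB
      by (metis Un_least span_mono span_span)
    show "span B \<subseteq> span (D \<union> r ` C)"
    proof
      fix x assume x: "x \<in> span B"
      then have "T x \<in> span C" using T_image by auto
      then obtain f where f: "T x = (\<Sum>c\<in>C. scale (f c) c)"
        using span_finite[OF C(2)] by auto
      define y where "y = (\<Sum>c\<in>C. scale (f c) (r c))"
      have y: "y \<in> span B" unfolding y_def using r by (intro span_sum span_scale) auto
      have Ty: "T y = T x" unfolding y_def f using C r by (simp add: T_sum)
      have "T (x - y) = 0"
        using T_add[of "x - y" y] x y Ty by (simp add: span_diff)
      then have "x - y \<in> K" using x y by (simp add: K_def span_diff)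
      then have "x - y \<in> span (D \<union> r ` C)" using spanD by (metis Un_upper1 span_mono subsetD)
      moreover have "y \<in> span (D \<union> r ` C)"
        unfolding y_def by (intro span_sum span_scale span_base) auto
      ultimately show "x \<in> span (D \<union> r ` C)" using span_add by fastforce
    qed
  qed
  ultimately have "card (D \<union> r ` C) = card B"
    using B by (metis dim_eq_card)
  then have "card D + card C = card B"
    using disj finD C by (simp add: card_Un_disjoint card_image inj_r)
  then show ?thesis using that D(2) finD spanD K_def by blast
qed

text \<open>
  The third basis element of sl2 acts on \<open>W m\<close> as the scalar \<open>m\<close>, so it appears only through the
  commutator. The bound on the weights makes \<open>E\<close> and \<open>F\<close> locally nilpotent.
\<close>

locale sl2_weight_spaces = vector_space scale
  for scale :: "complex \<Rightarrow> 'v::ab_group_add \<Rightarrow> 'v" +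
  fixes W :: "int \<Rightarrow> 'v set" and E F :: "'v \<Rightarrow> 'v"
  assumes subspace_W: "subspace (W m)"
    and E_add: "v \<in> W m \<Longrightarrow> w \<in> W m \<Longrightarrow> E (v + w) = E v + E w"
    and E_scale: "v \<in> W m \<Longrightarrow> E (scale c v) = scale c (E v)"
    and F_add: "v \<in> W m \<Longrightarrow> w \<in> W m \<Longrightarrow> F (v + w) = F v + F w"
    and F_scale: "v \<in> W m \<Longrightarrow> F (scale c v) = scale c (F v)"
    and E_W: "v \<in> W m \<Longrightarrow> E v \<in> W (m + 2)"
    and F_W: "v \<in> W m \<Longrightarrow> F v \<in> W (m - 2)"
    and commutator: "v \<in> W m \<Longrightarrow> E (F v) = F (E v) + scale (of_int m) v"
    and bounded: "\<exists>M. \<forall>m v. \<bar>m\<bar> > M \<longrightarrow> v \<in> W m \<longrightarrow> v = 0"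
begin

lemma F_zero [simp]: "F 0 = 0"
  using F_scale[OF subspace_0[OF subspace_W], of 0] by simp

lemma E_zero [simp]: "E 0 = 0"
  using E_scale[OF subspace_0[OF subspace_W], of 0] by simp

lemma F_pow_W: "v \<in> W m \<Longrightarrow> (F ^^ k) v \<in> W (m - 2 * int k)"
proof (induction k)
  case (Suc k)
  then show ?case using F_W[of "(F ^^ k) v" "m - 2 * int k"] by (simp add: algebra_simps)
qed simp

lemma E_pow_W: "v \<in> W m \<Longrightarrow> (E ^^ k) v \<in> W (m + 2 * int k)"
proof (induction k)
  case (Suc k)
  then show ?case using E_W[of "(E ^^ k) v" "m + 2 * int k"] by (simp add: algebra_simps)
qed simp

text \<open>
  Moving \<open>E\<close> past the \<open>k + 1\<close> factors \<open>F\<close> costs one commutator each; they contribute the weights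
  \<open>m, m - 2, ..., m - 2 k\<close>, whose sum is \<open>(k + 1) (m - k)\<close>.
\<close>

lemma E_F_pow:
  assumes "v \<in> W m"
  shows "E ((F ^^ Suc k) v) =
    (F ^^ Suc k) (E v) + scale (of_nat (Suc k) * (of_int m - of_nat k)) ((F ^^ k) v)"
proof (induction k)
  case 0
  then show ?case using commutator[OF assms] by simp
next
  case (Suc k)
  define u where "u = (F ^^ Suc k) v"
  have u: "u \<in> W (m - 2 * int (Suc k))" using F_pow_W[OF assms] unfolding u_def .
  have k: "(F ^^ k) v \<in> W (m - 2 * int k)" using F_pow_W[OF assms] .
  have e: "(F ^^ Suc k) (E v) \<in> W (m - 2 * int k)"
    using F_pow_W[OF E_W[OF assms], of "Suc k"] by (simp add: algebra_simps)
  have "E ((F ^^ Suc (Suc k)) v) = F (E u) + scale (of_int (m - 2 * int (Suc k))) u"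
    using commutator[OF u] by (simp add: u_def)
  also have "F (E u) =
      F ((F ^^ Suc k) (E v)) + scale (of_nat (Suc k) * (of_int m - of_nat k)) u"
    unfolding u_def Suc using F_add[OF e] F_scale[OF k] k
    by (simp add: subspace_scale[OF subspace_W])
  finally have "E ((F ^^ Suc (Suc k)) v) = (F ^^ Suc (Suc k)) (E v) +
      (scale (of_nat (Suc k) * (of_int m - of_nat k)) u + scale (of_int (m - 2 * int (Suc k))) u)"
    by (simp only: funpow.simps o_apply add.assoc)
  also have "scale (of_nat (Suc k) * (of_int m - of_nat k)) u + scale (of_int (m - 2 * int (Suc k))) u
      = scale (of_nat (Suc (Suc k)) * (of_int m - of_nat (Suc k))) u"
    unfolding scale_left_distrib[symmetric] by (rule arg_cong[of _ _ "\<lambda>c. scale c u"]) (simp add: algebra_simps)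
  finally show ?case unfolding u_def .
qed

text \<open>
  If \<open>E v = 0\<close>, then \<open>E\<close> maps \<open>F ^^ (k + 1) v\<close> to a multiple of \<open>F ^^ k v\<close>, and the factor
  \<open>(k + 1) (m - k)\<close> is nonzero for negative \<open>m\<close>. So \<open>F ^^ (k + 1) v = 0\<close> implies \<open>F ^^ k v = 0\<close>,
  and a high power of \<open>F\<close> does vanish.
\<close>

lemma E_injective_below_0:
  assumes "m < 0" "v \<in> W m" "E v = 0"
  shows "v = 0"
proof -
  obtain M where M: "\<And>m v. \<bar>m\<bar> > M \<Longrightarrow> v \<in> W m \<Longrightarrow> v = 0" using bounded by blast
  have F0: "(F ^^ k) 0 = 0" for k by (induction k) auto
  have step: "(F ^^ k) v = 0" if "(F ^^ Suc k) v = 0" for k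
  proof -
    have "scale (of_nat (Suc k) * (of_int m - of_nat k)) ((F ^^ k) v) = 0"
      using E_F_pow[OF assms(2), of k] unfolding assms(3) that F0 by simp
    moreover have "of_int m - of_nat k \<noteq> (0 :: complex)"
      using assms(1) by (metis of_int_of_nat_eq of_int_diff of_int_eq_0_iff diff_eq_diff_eq
          diff_self linorder_not_less of_nat_0_le_iff)
    ultimately show ?thesis
      by (metis mult_eq_0_iff of_nat_eq_0_iff scale_eq_0_iff nat.distinct(1))
  qed
  have "(F ^^ nat \<bar>M\<bar>) v = 0"
    by (rule M[OF _ F_pow_W[OF assms(2)]]) (use assms(1) in linarith)
  moreover have "(F ^^ k) v = 0 \<Longrightarrow> v = 0" for k
    by (induction k) (use step in auto)
  ultimately show ?thesis by blast
qed

text \<open>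
  Put \<open>u k = F ^^ k (E ^^ k v)\<close>. Then \<open>E (F ^^ (k + 1) (E ^^ k v))\<close> equals \<open>u (k + 1)\<close> plus a nonzero
  multiple of \<open>u k\<close>, so \<open>u k\<close> is in the image of \<open>E\<close> if \<open>u (k + 1)\<close> is. Start at a large \<open>k\<close>, where
  \<open>u k = 0\<close>, and descend to \<open>u 0 = v\<close>.
\<close>

lemma E_surjective_above_0:
  assumes "m > 0" "v \<in> W m"
  shows "\<exists>w \<in> W (m - 2). E w = v"
proof -
  obtain M where M: "\<And>m v. \<bar>m\<bar> > M \<Longrightarrow> v \<in> W m \<Longrightarrow> v = 0" using bounded by blast
  have F0: "(F ^^ k) 0 = 0" for k by (induction k) auto
  define u where "u k = (F ^^ k) ((E ^^ k) v)" for k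
  have step: "\<exists>w \<in> W (m - 2). E w = u k" if ex: "\<exists>w \<in> W (m - 2). E w = u (Suc k)" for k
  proof -
    obtain w where w: "w \<in> W (m - 2)" "E w = u (Suc k)" using ex by blast
    define x where "x = (F ^^ Suc k) ((E ^^ k) v)"
    define c :: complex where "c = of_nat (Suc k) * of_int (m + int k)"
    have c: "c \<noteq> 0"
    proof -
      have "m + int k \<noteq> 0" using assms(1) by linarith
      then show ?thesis unfolding c_def by (simp only: mult_eq_0_iff of_int_eq_0_iff of_nat_eq_0_iff) simp
    qed
    have x: "x \<in> W (m - 2)"
      using F_pow_W[OF E_pow_W[OF assms(2), of k], of "Suc k"] by (simp add: x_def)
    have "E x = u (Suc k) + scale c (u k)"
      using E_F_pow[OF E_pow_W[OF assms(2), of k], of k]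
      by (simp add: x_def u_def c_def algebra_simps)
    moreover have mw: "scale (-1) w \<in> W (m - 2)" using w subspace_scale[OF subspace_W] by blast
    ultimately have "E (x + scale (-1) w) = scale c (u k)"
      using E_add[OF x mw] E_scale[OF w(1), of "-1"] w by simp
    then have "E (scale (inverse c) (x + scale (-1) w)) = u k"
      using E_scale[of "x + scale (-1) w" "m - 2" "inverse c"] c
      by (simp only: subspace_add[OF subspace_W x mw]) simp
    then show ?thesis
      using subspace_scale[OF subspace_W subspace_add[OF subspace_W x mw]] by blast
  qed
  have "(E ^^ nat \<bar>M\<bar>) v = 0"
    by (rule M[OF _ E_pow_W[OF assms(2)]]) (use assms(1) in linarith)
  then have "u (nat \<bar>M\<bar>) = 0" by (simp add: u_def F0)
  then have "\<exists>w \<in> W (m - 2). E w = u (nat \<bar>M\<bar>)"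
    using subspace_0[OF subspace_W] E_zero by metis
  moreover have "\<exists>w \<in> W (m - 2). E w = u k \<Longrightarrow> \<exists>w \<in> W (m - 2). E w = u 0" for k
    by (induction k) (use step in auto)
  ultimately show ?thesis unfolding u_def by auto
qed

text \<open>
  The vector \<open>F v\<close> has weight \<open>-2\<close>, and \<open>E\<close> kills it because the commutator acts as \<open>0\<close> on \<open>v\<close>.
\<close>

lemma F_zero_if_E_zero:
  assumes "v \<in> W 0" "E v = 0"
  shows "F v = 0"
  using E_injective_below_0[OF _ F_W[OF assms(1)]] commutator[OF assms(1)] assms(2) by simp

end


lemma sum_apply: "(\<Sum>x\<in>A. f x) y = (\<Sum>x\<in>A. f x y :: 'a::comm_monoid_add)"
  by (induction A rule: infinite_finite_induct) auto

section \<open>Derivations of polynomial functions\<close>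

interpretation fun_space: vector_space "\<lambda>(c::complex) (F :: 'a \<Rightarrow> complex) p. c * F p"
  by (rule vector_space_fun_scale)

type_synonym pfun = "(nat \<Rightarrow> complex) \<Rightarrow> complex"

text \<open>
  Polynomial functions in countably many coordinates. The inductive form lets identities between
  derivations be checked on coordinates and carried over to sums and products.
\<close>

inductive poly_function :: "pfun \<Rightarrow> bool" where
  const: "poly_function (\<lambda>y. c)"
| coord: "poly_function (\<lambda>y. y k)"
| add: "poly_function G \<Longrightarrow> poly_function H \<Longrightarrow> poly_function (\<lambda>y. G y + H y)"
| mult: "poly_function G \<Longrightarrow> poly_function H \<Longrightarrow> poly_function (\<lambda>y. G y * H y)"

lemma poly_function_prod: "(\<And>i. i \<in> I \<Longrightarrow> poly_function (G i)) \<Longrightarrow> poly_function (\<lambda>y. \<Prod>i\<in>I. G i y)"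
  by (induction I rule: infinite_finite_induct) (auto intro: poly_function.intros)

lemma poly_function_power: "poly_function G \<Longrightarrow> poly_function (\<lambda>y. G y ^ k)"
  by (induction k) (auto intro: poly_function.intros)

definition derivation :: "((nat \<Rightarrow> complex) \<Rightarrow> nat \<Rightarrow> complex) \<Rightarrow> pfun \<Rightarrow> pfun" where
  "derivation X G = (\<lambda>y. deriv (\<lambda>t. G (\<lambda>k. y k + t * X y k)) 0)"

lemma poly_function_line_differentiable:
  "poly_function G \<Longrightarrow> (\<lambda>t. G (\<lambda>k. y k + t * v k)) field_differentiable at t"
  by (induction rule: poly_function.induct) (auto intro!: derivative_intros)

lemma derivation_const [simp]: "derivation X (\<lambda>y. c) = (\<lambda>y. 0)"
  by (simp add: derivation_def)

lemma derivation_coord [simp]: "derivation X (\<lambda>y. y k) = (\<lambda>y. X y k)"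
proof -
  have "((\<lambda>t. y k + t * X y k) has_field_derivative X y k) (at 0)" for y
    by (auto intro!: derivative_eq_intros)
  then show ?thesis by (auto simp: derivation_def fun_eq_iff intro!: DERIV_imp_deriv)
qed

lemma derivation_add:
  assumes "poly_function G" "poly_function H"
  shows "derivation X (\<lambda>y. G y + H y) = (\<lambda>y. derivation X G y + derivation X H y)"
  unfolding derivation_def fun_eq_iff
  by (intro allI deriv_add poly_function_line_differentiable assms)

lemma derivation_mult:
  assumes "poly_function G" "poly_function H"
  shows "derivation X (\<lambda>y. G y * H y) = (\<lambda>y. G y * derivation X H y + derivation X G y * H y)"
  unfolding derivation_def fun_eq_iff
  by (intro allI, subst deriv_mult) (auto intro!: poly_function_line_differentiable assms)

lemma derivation_cmult:
  assumes "poly_function G"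
  shows "derivation X (\<lambda>y. c * G y) = (\<lambda>y. c * derivation X G y)"
  using derivation_mult[OF poly_function.const assms, of X c] by simp

lemma poly_function_derivation:
  assumes "poly_function G" "\<And>k. poly_function (\<lambda>y. X y k)"
  shows "poly_function (derivation X G)"
  using assms(1)
  by (induction rule: poly_function.induct) (simp_all add: derivation_add derivation_mult poly_function.intros assms(2))

text \<open>
  The curve is only assumed to have velocity \<open>X\<close> at the parameter \<open>t\<close>; it need not be a line. This is the
  link from the Lie algebra to one-parameter groups.
\<close>

lemma derivation_along_curve:
  assumes "poly_function G" "\<And>k. ((\<lambda>t. \<phi> t k) has_field_derivative X (\<phi> t) k) (at t)"
  shows "((\<lambda>t. G (\<phi> t)) has_field_derivative derivation X G (\<phi> t)) (at t)"
  using assms(1)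
proof (induction rule: poly_function.induct)
  case (coord k)
  then show ?case using assms(2) by simp
next
  case (add G H)
  then show ?case by (auto simp: derivation_add intro!: derivative_eq_intros)
next
  case (mult G H)
  then show ?case by (auto simp: derivation_mult intro!: derivative_eq_intros)
qed auto

text \<open>
  Both sides are derivations in \<open>G\<close>, so it suffices that they agree on the coordinates.
\<close>

lemma derivation_commutator:
  assumes X: "\<And>k. poly_function (\<lambda>y. X y k)" and Y: "\<And>k. poly_function (\<lambda>y. Y y k)"
    and Z: "\<And>y k. Z y k = derivation X (\<lambda>y. Y y k) y - derivation Y (\<lambda>y. X y k) y"
    and "poly_function G"
  shows "derivation X (derivation Y G) y - derivation Y (derivation X G) y = derivation Z G y"
  using assms(4)
proof (induction arbitrary: y rule: poly_function.induct)
  case (coord k)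
  then show ?case by (simp add: Z)
next
  case (add G H)
  note p = add.hyps poly_function_derivation[OF add.hyps(1) X] poly_function_derivation[OF add.hyps(1) Y]
    poly_function_derivation[OF add.hyps(2) X] poly_function_derivation[OF add.hyps(2) Y]
  show ?case
    using add.IH[of y] by (simp add: derivation_add p algebra_simps)
next
  case (mult G H)
  note p = mult.hyps poly_function_derivation[OF mult.hyps(1) X] poly_function_derivation[OF mult.hyps(1) Y]
    poly_function_derivation[OF mult.hyps(2) X] poly_function_derivation[OF mult.hyps(2) Y]
  have "derivation X (derivation Y G) y = derivation Y (derivation X G) y + derivation Z G y"
    "derivation X (derivation Y H) y = derivation Y (derivation X H) y + derivation Z H y"
    using mult.IH[of y] by (simp_all add: algebra_simps)
  then show ?case
    by (simp add: derivation_add derivation_mult p poly_function.intros algebra_simps)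
qed simp


section \<open>Monomials\<close>

definition monomial :: "nat \<Rightarrow> (nat \<Rightarrow> nat) \<Rightarrow> pfun" where
  "monomial n e = (\<lambda>y. \<Prod>k<n. y k ^ e k)"

definition exps :: "nat \<Rightarrow> (nat \<Rightarrow> nat) set" where
  "exps n = {e. \<forall>k\<ge>n. e k = 0}"

lemma poly_function_monomial: "poly_function (monomial n e)"
  unfolding monomial_def by (intro poly_function_prod poly_function_power poly_function.coord)

lemma poly_function_span_monomials:
  assumes "G \<in> fun_space.span (monomial n ` A)"
  shows "poly_function G"
  using assms
proof (induction rule: fun_space.span_induct_alt)
  case base
  then show ?case using poly_function.const[of 0] by (simp add: zero_fun_def)
next
  case (step c x y)
  then have "poly_function (\<lambda>p. c * x p + y p)"
    by (auto intro!: poly_function.add poly_function.mult poly_function.const poly_function_monomial)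
  then show ?case by (simp add: plus_fun_def)
qed

text \<open>
  Induction on the number of coordinates: for fixed values of the others, the sum is a polynomial in the
  last coordinate that vanishes everywhere, so its coefficients vanish.
\<close>

lemma monomials_independent:
  assumes "finite S" "S \<subseteq> exps n" "\<And>y. (\<Sum>e\<in>S. c e * monomial n e y) = 0" "e \<in> S"
  shows "c e = 0"
  using assms
proof (induction n arbitrary: S e c)
  case 0
  have zero: "f = (\<lambda>_. 0)" if "f \<in> S" for f
    using 0(2) that by (force simp: exps_def)
  have "S \<subseteq> {e}" using zero[OF 0(4)] zero by (intro subsetI) (metis singletonI)
  then have "S = {e}" using 0(4) by blast
  then show ?case using 0(3)[of undefined] by (simp add: monomial_def)
next
  case (Suc n)
  define N where "N = Max ((\<lambda>e. e n) ` S)"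
  have N: "f n \<le> N" if "f \<in> S" for f unfolding N_def using that Suc.prems(1) by auto
  define T where "T j = {f \<in> S. f n = j}" for j
  have finT: "finite (T j)" for j using Suc.prems(1) by (simp add: T_def)
  have coeff0: "(\<Sum>f\<in>T j. c f * monomial n f y) = 0" for j y
  proof -
    define p where "p = (\<Sum>j\<le>N. monom (\<Sum>f\<in>T j. c f * monomial n f y) j)"
    have "poly p z = 0" for z
    proof -
      have "0 = (\<Sum>f\<in>S. c f * monomial (Suc n) f (y(n := z)))" using Suc.prems(3) by simp
      also have "\<dots> = (\<Sum>f\<in>S. c f * monomial n f y * z ^ f n)"
        by (intro sum.cong) (auto simp: monomial_def mult_ac)
      also have "\<dots> = (\<Sum>j\<le>N. \<Sum>f\<in>{f \<in> S. f n = j}. c f * monomial n f y * z ^ f n)"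
        using N by (intro sum.group[symmetric] Suc.prems(1)) auto
      also have "\<dots> = poly p z"
        by (auto simp: p_def poly_sum poly_monom sum_distrib_right T_def intro!: sum.cong)
      finally show ?thesis by simp
    qed
    then have "p = 0" by (metis poly_all_0_iff_0)
    show ?thesis
    proof (cases "j \<le> N")
      case True
      then have "coeff p j = (\<Sum>f\<in>T j. c f * monomial n f y)"
        by (simp add: p_def coeff_sum if_distrib sum.delta cong: if_cong)
      then show ?thesis using \<open>p = 0\<close> by simp
    next
      case False
      then have "T j = {}" using N by (auto simp: T_def)
      then show ?thesis by simp
    qed
  qed
  define r where "r f = f(n := 0 :: nat)" for f :: "nat \<Rightarrow> nat"
  define i where "i f = f(n := e n)" for f :: "nat \<Rightarrow> nat"
  have ir: "i (r f) = f" if "f \<in> T (e n)" for f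
    using that by (auto simp: i_def r_def T_def)
  have "(c \<circ> i) (r e) = 0"
  proof (rule Suc.IH[of "r ` T (e n)" "c \<circ> i" "r e"])
    show "finite (r ` T (e n))" using finT by simp
    show "r ` T (e n) \<subseteq> exps n"
      using Suc.prems(2) by (auto simp: r_def exps_def T_def)
    show "(\<Sum>f\<in>r ` T (e n). (c \<circ> i) f * monomial n f y) = 0" for y
    proof -
      have "inj_on r (T (e n))" using ir by (metis inj_onI)
      then have "(\<Sum>f\<in>r ` T (e n). (c \<circ> i) f * monomial n f y) =
          (\<Sum>f\<in>T (e n). c (i (r f)) * monomial n (r f) y)"
        by (simp add: sum.reindex)
      also have "\<dots> = (\<Sum>f\<in>T (e n). c f * monomial n f y)"
        by (intro sum.cong) (auto simp: ir, auto simp: monomial_def r_def)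
      finally show ?thesis using coeff0 by simp
    qed
    show "r e \<in> r ` T (e n)" using Suc.prems(4) by (auto simp: T_def)
  qed
  then show ?case using ir[of e] Suc.prems(4) by (simp add: T_def)
qed

lemma inj_monomial: "inj_on (monomial n) (exps n)"
proof (rule inj_onI, rule ccontr)
  fix e f assume *: "e \<in> exps n" "f \<in> exps n" "monomial n e = monomial n f" "e \<noteq> f"
  have "(if e = e then 1 else -1 :: complex) = 0"
    by (rule monomials_independent[of "{e, f}" n "\<lambda>g. if g = e then 1 else -1"]) (use * in auto)
  then show False by simp
qed

lemma independent_monomials:
  assumes "finite A" "A \<subseteq> exps n"
  shows "fun_space.independent (monomial n ` A)"
proof -
  have inj: "inj_on (monomial n) A" using inj_monomial assms(2) inj_on_subset by blast
  have key: "f G = 0"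
    if *: "(\<Sum>x\<in>monomial n ` A. (\<lambda>p. f x * x p)) = 0" "G \<in> monomial n ` A" for f G
  proof -
    from *(2) obtain e where e: "e \<in> A" "G = monomial n e" by auto
    have sum0: "(\<Sum>e\<in>A. f (monomial n e) * monomial n e y) = 0" for y
    proof -
      have "(\<Sum>x\<in>monomial n ` A. (\<lambda>p. f x * x p)) y = (\<Sum>x\<in>monomial n ` A. f x * x y)"
        by (simp add: sum_apply)
      then show ?thesis using *(1) inj by (simp add: sum.reindex)
    qed
    have "(\<lambda>e. f (monomial n e)) e = 0"
      by (rule monomials_independent[of A n "\<lambda>e. f (monomial n e)" e])
        (fact assms(1), fact assms(2), simp only: sum0, fact e(1))
    then show ?thesis using e by simp
  qed
  show ?thesis
    apply (rule fun_space.independent_if_scalars_zero)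
    subgoal using assms by simp
    subgoal premises p for f G by (rule key[of f G, OF p])
    done
qed

text \<open>
  In the truncated exponent \<open>e k - 1\<close> the case \<open>e k = 0\<close> does no harm, as its term has the factor \<open>0\<close>.
\<close>

lemma derivation_monomial:
  "derivation X (monomial n e) y = (\<Sum>k<n. of_nat (e k) * X y k * monomial n (e(k := e k - 1)) y)"
proof -
  have "((\<lambda>t. monomial n e (\<lambda>k. y k + t * X y k)) has_field_derivative
     (\<Sum>k<n. (of_nat (e k) * (y k + 0 * X y k) ^ (e k - 1) * X y k) *
        (\<Prod>l\<in>{..<n} - {k}. (y l + 0 * X y l) ^ e l))) (at 0)"
    unfolding monomial_def
    by (intro has_field_derivative_prod) (auto intro!: derivative_eq_intros)
  then have "derivation X (monomial n e) y = (\<Sum>k<n. (of_nat (e k) * y k ^ (e k - 1) * X y k) *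
        (\<Prod>l\<in>{..<n} - {k}. y l ^ e l))"
    unfolding derivation_def by (simp add: DERIV_imp_deriv)
  also have "\<dots> = (\<Sum>k<n. of_nat (e k) * X y k * monomial n (e(k := e k - 1)) y)"
  proof (intro sum.cong refl)
    fix k assume k: "k \<in> {..<n}"
    have "monomial n (e(k := e k - 1)) y = y k ^ (e k - 1) * (\<Prod>l\<in>{..<n} - {k}. y l ^ e l)"
      unfolding monomial_def by (subst prod.remove[OF _ k]) (auto intro!: prod.cong)
    then show "of_nat (e k) * y k ^ (e k - 1) * X y k * (\<Prod>l\<in>{..<n} - {k}. y l ^ e l) =
      of_nat (e k) * X y k * monomial n (e(k := e k - 1)) y" by (simp add: mult_ac)
  qed
  finally show ?thesis .
qed

lemma coord_times_monomial:
  assumes "j < n"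
  shows "y j * monomial n e y = monomial n (e(j := Suc (e j))) y"
proof -
  have "monomial n f y = y j ^ f j * (\<Prod>l\<in>{..<n} - {j}. y l ^ f l)" for f
    unfolding monomial_def using assms by (subst prod.remove[of _ j]) auto
  from this[of e] this[of "e(j := Suc (e j))"] show ?thesis by simp
qed


section \<open>The action of the Lie algebra sl2 on polynomial functions\<close>

text \<open>
  The coordinates \<open>y 0, ..., y d\<close> are the coefficients of the form of degree \<open>d\<close>, and \<open>y (d + 1)\<close>,
  \<open>y (d + 2)\<close> are those of the linear form. The two fields below are the infinitesimal substitutions
  that add a multiple of the second variable to the first, and vice versa.
\<close>

definition raising_field :: "nat \<Rightarrow> (nat \<Rightarrow> complex) \<Rightarrow> nat \<Rightarrow> complex" where
  "raising_field d y k =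
     (if 1 \<le> k \<and> k \<le> d then of_nat (d + 1 - k) * y (k - 1) else if k = d + 2 then y (d + 1) else 0)"

definition lowering_field :: "nat \<Rightarrow> (nat \<Rightarrow> complex) \<Rightarrow> nat \<Rightarrow> complex" where
  "lowering_field d y k =
     (if k < d then of_nat (k + 1) * y (k + 1) else if k = d + 1 then y (d + 2) else 0)"

definition coord_weight :: "nat \<Rightarrow> nat \<Rightarrow> int" where
  "coord_weight d k =
     (if k \<le> d then int d - 2 * int k else if k = d + 1 then 1 else if k = d + 2 then -1 else 0)"

definition weight :: "nat \<Rightarrow> (nat \<Rightarrow> nat) \<Rightarrow> int" where
  "weight d e = (\<Sum>k<d + 3. coord_weight d k * int (e k))"

text \<open>
  The grading leaves the degree in the linear form unbounded. The bound \<open>K\<close> on it keeps the weight spaces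
  finite-dimensional; it is respected by both operators.
\<close>

definition weight_exps :: "nat \<Rightarrow> nat \<Rightarrow> nat \<Rightarrow> int \<Rightarrow> (nat \<Rightarrow> nat) set" where
  "weight_exps d i K m = {e \<in> exps (d + 3).
     (\<Sum>k\<le>d. e k) = i \<and> e (d + 1) + e (d + 2) \<le> K \<and> weight d e = m}"

definition weight_space :: "nat \<Rightarrow> nat \<Rightarrow> nat \<Rightarrow> int \<Rightarrow> pfun set" where
  "weight_space d i K m = fun_space.span (monomial (d + 3) ` weight_exps d i K m)"

lemma finite_bounded_exps: "finite {e \<in> exps n. \<forall>k. e k \<le> B}"
proof -
  have "finite {e. \<forall>k. (k \<in> {..<n} \<longrightarrow> e k \<in> {..B}) \<and> (k \<notin> {..<n} \<longrightarrow> e k = (0::nat))}"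
    by (rule finite_set_of_finite_funs) auto
  then show ?thesis by (rule rev_finite_subset) (auto simp: exps_def)
qed

lemma finite_weight_exps_UN: "finite (\<Union>m. weight_exps d i K m)"
proof (rule finite_subset[OF _ finite_bounded_exps[of "d + 3" "i + K"]], safe)
  fix e m assume e: "e \<in> weight_exps d i K m"
  then show "e \<in> exps (d + 3)" by (simp add: weight_exps_def)
  fix k
  consider "k \<le> d" | "k = d + 1" | "k = d + 2" | "k \<ge> d + 3" by linarith
  then show "e k \<le> i + K"
  proof cases
    case 1
    then have "e k \<le> (\<Sum>k\<le>d. e k)" by (intro member_le_sum) auto
    then show ?thesis using e by (simp add: weight_exps_def)
  qed (use e in \<open>auto simp: weight_exps_def exps_def\<close>)
qed

lemma finite_weight_exps: "finite (weight_exps d i K m)"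
  by (rule finite_subset[OF _ finite_weight_exps_UN[of d i K]]) auto

lemma weight_exps_subset: "weight_exps d i K m \<subseteq> exps (d + 3)"
  by (auto simp: weight_exps_def)

lemma poly_function_weight_space: "G \<in> weight_space d i K m \<Longrightarrow> poly_function G"
  unfolding weight_space_def by (rule poly_function_span_monomials)

text \<open>
  Applied to a monomial, a derivation whose field sends coordinate \<open>k\<close> to a multiple of coordinate \<open>j\<close>
  replaces one factor \<open>y k\<close> by \<open>y j\<close>.
\<close>

definition move :: "nat \<Rightarrow> nat \<Rightarrow> (nat \<Rightarrow> nat) \<Rightarrow> nat \<Rightarrow> nat" where
  "move k j e = e(k := e k - 1, j := Suc (e j))"

lemma sum_increment:
  "finite I \<Longrightarrow> (\<Sum>l\<in>I. w l * of_nat ((f(j := Suc (f j))) l)) =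
    (\<Sum>l\<in>I. w l * of_nat (f l)) + (if j \<in> I then w j else (0 :: 'a::comm_semiring_1))"
  by (induction I rule: finite_induct) (auto simp: algebra_simps)

lemma sum_move:
  assumes "finite I" "k \<noteq> j" "e k > 0"
  shows "(\<Sum>l\<in>I. w l * of_nat (move k j e l)) + (if k \<in> I then w k else 0) =
    (\<Sum>l\<in>I. w l * of_nat (e l)) + (if j \<in> I then w j else (0 :: 'a::comm_semiring_1))"
proof -
  define f where "f = e(k := e k - 1)"
  have "move k j e = f(j := Suc (f j))" "e = f(k := Suc (f k))"
    using assms by (auto simp: f_def move_def)
  then show ?thesis
    using sum_increment[OF assms(1), of w f j] sum_increment[OF assms(1), of w f k]
    by (simp add: algebra_simps)
qed

lemma move_weight_exps:
  assumes "e \<in> weight_exps d i K m" "e k > 0"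
    and "1 \<le> k \<and> k \<le> d \<and> j = k - 1 \<or> k < d \<and> j = k + 1 \<or>
         k = d + 2 \<and> j = d + 1 \<or> k = d + 1 \<and> j = d + 2"
  shows "move k j e \<in> weight_exps d i K (m + coord_weight d j - coord_weight d k)"
proof -
  have kj: "k \<noteq> j" using assms(3) by auto
  have "(\<Sum>l\<le>d. move k j e l) = i"
    using sum_move[of "{..d}" k j e "\<lambda>_. 1 :: nat"] kj assms(2) assms(1,3)
    by (fastforce simp: weight_exps_def split: if_splits)
  moreover have "weight d (move k j e) = m + coord_weight d j - coord_weight d k"
    using sum_move[of "{..<d + 3}" k j e "coord_weight d"] kj assms(2) assms(1,3)
    by (auto simp: weight_exps_def weight_def split: if_splits)
  moreover have "move k j e \<in> exps (d + 3)" "move k j e (d + 1) + move k j e (d + 2) \<le> K"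
    using assms by (auto simp: weight_exps_def exps_def move_def)
  ultimately show ?thesis by (simp add: weight_exps_def)
qed

lemma derivation_add_fun:
  "poly_function G \<Longrightarrow> poly_function H \<Longrightarrow> derivation X (G + H) = derivation X G + derivation X H"
  using derivation_add[of G H X] by (simp add: plus_fun_def)

text \<open>
  The usual induction on a span, with the summand \<open>H\<close> known to be polynomial, which additivity of
  derivations requires.
\<close>

lemma span_monomials_induct [consumes 1, case_names zero add]:
  assumes "G \<in> fun_space.span (monomial n ` A)" "P 0"
    and "\<And>c e H. e \<in> A \<Longrightarrow> poly_function H \<Longrightarrow> P H \<Longrightarrow> P (\<lambda>y. c * monomial n e y + H y)"
  shows "P G"
proof -
  have "poly_function G \<and> P G"
    using assms(1)
  proof (induction rule: fun_space.span_induct_alt)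
    case base
    show ?case using assms(2) poly_function.const[of 0] by (simp add: zero_fun_def)
  next
    case (step c x H)
    then obtain e where e: "e \<in> A" "x = monomial n e" by auto
    have "poly_function (\<lambda>y. c * monomial n e y + H y)"
      using poly_function.add[OF poly_function.mult[OF poly_function.const poly_function_monomial]] step by blast
    moreover have "P (\<lambda>y. c * monomial n e y + H y)" using assms(3) e step by blast
    ultimately show ?case unfolding e plus_fun_def by blast
  qed
  then show ?thesis ..
qed

lemma derivation_lincomb:
  assumes "poly_function H"
  shows "derivation X (\<lambda>y. c * monomial n e y + H y) =
    (\<lambda>y. c * derivation X (monomial n e) y + derivation X H y)"
  using assms by (simp add: derivation_add poly_function.mult poly_function.const poly_function_monomial derivation_cmult)

lemma derivation_move_span:
  assumes "G \<in> fun_space.span (monomial n ` A)"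
    and "\<And>k. k < n \<Longrightarrow> (\<forall>y. X y k = 0) \<or>
      (\<exists>c j. j < n \<and> j \<noteq> k \<and> (\<forall>y. X y k = c * y j) \<and> (\<forall>e\<in>A. e k > 0 \<longrightarrow> move k j e \<in> B))"
  shows "derivation X G \<in> fun_space.span (monomial n ` B)"
  using assms(1)
proof (induction rule: span_monomials_induct)
  case zero
  have "derivation X 0 = 0" using derivation_const[of X 0] by (simp add: zero_fun_def)
  then show ?case using fun_space.span_zero by metis
next
  case (add c e H)
  define g where "g k = (\<lambda>y. of_nat (e k) * X y k * monomial n (e(k := e k - 1)) y)" for k
  have g: "g k \<in> fun_space.span (monomial n ` B)" if kn: "k < n" for k
  proof -
    consider "\<forall>y. X y k = 0" | "e k = 0" | c j where "j < n" "j \<noteq> k" "\<forall>y. X y k = c * y j"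
      "move k j e \<in> B" using assms(2)[OF kn] add(1) by (metis gr0I)
    then show ?thesis
    proof cases
      case 3
      have "g k y = (of_nat (e k) * c) * monomial n (move k j e) y" for y
      proof -
        have "move k j e = (e(k := e k - 1))(j := Suc ((e(k := e k - 1)) j))"
          using 3(2) by (simp add: move_def)
        then have m: "monomial n (move k j e) y = y j * monomial n (e(k := e k - 1)) y"
          using coord_times_monomial[OF 3(1), of y "e(k := e k - 1)"] by metis
        have x: "X y k = c * y j" using 3(3) by blast
        show ?thesis by (simp only: g_def x m mult.assoc)
      qed
      then have "g k = (\<lambda>y. (of_nat (e k) * c) * monomial n (move k j e) y)" ..
      then show ?thesis
        using fun_space.span_scale[OF fun_space.span_base[OF imageI[OF 3(4)]]] by simp
    next
      case 1
      then have "g k = 0" by (simp add: g_def zero_fun_def)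
      then show ?thesis using fun_space.span_zero by metis
    next
      case 2
      then have "g k = 0" by (simp add: g_def zero_fun_def)
      then show ?thesis using fun_space.span_zero by metis
    qed
  qed
  have "derivation X (monomial n e) = (\<Sum>k<n. g k)"
    by (simp add: g_def fun_eq_iff sum_apply derivation_monomial)
  also have "\<dots> \<in> fun_space.span (monomial n ` B)"
    using g by (auto intro: fun_space.span_sum)
  finally have "(\<lambda>y. c * derivation X (monomial n e) y) \<in> fun_space.span (monomial n ` B)"
    by (rule fun_space.span_scale)
  from fun_space.span_add[OF this add(3)] show ?case
    unfolding derivation_lincomb[OF add(2)] plus_fun_def .
qed

lemma raising_weight_space:
  assumes "G \<in> weight_space d i K m"
  shows "derivation (raising_field d) G \<in> weight_space d i K (m + 2)"
  using assms unfolding weight_space_def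
proof (rule derivation_move_span)
  fix k assume k: "k < d + 3"
  consider "1 \<le> k \<and> k \<le> d" | "k = d + 2" | "k = 0 \<or> k = d + 1" using k by linarith
  then show "(\<forall>y. raising_field d y k = 0) \<or> (\<exists>c j. j < d + 3 \<and> j \<noteq> k \<and>
    (\<forall>y. raising_field d y k = c * y j) \<and>
    (\<forall>e\<in>weight_exps d i K m. 0 < e k \<longrightarrow> move k j e \<in> weight_exps d i K (m + 2)))"
  proof cases
    case 1
    have "move k (k - 1) e \<in> weight_exps d i K (m + 2)"
      if "e \<in> weight_exps d i K m" "e k > 0" for e
      using move_weight_exps[OF that, of "k - 1"] 1
      by (auto simp: coord_weight_def of_nat_diff split: if_splits)
    then show ?thesis using 1 k
      by (intro disjI2 exI[of _ "of_nat (d + 1 - k)"] exI[of _ "k - 1"]) (auto simp: raising_field_def)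
  next
    case 2
    have "move k (d + 1) e \<in> weight_exps d i K (m + 2)"
      if "e \<in> weight_exps d i K m" "e k > 0" for e
      using move_weight_exps[OF that, of "d + 1"] 2 by (auto simp: coord_weight_def add.commute)
    then show ?thesis using 2
      by (intro disjI2 exI[of _ 1] exI[of _ "d + 1"]) (auto simp: raising_field_def)
  qed (auto simp: raising_field_def)
qed

lemma lowering_weight_space:
  assumes "G \<in> weight_space d i K m"
  shows "derivation (lowering_field d) G \<in> weight_space d i K (m - 2)"
  using assms unfolding weight_space_def
proof (rule derivation_move_span)
  fix k assume k: "k < d + 3"
  consider "k < d" | "k = d + 1" | "k = d \<or> k = d + 2" using k by linarith
  then show "(\<forall>y. lowering_field d y k = 0) \<or> (\<exists>c j. j < d + 3 \<and> j \<noteq> k \<and>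
    (\<forall>y. lowering_field d y k = c * y j) \<and>
    (\<forall>e\<in>weight_exps d i K m. 0 < e k \<longrightarrow> move k j e \<in> weight_exps d i K (m - 2)))"
  proof cases
    case 1
    have "move k (k + 1) e \<in> weight_exps d i K (m - 2)"
      if "e \<in> weight_exps d i K m" "e k > 0" for e
      using move_weight_exps[OF that, of "k + 1"] 1
      by (auto simp: coord_weight_def split: if_splits)
    then show ?thesis using 1 k
      by (intro disjI2 exI[of _ "of_nat (k + 1)"] exI[of _ "k + 1"]) (auto simp: lowering_field_def)
  next
    case 2
    have "move k (d + 2) e \<in> weight_exps d i K (m - 2)"
      if "e \<in> weight_exps d i K m" "e k > 0" for e
      using move_weight_exps[OF that, of "d + 2"] 2 by (auto simp: coord_weight_def)
    then show ?thesis using 2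
      by (intro disjI2 exI[of _ 1] exI[of _ "d + 2"]) (auto simp: lowering_field_def)
  qed (auto simp: lowering_field_def)
qed

definition weight_field :: "nat \<Rightarrow> (nat \<Rightarrow> complex) \<Rightarrow> nat \<Rightarrow> complex" where
  "weight_field d y k = of_int (coord_weight d k) * y k"

lemma poly_function_raising_field: "poly_function (\<lambda>y. raising_field d y k)"
  unfolding raising_field_def
  by (cases "1 \<le> k \<and> k \<le> d"; cases "k = d + 2") (auto intro!: poly_function.mult poly_function.const poly_function.coord)

lemma poly_function_lowering_field: "poly_function (\<lambda>y. lowering_field d y k)"
  unfolding lowering_field_def
  by (cases "k < d"; cases "k = d + 1") (auto intro!: poly_function.mult poly_function.const poly_function.coord)

lemma derivation_weight_field_monomial:
  "derivation (weight_field d) (monomial (d + 3) e) y = of_int (weight d e) * monomial (d + 3) e y"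
proof -
  have "derivation (weight_field d) (monomial (d + 3) e) y =
     (\<Sum>k<d + 3. of_int (coord_weight d k * int (e k)) * monomial (d + 3) e y)"
    unfolding derivation_monomial
  proof (intro sum.cong refl)
    fix k assume "k \<in> {..<d + 3}"
    then have "y k * monomial (d + 3) (e(k := e k - 1)) y = monomial (d + 3) e y" if "e k > 0"
      using that coord_times_monomial[of k "d + 3" y "e(k := e k - 1)"] by simp
    then show "of_nat (e k) * weight_field d y k * monomial (d + 3) (e(k := e k - 1)) y =
        of_int (coord_weight d k * int (e k)) * monomial (d + 3) e y"
      by (cases "e k = 0") (auto simp: weight_field_def mult_ac)
  qed
  then show ?thesis by (simp add: weight_def sum_distrib_right)
qed

lemma derivation_weight_field:
  assumes "G \<in> weight_space d i K m"
  shows "derivation (weight_field d) G = (\<lambda>y. of_int m * G y)"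
  using assms unfolding weight_space_def
proof (induction rule: span_monomials_induct)
  case zero
  show ?case using derivation_const[of "weight_field d" 0] by (simp add: zero_fun_def)
next
  case (add c e H)
  then have m: "weight d e = m" by (simp add: weight_exps_def)
  show ?case
    by (rule ext) (simp only: derivation_lincomb[OF add(2)] add(3)
        derivation_weight_field_monomial m distrib_left mult.left_commute)
qed

text \<open>
  On the coordinate \<open>y k\<close> with \<open>k \<le> d\<close> the commutator multiplies by
  \<open>(k + 1) (d - k) - (d + 1 - k) k = d - 2 k\<close>, the weight of that coordinate.
\<close>

lemma sl2_commutator:
  assumes "G \<in> weight_space d i K m"
  shows "derivation (raising_field d) (derivation (lowering_field d) G) =
    derivation (lowering_field d) (derivation (raising_field d) G) + (\<lambda>y. of_int m * G y)"
proof
  fix y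
  have "weight_field d y k = derivation (raising_field d) (\<lambda>y. lowering_field d y k) y -
      derivation (lowering_field d) (\<lambda>y. raising_field d y k) y" for y k
  proof -
    consider "k = 0 \<and> d = 0" | "k = 0 \<and> d > 0" | "1 \<le> k \<and> k < d" | "1 \<le> k \<and> k = d" | "k = d + 1" | "k = d + 2" | "k > d + 2"
      by linarith
    then show ?thesis
    proof cases
      case 3
      then have "(\<lambda>y. lowering_field d y k) = (\<lambda>y. of_nat (k + 1) * y (k + 1))"
        "(\<lambda>y. raising_field d y k) = (\<lambda>y. of_nat (d + 1 - k) * y (k - 1))"
        by (auto simp: lowering_field_def raising_field_def)
      then show ?thesis using 3
        by (simp only: derivation_cmult[OF poly_function.coord] derivation_coord)
          (auto simp: raising_field_def lowering_field_def weight_field_def coord_weight_def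
            of_nat_diff algebra_simps)
    next
      case 4
      then have "(\<lambda>y. lowering_field d y k) = (\<lambda>y. 0)"
        "(\<lambda>y. raising_field d y k) = (\<lambda>y. of_nat (d + 1 - k) * y (k - 1))"
        by (auto simp: lowering_field_def raising_field_def)
      then show ?thesis using 4
        by (simp only: derivation_cmult[OF poly_function.coord] derivation_coord derivation_const)
          (auto simp: raising_field_def lowering_field_def weight_field_def coord_weight_def
            of_nat_diff algebra_simps)
    qed (auto simp: raising_field_def lowering_field_def weight_field_def coord_weight_def
            derivation_cmult poly_function.coord)
  qed
  from derivation_commutator[OF poly_function_raising_field poly_function_lowering_field this poly_function_weight_space[OF assms]]
  show "derivation (raising_field d) (derivation (lowering_field d) G) y =
    (derivation (lowering_field d) (derivation (raising_field d) G) + (\<lambda>y. of_int m * G y)) y"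
    by (simp add: derivation_weight_field[OF assms] algebra_simps)
qed

lemma weight_bounded: "\<exists>M. \<forall>m v. \<bar>m\<bar> > M \<longrightarrow> v \<in> weight_space d i K m \<longrightarrow> v = 0"
proof -
  define M where "M = Max (insert 0 ((\<lambda>e. \<bar>weight d e\<bar>) ` (\<Union>m. weight_exps d i K m)))"
  have "weight_exps d i K m = {}" if "\<bar>m\<bar> > M" for m
  proof (rule ccontr)
    assume "weight_exps d i K m \<noteq> {}"
    then obtain e where e: "e \<in> weight_exps d i K m" by blast
    then have "\<bar>weight d e\<bar> \<in> insert 0 ((\<lambda>e. \<bar>weight d e\<bar>) ` (\<Union>m. weight_exps d i K m))"
      by blast
    then have "\<bar>weight d e\<bar> \<le> M"
      unfolding M_def using finite_weight_exps_UN[of d i K] by (intro Max_ge) auto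
    then show False using e that by (simp add: weight_exps_def)
  qed
  then show ?thesis by (intro exI[of _ M]) (auto simp: weight_space_def)
qed

lemma sl2_weight_spaces_polynomials:
  "sl2_weight_spaces (\<lambda>c F p. c * F p) (weight_space d i K)
     (derivation (raising_field d)) (derivation (lowering_field d))"
proof (intro sl2_weight_spaces.intro sl2_weight_spaces_axioms.intro vector_space_fun_scale)
  show "fun_space.subspace (weight_space d i K m)" for m
    by (simp add: weight_space_def)
  show "\<exists>M. \<forall>m v. \<bar>m\<bar> > M \<longrightarrow> v \<in> weight_space d i K m \<longrightarrow> v = 0"
    by (rule weight_bounded)
qed (simp_all add: derivation_add_fun[OF poly_function_weight_space poly_function_weight_space]
    derivation_cmult[OF poly_function_weight_space] raising_weight_space lowering_weight_space sl2_commutator)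

text \<open>
  The raising operator maps weight \<open>0\<close> onto weight \<open>2\<close>, and the monomials are bases of both spaces.
\<close>

lemma raising_kernel_basis:
  obtains D where "fun_space.independent D" "finite D"
    "fun_space.span D = {G \<in> weight_space d i K 0. derivation (raising_field d) G = 0}"
    "card D + card (weight_exps d i K 2) = card (weight_exps d i K 0)"
proof -
  interpret sl2_weight_spaces "\<lambda>c F p. c * F p" "weight_space d i K"
    "derivation (raising_field d)" "derivation (lowering_field d)"
    by (rule sl2_weight_spaces_polynomials)
  have card: "card (monomial (d + 3) ` weight_exps d i K m) = card (weight_exps d i K m)" for m
    by (rule card_image[OF inj_on_subset[OF inj_monomial weight_exps_subset]])
  have 1: "derivation (raising_field d) ` fun_space.span (monomial (d + 3) ` weight_exps d i K 0) =
      fun_space.span (monomial (d + 3) ` weight_exps d i K 2)"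
    using E_W[of _ 0] E_surjective_above_0[of 2] unfolding weight_space_def by fastforce
  obtain D where "fun_space.independent D" "finite D"
    "fun_space.span D = {G \<in> weight_space d i K 0. derivation (raising_field d) G = 0}"
    "card D + card (monomial (d + 3) ` weight_exps d i K 2) = card (monomial (d + 3) ` weight_exps d i K 0)"
  proof (rule fun_space.rank_nullity_on_subspace[OF
        independent_monomials[OF finite_weight_exps weight_exps_subset] _
        independent_monomials[OF finite_weight_exps weight_exps_subset] _ _ _ 1],
      goal_cases)
    case (5 D)
    then show ?thesis using that by (simp add: weight_space_def)
  qed (use E_add E_scale finite_weight_exps in \<open>auto simp: weight_space_def\<close>)
  then show ?thesis using that card by simp
qed


section \<open>Substitutions in binary forms\<close>

definition subst_form :: "complex^2^2 \<Rightarrow> bform \<Rightarrow> bform" where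
  "subst_form m f = (\<lambda>v. f (m *v v))"

definition upper :: "complex \<Rightarrow> complex^2^2" where
  "upper t = vector [vector [1, t], vector [0, 1]]"

definition lower :: "complex \<Rightarrow> complex^2^2" where
  "lower t = vector [vector [1, 0], vector [t, 1]]"

text \<open>
  A single element of the torus suffices to detect the weight, because \<open>2\<close> is not a root of unity.
\<close>

definition torus_elem :: "complex^2^2" where
  "torus_elem = vector [vector [2, 0], vector [0, 1 / 2]]"

lemma matrix_vector_2:
  fixes m :: "complex^2^2"
  shows "vec_nth (m *v v) 1 = vec_nth (vec_nth m 1) 1 * vec_nth v 1 + vec_nth (vec_nth m 1) 2 * vec_nth v 2"
    and "vec_nth (m *v v) 2 = vec_nth (vec_nth m 2) 1 * vec_nth v 1 + vec_nth (vec_nth m 2) 2 * vec_nth v 2"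
  by (simp_all add: matrix_vector_mult_def sum_2)

lemma det_upper: "det (upper t) = 1" and det_lower: "det (lower t) = 1"
  and det_torus_elem: "det torus_elem = 1"
  by (simp_all add: det_2 upper_def lower_def torus_elem_def vector_2)

lemma subst_form_mult: "subst_form (m ** n) f = subst_form n (subst_form m f)"
  by (simp add: subst_form_def matrix_vector_mul_assoc)

lemma matrix_eq_2:
  fixes m n :: "complex^2^2"
  assumes "vec_nth (vec_nth m 1) 1 = vec_nth (vec_nth n 1) 1"
    "vec_nth (vec_nth m 1) 2 = vec_nth (vec_nth n 1) 2"
    "vec_nth (vec_nth m 2) 1 = vec_nth (vec_nth n 2) 1"
    "vec_nth (vec_nth m 2) 2 = vec_nth (vec_nth n 2) 2"
  shows "m = n"
  using assms by (simp add: vec_eq_iff forall_2)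

lemma matrix_mult_2:
  fixes m n :: "complex^2^2"
  shows "vec_nth (vec_nth (m ** n) i) j =
    vec_nth (vec_nth m i) 1 * vec_nth (vec_nth n 1) j + vec_nth (vec_nth m i) 2 * vec_nth (vec_nth n 2) j"
  by (simp add: matrix_matrix_mult_def sum_2)

lemma SL2_factorization:
  assumes "det m = 1" "vec_nth (vec_nth m 2) 1 \<noteq> 0"
  shows "\<exists>r s t. m = upper r ** lower s ** upper t"
proof -
  define a b c e where "a = vec_nth (vec_nth m 1) 1" "b = vec_nth (vec_nth m 1) 2"
    "c = vec_nth (vec_nth m 2) 1" "e = vec_nth (vec_nth m 2) 2"
  note defs = this
  have det: "a * e - b * c = 1" "c \<noteq> 0" using assms by (simp_all add: det_2 defs)
  have det': "1 + b * c = a * e" using det(1) by (simp add: algebra_simps)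
  have key: "a * (c * e) = c + b * (c * c)" using det(1) by algebra
  have "m = upper ((a - 1) / c) ** lower c ** upper ((e - 1) / c)"
    using det(2)
    by (intro matrix_eq_2)
      (simp_all add: matrix_mult_2 upper_def lower_def vector_2 defs[symmetric] field_simps key det')
  then show ?thesis by blast
qed

text \<open>
  A matrix whose lower left entry is nonzero is a product of three unipotent matrices. Multiplication by
  \<open>lower 1\<close> makes that entry nonzero if it is zero.
\<close>

lemma SL2_generated:
  assumes one: "\<And>t. P (upper t)" "\<And>t. P (lower t)"
    and mult: "\<And>m n. P m \<Longrightarrow> P n \<Longrightarrow> P (m ** n)"
    and "det m = 1"
  shows "P m"
proof (cases "vec_nth (vec_nth m 2) 1 = 0")
  case False
  then show ?thesis using SL2_factorization[OF assms(4)] one mult by metis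
next
  case True
  then have e: "vec_nth (vec_nth m 2) 2 \<noteq> 0" using assms(4) by (auto simp: det_2)
  have "det (m ** lower 1) = 1" using assms(4) by (simp add: det_mul det_lower)
  moreover have "vec_nth (vec_nth (m ** lower 1) 2) 1 \<noteq> 0"
    using e True by (simp add: matrix_mult_2 lower_def vector_2)
  ultimately have "P (m ** lower 1)" using SL2_factorization one mult by metis
  then have "P (m ** lower 1 ** lower (-1))" using one mult by blast
  moreover have "m ** lower 1 ** lower (-1) = m"
    by (intro matrix_eq_2) (simp_all add: matrix_mult_2 lower_def vector_2)
  ultimately show ?thesis by simp
qed

lemma binary_form_cong:
  "(\<And>k. k \<le> n \<Longrightarrow> a k = b k) \<Longrightarrow> binary_form n a = binary_form n b"
  unfolding binary_form_def by (auto intro!: sum.cong)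

lemma binary_form_eqD:
  assumes "binary_form n a = binary_form n b" "k \<le> n"
  shows "a k = b k"
proof -
  define p where "p = (\<Sum>k\<le>n. monom (a k - b k) k)"
  have "poly p t = 0" for t
  proof -
    have "binary_form n a (vector [1, t]) = binary_form n b (vector [1, t])"
      using assms(1) by simp
    then show ?thesis
      by (simp add: binary_form_def vector_2 p_def poly_sum poly_monom sum_subtractf algebra_simps)
  qed
  then have "p = 0" by (metis poly_all_0_iff_0)
  moreover have "coeff p k = a k - b k"
    using assms(2) by (simp add: p_def coeff_sum if_distrib sum.delta cong: if_cong)
  ultimately show ?thesis by simp
qed

definition upper_coeffs :: "nat \<Rightarrow> complex \<Rightarrow> (nat \<Rightarrow> complex) \<Rightarrow> nat \<Rightarrow> complex" where
  "upper_coeffs n t a k = (\<Sum>l\<le>k. of_nat ((n - l) choose (k - l)) * t ^ (k - l) * a l)"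

definition lower_coeffs :: "nat \<Rightarrow> complex \<Rightarrow> (nat \<Rightarrow> complex) \<Rightarrow> nat \<Rightarrow> complex" where
  "lower_coeffs n t a k = (\<Sum>l=k..n. of_nat (l choose k) * t ^ (l - k) * a l)"

lemma subst_form_upper:
  "subst_form (upper t) (binary_form n a) = binary_form n (upper_coeffs n t a)"
proof
  fix v :: "complex^2"
  define x y where "x = vec_nth v 1" and "y = vec_nth v 2"
  have "subst_form (upper t) (binary_form n a) v = (\<Sum>l\<le>n. a l * (t * y + x) ^ (n - l) * y ^ l)"
    by (simp add: subst_form_def binary_form_def matrix_vector_2 upper_def vector_2 x_def y_def add.commute)
  also have "\<dots> = (\<Sum>l\<le>n. \<Sum>j\<le>n - l. a l * (of_nat ((n - l) choose j) * (t * y) ^ j * x ^ (n - l - j)) * y ^ l)"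
    by (simp add: binomial_ring sum_distrib_left sum_distrib_right)
  also have "\<dots> = (\<Sum>(l, j)\<in>(SIGMA l:{..n}. {..n - l}). a l * (of_nat ((n - l) choose j) * (t * y) ^ j * x ^ (n - l - j)) * y ^ l)"
    by (simp add: sum.Sigma)
  also have "\<dots> = (\<Sum>(k, l)\<in>(SIGMA k:{..n}. {..k}).
      of_nat ((n - l) choose (k - l)) * t ^ (k - l) * a l * x ^ (n - k) * y ^ k)"
  proof (intro sum.reindex_bij_witness[of _ "\<lambda>(k, l). (l, k - l)" "\<lambda>(l, j). (l + j, l)"], goal_cases)
    case (5 p)
    then obtain l j where p: "p = (l, j)" "l \<le> n" "j \<le> n - l" by auto
    then have "n - (l + j) = n - l - j" by simp
    then show ?case using p by (simp add: power_mult_distrib power_add mult_ac)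
  qed auto
  also have "\<dots> = (\<Sum>k\<le>n. \<Sum>l\<le>k. of_nat ((n - l) choose (k - l)) * t ^ (k - l) * a l * x ^ (n - k) * y ^ k)"
    by (simp add: sum.Sigma)
  also have "\<dots> = binary_form n (upper_coeffs n t a) v"
    by (simp add: binary_form_def upper_coeffs_def x_def y_def sum_distrib_right)
  finally show "subst_form (upper t) (binary_form n a) v = binary_form n (upper_coeffs n t a) v" .
qed

lemma subst_form_lower:
  "subst_form (lower t) (binary_form n a) = binary_form n (lower_coeffs n t a)"
proof
  fix v :: "complex^2"
  define x y where "x = vec_nth v 1" and "y = vec_nth v 2"
  have "subst_form (lower t) (binary_form n a) v = (\<Sum>l\<le>n. a l * x ^ (n - l) * (y + t * x) ^ l)"
    by (simp add: subst_form_def binary_form_def matrix_vector_2 lower_def vector_2 x_def y_def add.commute)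
  also have "\<dots> = (\<Sum>l\<le>n. \<Sum>k\<le>l. a l * x ^ (n - l) * (of_nat (l choose k) * y ^ k * (t * x) ^ (l - k)))"
    by (simp add: binomial_ring sum_distrib_left)
  also have "\<dots> = (\<Sum>(l, k)\<in>(SIGMA l:{..n}. {..l}). a l * x ^ (n - l) * (of_nat (l choose k) * y ^ k * (t * x) ^ (l - k)))"
    by (simp add: sum.Sigma)
  also have "\<dots> = (\<Sum>(k, l)\<in>(SIGMA k:{..n}. {k..n}).
      of_nat (l choose k) * t ^ (l - k) * a l * x ^ (n - k) * y ^ k)"
  proof (intro sum.reindex_bij_witness[of _ "\<lambda>(k, l). (l, k)" "\<lambda>(l, k). (k, l)"], goal_cases)
    case (5 p)
    then obtain l k where p: "p = (l, k)" "l \<le> n" "k \<le> l" by auto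
    then have "x ^ (n - k) = x ^ (n - l) * x ^ (l - k)" by (simp flip: power_add)
    then show ?case using p by (simp add: power_mult_distrib mult_ac)
  qed auto
  also have "\<dots> = (\<Sum>k\<le>n. \<Sum>l=k..n. of_nat (l choose k) * t ^ (l - k) * a l * x ^ (n - k) * y ^ k)"
    by (simp add: sum.Sigma)
  also have "\<dots> = binary_form n (lower_coeffs n t a) v"
    by (simp add: binary_form_def lower_coeffs_def x_def y_def sum_distrib_right)
  finally show "subst_form (lower t) (binary_form n a) v = binary_form n (lower_coeffs n t a) v" .
qed

lemma subst_form_torus:
  "subst_form torus_elem (binary_form n a) = binary_form n (\<lambda>k. 2 powi (int n - 2 * int k) * a k)"
proof
  fix v :: "complex^2"
  have *: "(2 * x) ^ (n - k) * (y / 2) ^ k = 2 powi (int n - 2 * int k) * (x ^ (n - k) * y ^ k)"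
    if "k \<le> n" for x y :: complex and k
  proof -
    have "(2::complex) powi (int n - 2 * int k) = 2 powi (int (n - k) - int k)"
      using that by (simp add: of_nat_diff algebra_simps)
    also have "\<dots> = 2 ^ (n - k) / 2 ^ k" by (simp add: power_int_diff)
    finally show ?thesis by (simp add: power_mult_distrib power_divide)
  qed
  show "subst_form torus_elem (binary_form n a) v = binary_form n (\<lambda>k. 2 powi (int n - 2 * int k) * a k) v"
    unfolding subst_form_def binary_form_def matrix_vector_2
  proof (intro sum.cong refl, goal_cases)
    case (1 k)
    then show ?case
      using *[of k "vec_nth v 1" "vec_nth v 2"] by (simp add: torus_elem_def vector_2 mult_ac)
  qed
qed

text \<open>
  The orbits of the unipotent one-parameter groups, in coordinates; they are integral curves of the raising
  and the lowering field.
\<close>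

definition upper_flow :: "nat \<Rightarrow> complex \<Rightarrow> (nat \<Rightarrow> complex) \<Rightarrow> nat \<Rightarrow> complex" where
  "upper_flow d t y k =
     (if k \<le> d then upper_coeffs d t y k else if k = d + 2 then y (d + 2) + t * y (d + 1) else y k)"

definition lower_flow :: "nat \<Rightarrow> complex \<Rightarrow> (nat \<Rightarrow> complex) \<Rightarrow> nat \<Rightarrow> complex" where
  "lower_flow d t y k =
     (if k \<le> d then lower_coeffs d t y k else if k = d + 1 then y (d + 1) + t * y (d + 2) else y k)"

lemma upper_flow_0: "k < d + 3 \<Longrightarrow> upper_flow d 0 y k = y k"
proof -
  have "upper_coeffs d 0 y k = y k" for k
  proof -
    have "upper_coeffs d 0 y k = (\<Sum>l\<in>{k}. of_nat ((d - l) choose (k - l)) * 0 ^ (k - l) * y l)"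
      unfolding upper_coeffs_def by (rule sum.mono_neutral_right) auto
    then show ?thesis by simp
  qed
  then show ?thesis by (simp add: upper_flow_def)
qed

lemma lower_flow_0: "k < d + 3 \<Longrightarrow> lower_flow d 0 y k = y k"
proof -
  have "lower_coeffs d 0 y k = y k" if "k \<le> d" for k
  proof -
    have "lower_coeffs d 0 y k = (\<Sum>l\<in>{k}. of_nat (l choose k) * 0 ^ (l - k) * y l)"
      unfolding lower_coeffs_def by (rule sum.mono_neutral_right) (use that in auto)
    then show ?thesis by simp
  qed
  then show ?thesis by (simp add: lower_flow_def)
qed

text \<open>
  For \<open>k \<le> d\<close> this is the identity \<open>(k - l) ((d - l) choose (k - l)) =
  (d + 1 - k) ((d - l) choose (k - 1 - l))\<close> in each coefficient.
\<close>

lemma upper_flow_derivative: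
  "((\<lambda>t. upper_flow d t y k) has_field_derivative raising_field d (upper_flow d t y) k) (at t)"
proof -
  have main: "((\<lambda>t. upper_coeffs d t y k) has_field_derivative
      (if k = 0 then 0 else of_nat (d + 1 - k) * upper_coeffs d t y (k - 1))) (at t)" if "k \<le> d"
  proof -
    have "((\<lambda>t. upper_coeffs d t y k) has_field_derivative
       (\<Sum>l\<le>k. of_nat ((d - l) choose (k - l)) * (of_nat (k - l) * t ^ (k - l - 1)) * y l)) (at t)"
      unfolding upper_coeffs_def by (auto intro!: derivative_eq_intros sum.cong)
    also have "(\<Sum>l\<le>k. of_nat ((d - l) choose (k - l)) * (of_nat (k - l) * t ^ (k - l - 1)) * y l) =
       (if k = 0 then 0 else of_nat (d + 1 - k) * upper_coeffs d t y (k - 1))"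
    proof (cases k)
      case (Suc j)
      have "(\<Sum>l\<le>k. of_nat ((d - l) choose (k - l)) * (of_nat (k - l) * t ^ (k - l - 1)) * y l) =
        (\<Sum>l\<le>j. of_nat ((d - l) choose (k - l)) * (of_nat (k - l) * t ^ (k - l - 1)) * y l)"
        by (simp add: Suc)
      also have "\<dots> = (\<Sum>l\<le>j. of_nat (d + 1 - k) * (of_nat ((d - l) choose (j - l)) * t ^ (j - l) * y l))"
      proof (intro sum.cong refl)
        fix l assume "l \<in> {..j}"
        then have l: "k - l = Suc (j - l)" "d - l - (j - l) = d + 1 - k" using Suc that by auto
        have "Suc (j - l) * ((d - l) choose Suc (j - l)) = (d - l - (j - l)) * ((d - l) choose (j - l))"
          using binomial_absorb_comp[of "d - l" "j - l"] binomial_absorption[of "j - l" "d - l"]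
          by (metis binomial_fact_lemma choose_mult_lemma Suc_times_binomial_eq times_binomial_minus1_eq mult.commute)
        then have "of_nat ((d - l) choose (k - l)) * of_nat (k - l) = (of_nat (d + 1 - k) * of_nat ((d - l) choose (j - l)) :: complex)"
          unfolding l by (metis mult.commute of_nat_mult)
        then show "of_nat ((d - l) choose (k - l)) * (of_nat (k - l) * t ^ (k - l - 1)) * y l =
          of_nat (d + 1 - k) * (of_nat ((d - l) choose (j - l)) * t ^ (j - l) * y l)"
          using l(1) by (metis (no_types, opaque_lifting) diff_Suc_1 mult.assoc)
      qed
      finally show ?thesis using Suc by (simp add: upper_coeffs_def sum_distrib_left)
    qed auto
    finally show ?thesis .
  qed
  consider "k \<le> d" | "k = d + 2" | "k > d" "k \<noteq> d + 2" by linarith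
  then show ?thesis
  proof cases
    case 1
    then show ?thesis using main by (auto simp: upper_flow_def raising_field_def)
  qed (auto simp: upper_flow_def raising_field_def intro!: derivative_eq_intros)
qed

text \<open>
  For \<open>k \<le> d\<close> this is the identity \<open>(l - k) (l choose k) = (k + 1) (l choose (k + 1))\<close> in each coefficient.
\<close>

lemma lower_flow_derivative:
  "((\<lambda>t. lower_flow d t y k) has_field_derivative lowering_field d (lower_flow d t y) k) (at t)"
proof -
  have main: "((\<lambda>t. lower_coeffs d t y k) has_field_derivative
      (if k = d then 0 else of_nat (k + 1) * lower_coeffs d t y (k + 1))) (at t)" if "k \<le> d"
  proof -
    have "((\<lambda>t. lower_coeffs d t y k) has_field_derivative
       (\<Sum>l=k..d. of_nat (l choose k) * (of_nat (l - k) * t ^ (l - k - 1)) * y l)) (at t)"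
      unfolding lower_coeffs_def by (auto intro!: derivative_eq_intros sum.cong)
    also have "(\<Sum>l=k..d. of_nat (l choose k) * (of_nat (l - k) * t ^ (l - k - 1)) * y l) =
      (\<Sum>l=Suc k..d. of_nat (l choose k) * (of_nat (l - k) * t ^ (l - k - 1)) * y l)"
      using that by (simp add: sum.atLeast_Suc_atMost)
    also have "\<dots> = (\<Sum>l=Suc k..d. of_nat (k + 1) * (of_nat (l choose Suc k) * t ^ (l - Suc k) * y l))"
    proof (intro sum.cong refl)
      fix l assume l: "l \<in> {Suc k..d}"
      have "(l choose k) * (l - k) = (k + 1) * (l choose Suc k)"
        using binomial_absorb_comp[of l k] binomial_absorption[of k l]
        by (metis Suc_eq_plus1 mult.commute)
      then have "of_nat (l choose k) * of_nat (l - k) = (of_nat (k + 1) * of_nat (l choose Suc k) :: complex)"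
        by (metis of_nat_mult)
      then show "of_nat (l choose k) * (of_nat (l - k) * t ^ (l - k - 1)) * y l =
          of_nat (k + 1) * (of_nat (l choose Suc k) * t ^ (l - Suc k) * y l)"
        by (metis (no_types, opaque_lifting) diff_diff_left Suc_eq_plus1 mult.assoc)
    qed
    also have "\<dots> = (if k = d then 0 else of_nat (k + 1) * lower_coeffs d t y (k + 1))"
      by (simp add: lower_coeffs_def sum_distrib_left)
    finally show ?thesis .
  qed
  consider "k \<le> d" | "k = d + 1" | "k > d" "k \<noteq> d + 1" by linarith
  then show ?thesis
  proof cases
    case 1
    then show ?thesis using main by (auto simp: lower_flow_def lowering_field_def)
  qed (auto simp: lower_flow_def lowering_field_def intro!: derivative_eq_intros)
qed


section \<open>Covariants as polynomial functions killed by the raising operator\<close>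

definition form_pair :: "nat \<Rightarrow> (nat \<Rightarrow> complex) \<Rightarrow> bform \<times> bform" where
  "form_pair d y = (binary_form 1 (\<lambda>j. y (d + 1 + j)), binary_form d y)"

definition subst_pair :: "complex^2^2 \<Rightarrow> bform \<times> bform \<Rightarrow> bform \<times> bform" where
  "subst_pair m p = (subst_form m (fst p), subst_form m (snd p))"

lemma range_form_pair: "range (form_pair d) = V 1 \<times> V d"
proof
  show "range (form_pair d) \<subseteq> V 1 \<times> V d" by (auto simp: form_pair_def V_def)
  show "V 1 \<times> V d \<subseteq> range (form_pair d)"
  proof
    fix p assume "p \<in> V 1 \<times> V d"
    then obtain x a where p: "p = (binary_form 1 x, binary_form d a)" by (auto simp: V_def)
    have "form_pair d (\<lambda>k. if k \<le> d then a k else x (k - (d + 1))) = p"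
      unfolding p form_pair_def by (auto intro!: binary_form_cong)
    then show "p \<in> range (form_pair d)" by (metis rangeI)
  qed
qed

lemma form_pair_eqD:
  assumes "form_pair d y = form_pair d y'" "k < d + 3"
  shows "y k = y' k"
proof (cases "k \<le> d")
  case True
  then show ?thesis using assms(1) binary_form_eqD[of d y y'] by (simp add: form_pair_def)
next
  case False
  then have "k = d + 1 + (k - (d + 1))" "k - (d + 1) \<le> 1" using assms(2) by auto
  then show ?thesis
    using assms(1) binary_form_eqD[of 1 "\<lambda>j. y (d + 1 + j)" "\<lambda>j. y' (d + 1 + j)" "k - (d + 1)"]
    by (simp add: form_pair_def)
qed

lemma form_pair_upper: "subst_pair (upper t) (form_pair d y) = form_pair d (upper_flow d t y)"
proof -
  have "upper_coeffs 1 t (\<lambda>j. y (d + 1 + j)) k = upper_flow d t y (d + 1 + k)" if "k \<le> 1" for k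
    using that by (cases k) (auto simp: upper_coeffs_def upper_flow_def atMost_Suc)
  then show ?thesis
    by (auto simp: subst_pair_def form_pair_def subst_form_upper upper_flow_def
        intro!: binary_form_cong)
qed

lemma form_pair_lower: "subst_pair (lower t) (form_pair d y) = form_pair d (lower_flow d t y)"
proof -
  have "{Suc 0..1} = {1::nat}" "{0..1} = {0, 1::nat}" by auto
  then have "lower_coeffs 1 t (\<lambda>j. y (d + 1 + j)) k = lower_flow d t y (d + 1 + k)" if "k \<le> 1" for k
    using that by (cases k) (auto simp: lower_coeffs_def lower_flow_def)
  then show ?thesis
    by (auto simp: subst_pair_def form_pair_def subst_form_lower lower_flow_def
        intro!: binary_form_cong)
qed

lemma form_pair_torus:
  "subst_pair torus_elem (form_pair d y) = form_pair d (\<lambda>k. 2 powi (coord_weight d k) * y k)"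
proof -
  have "2 powi (int 1 - 2 * int k) * y (d + 1 + k) = 2 powi coord_weight d (d + 1 + k) * y (d + 1 + k)"
    if "k \<le> 1" for k
    using that by (cases k) (auto simp: coord_weight_def)
  then show ?thesis
    unfolding subst_pair_def form_pair_def subst_form_torus fst_conv snd_conv prod.inject
    by (auto simp: coord_weight_def intro!: binary_form_cong)
qed

lemma matrix_inv_det_1:
  fixes g :: "complex^2^2"
  assumes "det g = 1"
  shows "det (matrix_inv g) = 1" "matrix_inv (matrix_inv g) = g"
proof -
  have "\<exists>h. g ** h = mat 1 \<and> h ** g = mat 1"
    using assms invertible_det_nz[of g] by (auto simp: invertible_def)
  then have inv: "g ** matrix_inv g = mat 1 \<and> matrix_inv g ** g = mat 1"
    unfolding matrix_inv_def by (rule someI_ex)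
  then have "det g * det (matrix_inv g) = 1" by (metis det_I det_mul)
  then show "det (matrix_inv g) = 1" using assms by simp
  have "\<exists>h. matrix_inv g ** h = mat 1 \<and> h ** matrix_inv g = mat 1" using inv by blast
  then have "matrix_inv g ** matrix_inv (matrix_inv g) = mat 1"
    unfolding matrix_inv_def[of "matrix_inv g"] by (rule someI2_ex) simp
  then show "matrix_inv (matrix_inv g) = g"
    using inv by (metis matrix_mul_assoc matrix_mul_lid matrix_mul_rid)
qed

text \<open>
  The action substitutes the inverse matrix. As inversion permutes the group, invariance can be stated for
  the substitutions themselves.
\<close>

lemma covariants_subst:
  "F \<in> covariants d \<longleftrightarrow> F \<in> polynomial_functions d UNIV \<and>
     (\<forall>m. det m = 1 \<longrightarrow> (\<forall>y. F (subst_pair m (form_pair d y)) = F (form_pair d y)))"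
proof -
  have act: "act g f = subst_form (matrix_inv g) f" for g f
    by (simp add: act_def subst_form_def)
  have "(\<forall>g\<in>SL2. \<forall>l\<in>V 1. \<forall>f\<in>V d. F (act g l, act g f) = F (l, f)) \<longleftrightarrow>
    (\<forall>g\<in>SL2. \<forall>p\<in>V 1 \<times> V d. F (subst_pair (matrix_inv g) p) = F p)"
    by (auto simp: act subst_pair_def)
  also have "\<dots> \<longleftrightarrow> (\<forall>g. det g = 1 \<longrightarrow> (\<forall>y. F (subst_pair (matrix_inv g) (form_pair d y)) = F (form_pair d y)))"
    unfolding range_form_pair[symmetric] SL2_def by auto
  also have "\<dots> \<longleftrightarrow> (\<forall>m. det m = 1 \<longrightarrow> (\<forall>y. F (subst_pair m (form_pair d y)) = F (form_pair d y)))"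
    by (metis matrix_inv_det_1)
  finally show ?thesis by (simp add: covariants_def)
qed

definition pull :: "nat \<Rightarrow> (bform \<times> bform \<Rightarrow> complex) \<Rightarrow> pfun" where
  "pull d F = (\<lambda>y. F (form_pair d y))"

text \<open>
  The inverse of \<open>pull\<close> on functions of the first \<open>d + 3\<close> coordinates: for these the choice of
  coordinates for a pair of forms does not matter.
\<close>

definition push :: "nat \<Rightarrow> pfun \<Rightarrow> bform \<times> bform \<Rightarrow> complex" where
  "push d G = (\<lambda>p. if p \<in> V 1 \<times> V d then G (SOME y. form_pair d y = p) else 0)"

lemma span_monomials_depends:
  assumes "G \<in> fun_space.span (monomial n ` A)" "\<And>k. k < n \<Longrightarrow> y k = y' k"
  shows "G y = G y'"
  using assms(1)
proof (induction rule: span_monomials_induct)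
  case (add c e H)
  have "monomial n e y = monomial n e y'" unfolding monomial_def using assms(2) by (intro prod.cong) auto
  then show ?case using add by simp
qed simp

lemma push_form_pair:
  assumes "G \<in> fun_space.span (monomial (d + 3) ` A)"
  shows "push d G (form_pair d y) = G y"
proof -
  have in_V: "form_pair d y \<in> V 1 \<times> V d" using range_form_pair by (metis rangeI)
  define z where "z = (SOME z. form_pair d z = form_pair d y)"
  have "form_pair d z = form_pair d y" unfolding z_def
    by (rule someI[of "\<lambda>z. form_pair d z = form_pair d y" y]) (rule refl)
  then have "G z = G y" by (intro span_monomials_depends[OF assms] form_pair_eqD)
  then show ?thesis using in_V by (simp add: push_def z_def)
qed

lemma push_pull:
  assumes "F \<in> polynomial_functions d E"
  shows "push d (pull d F) = F"
proof
  fix p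
  show "push d (pull d F) p = F p"
  proof (cases "p \<in> V 1 \<times> V d")
    case True
    then obtain y where "form_pair d y = p" using range_form_pair by (metis imageE)
    then have "form_pair d (SOME y. form_pair d y = p) = p"
      by (rule someI[of "\<lambda>y. form_pair d y = p" y])
    then show ?thesis using True by (simp add: push_def pull_def)
  next
    case False
    then have "F p = 0" using assms unfolding polynomial_functions_def by blast
    then show ?thesis using False by (simp only: push_def if_False)
  qed
qed

definition merge_exps :: "nat \<Rightarrow> (nat \<Rightarrow> nat) \<times> (nat \<Rightarrow> nat) \<Rightarrow> nat \<Rightarrow> nat" where
  "merge_exps d p k = (if k \<le> d then snd p k else if k \<le> d + 2 then fst p (k - (d + 1)) else 0)"

definition split_exps :: "nat \<Rightarrow> (nat \<Rightarrow> nat) \<Rightarrow> (nat \<Rightarrow> nat) \<times> (nat \<Rightarrow> nat)" where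
  "split_exps d e = (\<lambda>j. if j \<le> 1 then e (d + 1 + j) else 0, \<lambda>k. if k \<le> d then e k else 0)"

lemma merge_split: "e \<in> exps (d + 3) \<Longrightarrow> merge_exps d (split_exps d e) = e"
  by (force simp: merge_exps_def split_exps_def exps_def fun_eq_iff)

lemma monomial_merge:
  "monomial (d + 3) (merge_exps d (r, s)) y = (\<Prod>j\<le>1. y (d + 1 + j) ^ r j) * (\<Prod>j\<le>d. y j ^ s j)"
proof -
  have "monomial (d + 3) e y = (\<Prod>j\<le>d. y j ^ e j) * y (d + 1) ^ e (d + 1) * y (d + 2) ^ e (d + 2)" for e
    by (simp add: monomial_def numeral_3_eq_3 lessThan_Suc_atMost[symmetric])
  then show ?thesis by (simp add: merge_exps_def atMost_Suc mult_ac)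
qed

lemma pull_polynomial:
  assumes "F \<in> polynomial_functions d {(r, s). (\<Sum>j\<le>d. s j) = i}"
  obtains K where "pull d F \<in> fun_space.span
    (monomial (d + 3) ` {e \<in> exps (d + 3). (\<Sum>k\<le>d. e k) = i \<and> e (d + 1) + e (d + 2) \<le> K})"
proof -
  obtain M c where M: "finite M" "M \<subseteq> {(r, s). (\<Sum>j\<le>d. s j) = i}"
    and F: "\<And>x a. F (binary_form 1 x, binary_form d a) =
      (\<Sum>(r, s)\<in>M. c (r, s) * (\<Prod>j\<le>1. x j ^ r j) * (\<Prod>j\<le>d. a j ^ s j))"
    using assms unfolding polynomial_functions_def by blast
  define K where "K = (\<Sum>(r, s)\<in>M. r 0 + r 1)"
  define A where "A = {e \<in> exps (d + 3). (\<Sum>k\<le>d. e k) = i \<and> e (d + 1) + e (d + 2) \<le> K}"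
  have "merge_exps d p \<in> A" if "p \<in> M" for p
  proof -
    have "(\<lambda>(r, s). r 0 + r 1) p \<le> K" unfolding K_def using M(1) that by (intro member_le_sum) auto
    then show ?thesis using M(2) that
      by (auto simp: A_def merge_exps_def exps_def split: prod.splits)
  qed
  then have "(\<Sum>p\<in>M. (\<lambda>y. c p * monomial (d + 3) (merge_exps d p) y)) \<in> fun_space.span (monomial (d + 3) ` A)"
    by (intro fun_space.span_sum fun_space.span_scale fun_space.span_base imageI)
  moreover have "pull d F = (\<Sum>p\<in>M. (\<lambda>y. c p * monomial (d + 3) (merge_exps d p) y))"
  proof
    fix y
    have "pull d F y = (\<Sum>(r, s)\<in>M. c (r, s) * (\<Prod>j\<le>1. y (d + 1 + j) ^ r j) * (\<Prod>j\<le>d. y j ^ s j))"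
      unfolding pull_def form_pair_def by (rule F)
    also have "\<dots> = (\<Sum>p\<in>M. c p * monomial (d + 3) (merge_exps d p) y)"
      by (intro sum.cong refl) (auto simp only: monomial_merge mult.assoc split: prod.splits)
    finally show "pull d F y = (\<Sum>p\<in>M. (\<lambda>y. c p * monomial (d + 3) (merge_exps d p) y)) y"
      unfolding sum_apply .
  qed
  ultimately show ?thesis using that[of K] by (simp add: A_def)
qed

lemma span_monomials_finite:
  assumes "finite A" "A \<subseteq> exps n" "G \<in> fun_space.span (monomial n ` A)"
  obtains b where "G = (\<lambda>y. \<Sum>e\<in>A. b e * monomial n e y)"
proof -
  have inj: "inj_on (monomial n) A" using inj_monomial assms(2) inj_on_subset by blast
  obtain u where "G = (\<Sum>v\<in>monomial n ` A. (\<lambda>p. u v * v p))"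
    using fun_space.span_finite[of "monomial n ` A"] assms(1,3) by auto
  then have "G = (\<lambda>y. \<Sum>e\<in>A. u (monomial n e) * monomial n e y)"
    using inj by (simp add: fun_eq_iff sum_apply sum.reindex)
  then show ?thesis using that[of "\<lambda>e. u (monomial n e)"] by simp
qed

lemma push_polynomial:
  assumes "finite A" "A \<subseteq> exps (d + 3)" "G \<in> fun_space.span (monomial (d + 3) ` A)"
    and "\<And>e. e \<in> A \<Longrightarrow> (\<Sum>k\<le>d. e k) = i"
  shows "push d G \<in> polynomial_functions d {(r, s). (\<Sum>j\<le>d. s j) = i}"
proof -
  obtain b where b: "G = (\<lambda>y. \<Sum>e\<in>A. b e * monomial (d + 3) e y)"
    using span_monomials_finite[OF assms(1-3)] .
  have inj: "inj_on (split_exps d) A" using merge_split assms(2) by (metis inj_onI subsetD)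
  have "push d G (binary_form 1 x, binary_form d a) =
      (\<Sum>(r, s)\<in>split_exps d ` A. b (merge_exps d (r, s)) * (\<Prod>j\<le>1. x j ^ r j) * (\<Prod>j\<le>d. a j ^ s j))"
    for x a
  proof -
    define y where "y k = (if k \<le> d then a k else x (k - (d + 1)))" for k
    have "form_pair d y = (binary_form 1 x, binary_form d a)"
      unfolding form_pair_def y_def by (auto intro!: binary_form_cong)
    then have "push d G (binary_form 1 x, binary_form d a) = G y"
      using push_form_pair[OF assms(3)] by metis
    also have "\<dots> = (\<Sum>e\<in>A. b (merge_exps d (split_exps d e)) * monomial (d + 3) (merge_exps d (split_exps d e)) y)"
      unfolding b using assms(2) by (intro sum.cong) (auto simp: merge_split)
    also have "\<dots> = (\<Sum>p\<in>split_exps d ` A. b (merge_exps d p) * monomial (d + 3) (merge_exps d p) y)"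
      using inj by (simp add: sum.reindex)
    also have "\<dots> = (\<Sum>(r, s)\<in>split_exps d ` A. b (merge_exps d (r, s)) * (\<Prod>j\<le>1. x j ^ r j) * (\<Prod>j\<le>d. a j ^ s j))"
    proof (intro sum.cong refl, goal_cases)
      case (1 p)
      have "(\<Prod>j\<le>1. y (d + 1 + j) ^ r j) = (\<Prod>j\<le>1. x j ^ r j)"
        "(\<Prod>j\<le>d. y j ^ s j) = (\<Prod>j\<le>d. a j ^ s j)" for r s :: "nat \<Rightarrow> nat"
        by (auto simp: y_def)
      then show ?case by (auto simp only: monomial_merge mult.assoc split: prod.splits)
    qed
    finally show ?thesis .
  qed
  moreover have "split_exps d ` A \<subseteq> {(r, s). (\<Sum>j\<le>d. s j) = i}"
    using assms(4) by (auto simp: split_exps_def)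
  ultimately show ?thesis
    unfolding polynomial_functions_def using assms(1)
    by (intro CollectI conjI exI[of _ "split_exps d ` A"] exI[of _ "\<lambda>p. b (merge_exps d p)"])
      (auto simp: push_def)
qed

lemma monomial_torus:
  "monomial (d + 3) e (\<lambda>k. 2 powi (coord_weight d k) * y k) = 2 powi (weight d e) * monomial (d + 3) e y"
proof -
  have "2 powi (\<Sum>k<n. coord_weight d k * int (e k)) = (\<Prod>k<n. (2 powi (coord_weight d k)) ^ e k :: complex)" for n
    by (induction n) (auto simp: power_int_add power_int_mult)
  then show ?thesis by (simp add: monomial_def weight_def power_mult_distrib prod.distrib)
qed

text \<open>
  The torus element multiplies a monomial of weight \<open>m\<close> by \<open>2 powi m\<close>. Comparing coefficients, only
  monomials of weight \<open>0\<close> can occur.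
\<close>

lemma torus_invariant_weight_0:
  assumes "G \<in> fun_space.span
      (monomial (d + 3) ` {e \<in> exps (d + 3). (\<Sum>k\<le>d. e k) = i \<and> e (d + 1) + e (d + 2) \<le> K})"
    and inv: "\<And>y. G (\<lambda>k. 2 powi (coord_weight d k) * y k) = G y"
  shows "G \<in> weight_space d i K 0"
proof -
  define A where "A = {e \<in> exps (d + 3). (\<Sum>k\<le>d. e k) = i \<and> e (d + 1) + e (d + 2) \<le> K}"
  have A: "A = (\<Union>m. weight_exps d i K m)" by (auto simp: A_def weight_exps_def)
  then have fin: "finite A" using finite_weight_exps_UN by simp
  have sub: "A \<subseteq> exps (d + 3)" by (auto simp: A_def)
  obtain b where b: "G = (\<lambda>y. \<Sum>e\<in>A. b e * monomial (d + 3) e y)"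
    using span_monomials_finite[OF fin sub assms(1)[folded A_def]] .
  have b0: "b e = 0" if "e \<in> A" "weight d e \<noteq> 0" for e
  proof -
    have "(\<Sum>e\<in>A. (b e * (2 powi (weight d e) - 1)) * monomial (d + 3) e y) = 0" for y
      using inv[of y] unfolding b monomial_torus
      by (simp add: right_diff_distrib left_diff_distrib sum_subtractf mult.assoc)
    then have "b e * (2 powi (weight d e) - 1) = 0"
      using monomials_independent[of A "d + 3" "\<lambda>e. b e * (2 powi (weight d e) - 1)" e] fin sub that(1) by blast
    moreover have "2 powi (weight d e) \<noteq> (1 :: complex)"
    proof
      assume "2 powi (weight d e) = (1 :: complex)"
      then have "norm (2 powi (weight d e) :: complex) = 1" by simp
      then have "(2::real) powi (weight d e) = 1" by (simp add: norm_power_int)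
      moreover have "(2::real) ^ k \<noteq> 1" if "k > 0" for k
        using one_less_power[of "2::real" k] that by linarith
      ultimately show False using that(2)
        by (auto simp: power_int_def power_one_over split: if_splits)
    qed
    ultimately show ?thesis by simp
  qed
  have "G = (\<Sum>e\<in>A. (\<lambda>y. b e * monomial (d + 3) e y))"
    by (simp add: b fun_eq_iff sum_apply)
  also have "\<dots> = (\<Sum>e\<in>weight_exps d i K 0. (\<lambda>y. b e * monomial (d + 3) e y))"
    using b0 by (intro sum.mono_neutral_right fin)
      (auto simp: A weight_exps_def fun_eq_iff)
  also have "\<dots> \<in> weight_space d i K 0"
    unfolding weight_space_def
    by (intro fun_space.span_sum fun_space.span_scale fun_space.span_base imageI)
  finally show ?thesis .
qed

lemma weight_space_subset_span:
  "weight_space d i K m \<subseteq> fun_space.span (monomial (d + 3) ` exps (d + 3))"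
  unfolding weight_space_def by (intro fun_space.span_mono image_mono weight_exps_subset)

text \<open>
  Weight \<open>0\<close> comes from the torus element. The function is constant along the orbits of the upper
  unipotent group, so its derivative along the raising field, which generates them, vanishes.
\<close>

lemma pull_covariant:
  assumes "F \<in> covariants_component d i"
  obtains K where "pull d F \<in> weight_space d i K 0" "derivation (raising_field d) (pull d F) = 0"
proof -
  have F: "F \<in> covariants d" "F \<in> polynomial_functions d {(r, s). (\<Sum>j\<le>d. s j) = i}"
    using assms by (auto simp: covariants_component_def)
  have inv: "F (subst_pair m (form_pair d y)) = F (form_pair d y)" if "det m = 1" for m y
    using F(1) that by (simp add: covariants_subst)
  obtain K where K: "pull d F \<in> fun_space.span
    (monomial (d + 3) ` {e \<in> exps (d + 3). (\<Sum>k\<le>d. e k) = i \<and> e (d + 1) + e (d + 2) \<le> K})"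
    using pull_polynomial[OF F(2)] .
  have "pull d F (\<lambda>k. 2 powi (coord_weight d k) * y k) = pull d F y" for y
    using inv[OF det_torus_elem, of y] by (simp add: pull_def form_pair_torus)
  then have W: "pull d F \<in> weight_space d i K 0" by (rule torus_invariant_weight_0[OF K])
  have "derivation (raising_field d) (pull d F) y = 0" for y
  proof -
    have "((\<lambda>t. pull d F (upper_flow d t y)) has_field_derivative
        derivation (raising_field d) (pull d F) (upper_flow d 0 y)) (at 0)"
      by (rule derivation_along_curve[of "pull d F" "\<lambda>t. upper_flow d t y" "raising_field d" 0,
            OF poly_function_weight_space[OF W] upper_flow_derivative])
    moreover have "pull d F (upper_flow d t y) = pull d F y" for t
      using inv[OF det_upper, of t y] by (simp add: pull_def form_pair_upper)
    ultimately have "derivation (raising_field d) (pull d F) (upper_flow d 0 y) = 0"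
      by (simp add: DERIV_unique[OF _ DERIV_const])
    moreover have "derivation (raising_field d) (pull d F) (upper_flow d 0 y) =
        derivation (raising_field d) (pull d F) y"
      by (rule span_monomials_depends[of _ "d + 3" "exps (d + 3)" "upper_flow d 0 y" y,
            OF subsetD[OF weight_space_subset_span raising_weight_space[OF W]] upper_flow_0])
    ultimately show ?thesis by simp
  qed
  then show ?thesis using that W by (simp add: fun_eq_iff)
qed

lemma flow_invariant:
  assumes "poly_function G" "derivation X G = 0"
    and "\<And>t k. ((\<lambda>t. \<phi> t k) has_field_derivative X (\<phi> t) k) (at t)"
  shows "G (\<phi> t) = G (\<phi> 0)"
proof -
  have "((\<lambda>t. G (\<phi> t)) has_field_derivative 0) (at t)" for t
    using derivation_along_curve[of G \<phi> X t, OF assms(1) assms(3)] assms(2) by simp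
  then have "\<exists>c. \<forall>t\<in>UNIV. G (\<phi> t) = c"
    by (intro has_field_derivative_zero_constant convex_UNIV) auto
  then show ?thesis by auto
qed

text \<open>
  The lowering operator kills \<open>G\<close> as well, so \<open>G\<close> is constant along the orbits of both unipotent groups,
  and these generate the whole group.
\<close>

lemma push_covariant:
  assumes W: "G \<in> weight_space d i K 0" and E: "derivation (raising_field d) G = 0"
  shows "push d G \<in> covariants_component d i"
proof -
  interpret sl2_weight_spaces "\<lambda>c F p. c * F p" "weight_space d i K"
    "derivation (raising_field d)" "derivation (lowering_field d)"
    by (rule sl2_weight_spaces_polynomials)
  have L: "derivation (lowering_field d) G = 0" by (rule F_zero_if_E_zero[OF W E])
  have span: "G \<in> fun_space.span (monomial (d + 3) ` exps (d + 3))"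
    by (rule subsetD[OF weight_space_subset_span W])
  note push = push_form_pair[OF span]
  have comp: "push d G \<in> polynomial_functions d {(r, s). (\<Sum>j\<le>d. s j) = i}"
    using W unfolding weight_space_def
    by (intro push_polynomial[OF finite_weight_exps weight_exps_subset]) (auto simp: weight_exps_def)
  then have "push d G \<in> polynomial_functions d UNIV"
    unfolding polynomial_functions_def by blast
  moreover have "push d G (subst_pair m (form_pair d y)) = push d G (form_pair d y)"
    if "det m = 1" for m y
  proof -
    define P where "P m \<longleftrightarrow> (\<forall>y. \<exists>y'. subst_pair m (form_pair d y) = form_pair d y' \<and> G y' = G y)" for m
    have "P m"
    proof (rule SL2_generated[OF _ _ _ that])
      fix t
      have "G (upper_flow d t y) = G y" for y
        using flow_invariant[of G "raising_field d" "\<lambda>t. upper_flow d t y" t,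
            OF poly_function_weight_space[OF W] E upper_flow_derivative]
          span_monomials_depends[of G "d + 3" "exps (d + 3)" "upper_flow d 0 y" y, OF span upper_flow_0] by simp
      then show "P (upper t)" unfolding P_def using form_pair_upper by metis
      have "G (lower_flow d t y) = G y" for y
        using flow_invariant[of G "lowering_field d" "\<lambda>t. lower_flow d t y" t,
            OF poly_function_weight_space[OF W] L lower_flow_derivative]
          span_monomials_depends[of G "d + 3" "exps (d + 3)" "lower_flow d 0 y" y, OF span lower_flow_0] by simp
      then show "P (lower t)" unfolding P_def using form_pair_lower by metis
    next
      fix m n assume "P m" "P n"
      moreover have "subst_pair (m ** n) p = subst_pair n (subst_pair m p)" for p
        by (simp add: subst_pair_def subst_form_mult)
      ultimately show "P (m ** n)" unfolding P_def by metis
    qed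
    then obtain y' where "subst_pair m (form_pair d y) = form_pair d y'" "G y' = G y"
      unfolding P_def by blast
    then show ?thesis by (simp add: push)
  qed
  ultimately show ?thesis using comp by (simp add: covariants_component_def covariants_subst)
qed


section \<open>The dimension of a graded component\<close>

definition multidegrees :: "nat \<Rightarrow> nat \<Rightarrow> (nat \<Rightarrow> nat) set" where
  "multidegrees d i = {s \<in> exps (d + 1). (\<Sum>k\<le>d. s k) = i}"

definition form_weight :: "nat \<Rightarrow> (nat \<Rightarrow> nat) \<Rightarrow> int" where
  "form_weight d s = (\<Sum>k\<le>d. (int d - 2 * int k) * int (s k))"

lemma finite_multidegrees: "finite (multidegrees d i)"
proof (rule finite_subset[OF _ finite_bounded_exps[of "d + 1" i]], safe)
  fix s assume s: "s \<in> multidegrees d i"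
  then show "s \<in> exps (d + 1)" by (simp add: multidegrees_def)
  fix k
  show "s k \<le> i"
  proof (cases "k \<le> d")
    case True
    then have "s k \<le> (\<Sum>k\<le>d. s k)" by (intro member_le_sum) auto
    then show ?thesis using s by (simp add: multidegrees_def)
  next
    case False
    then show ?thesis using s by (simp add: multidegrees_def exps_def)
  qed
qed

lemma form_weight_bound:
  assumes "s \<in> multidegrees d i"
  shows "\<bar>form_weight d s\<bar> \<le> int (d * i)"
proof -
  have "\<bar>form_weight d s\<bar> \<le> (\<Sum>k\<le>d. \<bar>(int d - 2 * int k) * int (s k)\<bar>)"
    unfolding form_weight_def by (rule sum_abs)
  also have "\<dots> \<le> (\<Sum>k\<le>d. int d * int (s k))"
    by (intro sum_mono) (auto simp: abs_mult intro!: mult_right_mono)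
  also have "\<dots> = int (d * i)"
    using assms by (simp add: multidegrees_def sum_distrib_left[symmetric] flip: of_nat_sum)
  finally show ?thesis .
qed

lemma weight_eq:
  "weight d e = form_weight d e + int (e (d + 1)) - int (e (d + 2))"
proof -
  have "{..<d + 3} = insert (d + 2) (insert (d + 1) {..d})" by auto
  then have "weight d e = coord_weight d (d + 2) * int (e (d + 2)) + (coord_weight d (d + 1) * int (e (d + 1)) +
      (\<Sum>k\<le>d. coord_weight d k * int (e k)))"
    by (simp add: weight_def)
  then show ?thesis by (simp add: coord_weight_def form_weight_def)
qed

lemma form_weight_cong: "(\<And>k. k \<le> d \<Longrightarrow> s k = t k) \<Longrightarrow> form_weight d s = form_weight d t"
  by (simp add: form_weight_def)

text \<open>
  Reversing the coefficients, \<open>k\<close> to \<open>d - k\<close>, changes the sign of the weight.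
\<close>

lemma card_negative_weight:
  "card {s \<in> multidegrees d i. form_weight d s \<le> 0} = card {s \<in> multidegrees d i. form_weight d s \<ge> 0}"
proof -
  define r where "r s = (\<lambda>k. if k \<le> d then s (d - k) else 0)" for s :: "nat \<Rightarrow> nat"
  have rr: "r (r s) = s" if "s \<in> multidegrees d i" for s
    using that by (auto simp: r_def multidegrees_def exps_def fun_eq_iff)
  have refl: "(\<Sum>k\<le>d. f (d - k)) = (\<Sum>k\<le>d. f k)" for f :: "nat \<Rightarrow> 'a::comm_monoid_add"
    by (rule sum.reindex_bij_witness[of _ "\<lambda>k. d - k" "\<lambda>k. d - k"]) auto
  have r_in: "r s \<in> multidegrees d i" if "s \<in> multidegrees d i" for s
    using that refl[of s] by (simp add: r_def multidegrees_def exps_def)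
  have "form_weight d (r s) = - form_weight d s" for s
  proof -
    have "form_weight d (r s) = (\<Sum>k\<le>d. - ((int d - 2 * int (d - k)) * int (s (d - k))))"
      unfolding form_weight_def by (intro sum.cong) (auto simp: r_def of_nat_diff algebra_simps)
    also have "\<dots> = - form_weight d s"
      using refl[of "\<lambda>k. (int d - 2 * int k) * int (s k)"] by (simp add: sum_negf form_weight_def)
    finally show ?thesis .
  qed
  then have "bij_betw r {s \<in> multidegrees d i. form_weight d s \<le> 0} {s \<in> multidegrees d i. form_weight d s \<ge> 0}"
    by (intro bij_betw_byWitness[where f' = r]) (auto simp: rr r_in)
  then show ?thesis by (rule bij_betw_same_card)
qed

text \<open>
  Replacing one factor \<open>y (d + 1)\<close> by \<open>y (d + 2)\<close> lowers the weight by \<open>2\<close>, and matches the exponents of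
  weight \<open>2\<close> that contain \<open>y (d + 1)\<close> with those of weight \<open>0\<close> that contain \<open>y (d + 2)\<close>. The remaining
  exponents of weight \<open>0\<close> are determined by their part in the first \<open>d + 1\<close> coordinates, which has an
  arbitrary weight \<open>\<le> 0\<close>; those of weight \<open>2\<close> by a part of arbitrary weight \<open>\<ge> 2\<close>. By symmetry the
  difference counts the weights \<open>\<ge> 0\<close> that are not \<open>\<ge> 2\<close>.
\<close>

lemma card_weight_exps_diff:
  assumes "K \<ge> d * i"
  shows "card (weight_exps d i K 0) =
    card (weight_exps d i K 2) + card {s \<in> multidegrees d i. form_weight d s \<in> {0, 1}}"
proof -
  define A where "A = weight_exps d i K"
  define restr where "restr e = (\<lambda>k. if k \<le> d then e k else 0)" for e :: "nat \<Rightarrow> nat"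
  have finA: "finite (A m)" for m unfolding A_def by (rule finite_weight_exps)
  have restr: "restr e \<in> multidegrees d i" "form_weight d (restr e) = form_weight d e" if "e \<in> A m" for e m
    using that by (auto simp: A_def weight_exps_def restr_def multidegrees_def exps_def form_weight_def)
  have ext: "s(d + 1 := p, d + 2 := q) \<in> A m"
    if "s \<in> multidegrees d i" "p + q \<le> K" "form_weight d s + int p - int q = m" for s p q m
  proof -
    have "form_weight d (s(d + 1 := p, d + 2 := q)) = form_weight d s"
      by (rule form_weight_cong) auto
    then show ?thesis
      using that unfolding A_def weight_exps_def weight_eq
      by (auto simp: multidegrees_def exps_def)
  qed
  have ext_restr: "(restr e)(d + 1 := e (d + 1), d + 2 := e (d + 2)) = e" if "e \<in> A m" for e m
    using that by (auto simp: A_def weight_exps_def restr_def exps_def fun_eq_iff)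
  have restr_ext: "restr (s(d + 1 := p, d + 2 := q)) = s" if "s \<in> multidegrees d i" for s p q
    using that by (auto simp: restr_def multidegrees_def exps_def fun_eq_iff)
  have A_weight: "form_weight d e + int (e (d + 1)) - int (e (d + 2)) = m" if "e \<in> A m" for e m
    using that by (simp add: A_def weight_exps_def weight_eq)
  have bound: "\<bar>form_weight d s\<bar> \<le> int K" if "s \<in> multidegrees d i" for s
    using form_weight_bound[OF that] assms by linarith
  have bij_move: "bij_betw (move (d + 1) (d + 2)) {e \<in> A 2. e (d + 1) > 0} {e \<in> A 0. e (d + 2) > 0}"
  proof (intro bij_betw_byWitness[where f' = "move (d + 2) (d + 1)"])
    have pos: "move k j e j > 0" for k j e by (simp add: move_def)
    show "move (d + 1) (d + 2) ` {e \<in> A 2. e (d + 1) > 0} \<subseteq> {e \<in> A 0. e (d + 2) > 0}"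
    proof (intro image_subsetI CollectI conjI pos)
      fix e assume "e \<in> {e \<in> A 2. e (d + 1) > 0}"
      then show "move (d + 1) (d + 2) e \<in> A 0"
        using move_weight_exps[of e d i K 2 "d + 1" "d + 2"] by (simp add: A_def coord_weight_def)
    qed
    show "move (d + 2) (d + 1) ` {e \<in> A 0. e (d + 2) > 0} \<subseteq> {e \<in> A 2. e (d + 1) > 0}"
    proof (intro image_subsetI CollectI conjI pos)
      fix e assume "e \<in> {e \<in> A 0. e (d + 2) > 0}"
      then show "move (d + 2) (d + 1) e \<in> A 2"
        using move_weight_exps[of e d i K 0 "d + 2" "d + 1"] by (simp add: A_def coord_weight_def)
    qed
  qed (auto simp: move_def fun_eq_iff)
  have "bij_betw restr {e \<in> A 0. e (d + 2) = 0} {s \<in> multidegrees d i. form_weight d s \<le> 0}"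
  proof (intro bij_betw_byWitness[where f' = "\<lambda>s. s(d + 1 := nat (- form_weight d s), d + 2 := 0)"])
    show "\<forall>e\<in>{e \<in> A 0. e (d + 2) = 0}. (restr e)(d + 1 := nat (- form_weight d (restr e)), d + 2 := 0) = e"
    proof
      fix e assume e: "e \<in> {e \<in> A 0. e (d + 2) = 0}"
      then have "nat (- form_weight d (restr e)) = e (d + 1)"
        using A_weight[of e 0] restr(2)[of e 0] by auto
      then show "(restr e)(d + 1 := nat (- form_weight d (restr e)), d + 2 := 0) = e"
        using ext_restr[of e 0] e by auto
    qed
    show "\<forall>s\<in>{s \<in> multidegrees d i. form_weight d s \<le> 0}. restr (s(d + 1 := nat (- form_weight d s), d + 2 := 0)) = s"
      using restr_ext by blast
    show "restr ` {e \<in> A 0. e (d + 2) = 0} \<subseteq> {s \<in> multidegrees d i. form_weight d s \<le> 0}"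
      using restr A_weight by fastforce
    show "(\<lambda>s. s(d + 1 := nat (- form_weight d s), d + 2 := 0)) ` {s \<in> multidegrees d i. form_weight d s \<le> 0}
        \<subseteq> {e \<in> A 0. e (d + 2) = 0}"
    proof (intro image_subsetI CollectI conjI)
      fix s assume "s \<in> {s \<in> multidegrees d i. form_weight d s \<le> 0}"
      then show "s(d + 1 := nat (- form_weight d s), d + 2 := 0) \<in> A 0"
        using bound[of s] by (intro ext) auto
    qed simp
  qed
  then have card0: "card {e \<in> A 0. e (d + 2) = 0} = card {s \<in> multidegrees d i. form_weight d s \<ge> 0}"
    by (simp add: bij_betw_same_card card_negative_weight)
  have "bij_betw restr {e \<in> A 2. e (d + 1) = 0} {s \<in> multidegrees d i. form_weight d s \<ge> 2}"
  proof (intro bij_betw_byWitness[where f' = "\<lambda>s. s(d + 1 := 0, d + 2 := nat (form_weight d s - 2))"])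
    show "\<forall>e\<in>{e \<in> A 2. e (d + 1) = 0}. (restr e)(d + 1 := 0, d + 2 := nat (form_weight d (restr e) - 2)) = e"
    proof
      fix e assume e: "e \<in> {e \<in> A 2. e (d + 1) = 0}"
      then have "nat (form_weight d (restr e) - 2) = e (d + 2)"
        using A_weight[of e 2] restr(2)[of e 2] by auto
      then show "(restr e)(d + 1 := 0, d + 2 := nat (form_weight d (restr e) - 2)) = e"
        using ext_restr[of e 2] e by auto
    qed
    show "\<forall>s\<in>{s \<in> multidegrees d i. form_weight d s \<ge> 2}. restr (s(d + 1 := 0, d + 2 := nat (form_weight d s - 2))) = s"
      using restr_ext by blast
    show "restr ` {e \<in> A 2. e (d + 1) = 0} \<subseteq> {s \<in> multidegrees d i. form_weight d s \<ge> 2}"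
      using restr A_weight by fastforce
    show "(\<lambda>s. s(d + 1 := 0, d + 2 := nat (form_weight d s - 2))) ` {s \<in> multidegrees d i. form_weight d s \<ge> 2}
        \<subseteq> {e \<in> A 2. e (d + 1) = 0}"
    proof (intro image_subsetI CollectI conjI)
      fix s assume "s \<in> {s \<in> multidegrees d i. form_weight d s \<ge> 2}"
      then show "s(d + 1 := 0, d + 2 := nat (form_weight d s - 2)) \<in> A 2"
        using bound[of s] by (intro ext) auto
    qed simp
  qed
  then have card2: "card {e \<in> A 2. e (d + 1) = 0} = card {s \<in> multidegrees d i. form_weight d s \<ge> 2}"
    by (rule bij_betw_same_card)
  have split: "card (A m) = card {e \<in> A m. e k > 0} + card {e \<in> A m. e k = 0}" for m k
    by (subst card_Un_disjoint[symmetric]) (auto simp: finA intro!: arg_cong[of _ _ card])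
  have "card {s \<in> multidegrees d i. form_weight d s \<ge> 0} =
      card {s \<in> multidegrees d i. form_weight d s \<ge> 2} + card {s \<in> multidegrees d i. form_weight d s \<in> {0, 1}}"
    by (subst card_Un_disjoint[symmetric]) (auto simp: finite_multidegrees intro!: arg_cong[of _ _ card])
  then show ?thesis
    using split[of 0 "d + 2"] split[of 2 "d + 1"] card0 card2 bij_betw_same_card[OF bij_move]
    by (simp add: A_def)
qed

lemma weight_exps_mono: "K \<le> K' \<Longrightarrow> weight_exps d i K m \<subseteq> weight_exps d i K' m"
  by (auto simp: weight_exps_def)

lemma (in vector_space) span_eq_if_card_eq:
  assumes "independent B" "finite C" "B \<subseteq> span C" "card B = card C"
  shows "span B = span C"
proof -
  have "x \<in> span B" if "x \<in> span C" for x
  proof (rule ccontr)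
    assume x: "x \<notin> span B"
    then have "independent (insert x B)" by (rule independent_insertI[OF _ assms(1)])
    then have "finite (insert x B) \<and> card (insert x B) \<le> card C"
      by (rule independent_span_bound[OF assms(2)]) (use that assms(3) in auto)
    moreover have "x \<notin> B" using x span_base by blast
    ultimately show False using assms(4) card_insert_disjoint[of B x] by auto
  qed
  moreover have "span B \<subseteq> span C" using span_mono[OF assms(3)] by (simp add: span_span)
  ultimately show ?thesis by blast
qed

text \<open>
  The kernel of the raising operator on weight \<open>0\<close> grows with the bound \<open>K\<close> on the degree in the linear
  form, but its dimension is the same for all \<open>K \<ge> d * i\<close>. So it stops growing there, and this
  one kernel contains the polynomials of all covariants of degree \<open>i\<close>.
\<close>

theorem dim_covariants_component:
  "vector_space.dim (\<lambda>(c::complex) F p. c * F p) (covariants_component d i) =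
     card {s \<in> multidegrees d i. form_weight d s \<in> {0, 1}}"
proof -
  define N where "N = card {s \<in> multidegrees d i. form_weight d s \<in> {0, 1}}"
  define kern where "kern K = {G \<in> weight_space d i K 0. derivation (raising_field d) G = 0}" for K
  have basis: "\<exists>D. fun_space.independent D \<and> finite D \<and> fun_space.span D = kern K \<and> card D = N"
    if "d * i \<le> K" for K
  proof -
    obtain D where D: "fun_space.independent D" "finite D"
      "fun_space.span D = {G \<in> weight_space d i K 0. derivation (raising_field d) G = 0}"
      "card D + card (weight_exps d i K 2) = card (weight_exps d i K 0)"
      by (rule raising_kernel_basis)
    have "card D = N" using D(4) card_weight_exps_diff[OF that] by (simp add: N_def)
    then show ?thesis using D(1-3) unfolding kern_def by blast
  qed
  from this[OF order.refl] obtain D where D: "fun_space.independent D" "finite D" "fun_space.span D = kern (d * i)" "card D = N"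
    by blast
  have monomial: "kern K \<subseteq> kern K'" if "K \<le> K'" for K K'
    using fun_space.span_mono[OF image_mono[OF weight_exps_mono[OF that]]]
    unfolding kern_def weight_space_def by blast
  have kern: "kern K \<subseteq> kern (d * i)" for K
  proof -
    \<comment> \<open>Compare both kernels with the larger one; it has the same dimension as the one for \<open>d * i\<close>.\<close>
  define K' where "K' = max K (d * i)"
    obtain D' where D': "finite D'" "fun_space.span D' = kern K'" "card D' = N"
      using basis[of K'] by (auto simp: K'_def)
    have "D \<subseteq> fun_space.span D'"
      using D(3) D'(2) monomial[of "d * i" K'] fun_space.span_superset[of D] by (auto simp: K'_def)
    then have "kern (d * i) = kern K'"
      using fun_space.span_eq_if_card_eq[OF D(1) D'(1)] D D' by simp
    then show ?thesis using monomial[of K K'] by (simp add: K'_def)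
  qed
  interpret push: module_hom "\<lambda>(c::complex) F p. c * F p" "\<lambda>(c::complex) F p. c * F p" "push d"
    unfolding module_hom_iff
    by (intro conjI fun_space.module_axioms) (auto simp: push_def fun_eq_iff)
  have "covariants_component d i = push d ` kern (d * i)"
  proof
    show "push d ` kern (d * i) \<subseteq> covariants_component d i"
      by (auto simp: kern_def intro: push_covariant)
    show "covariants_component d i \<subseteq> push d ` kern (d * i)"
    proof
      fix F assume F: "F \<in> covariants_component d i"
      then obtain K where "pull d F \<in> kern K" using pull_covariant[OF F] unfolding kern_def by blast
      then have "pull d F \<in> kern (d * i)" using kern by blast
      moreover have "push d (pull d F) = F"
        using F push_pull unfolding covariants_component_def by blast
      ultimately show "F \<in> push d ` kern (d * i)" by (metis imageI)
    qed
  qed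
  also have "\<dots> = fun_space.span (push d ` D)"
    using push.span_image[of D] D(3) by simp
  finally have span: "covariants_component d i = fun_space.span (push d ` D)" .
  have inj: "inj_on (push d) (fun_space.span D)"
  proof (rule inj_onI)
    fix G H assume *: "G \<in> fun_space.span D" "H \<in> fun_space.span D" "push d G = push d H"
    then have "G \<in> weight_space d i (d * i) 0" "H \<in> weight_space d i (d * i) 0"
      by (auto simp: D(3) kern_def)
    then show "G = H" using push_form_pair *(3) unfolding weight_space_def by (metis ext)
  qed
  have "fun_space.independent (push d ` D)"
    using push.independent_injective_image[OF D(1) inj] .
  then have "fun_space.dim (covariants_component d i) = card (push d ` D)"
    unfolding span by (simp add: fun_space.dim_eq_card_independent)
  also have "\<dots> = card D"
    by (rule card_image[OF inj_on_subset[OF inj fun_space.span_superset]])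
  finally show ?thesis using D(4) N_def by simp
qed


section \<open>The Poincare series as a rational function\<close>

text \<open>
  The complete homogeneous symmetric polynomial of degree \<open>i\<close> in \<open>1, q, ..., q ^ d\<close> for \<open>q = X ^ 2\<close>, that
  is, the Gaussian binomial coefficient of \<open>d + i\<close> over \<open>d\<close>.
\<close>

definition gauss_series :: "nat \<Rightarrow> nat \<Rightarrow> complex fps" where
  "gauss_series d i = (\<Sum>s\<in>multidegrees d i. fps_X ^ (2 * (\<Sum>k\<le>d. k * s k)))"

lemma multidegrees_0: "multidegrees d 0 = {\<lambda>_. 0}"
proof -
  have "s = (\<lambda>_. 0)" if "s \<in> multidegrees d 0" for s
  proof
    fix k show "s k = 0"
      using that by (cases "k \<le> d") (auto simp: multidegrees_def exps_def)
  qed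
  moreover have "(\<lambda>_. 0) \<in> multidegrees d 0" by (simp add: multidegrees_def exps_def)
  ultimately show ?thesis by blast
qed

lemma multidegrees_forms_0: "multidegrees 0 i = {\<lambda>k. if k = 0 then i else 0}"
proof -
  have "s = (\<lambda>k. if k = 0 then i else 0)" if "s \<in> multidegrees 0 i" for s
  proof
    fix k show "s k = (if k = 0 then i else 0)"
      using that by (cases k) (auto simp: multidegrees_def exps_def)
  qed
  moreover have "(\<lambda>k. if k = 0 then i else 0) \<in> multidegrees 0 i"
    by (simp add: multidegrees_def exps_def)
  ultimately show ?thesis by blast
qed

lemma gauss_series_0: "gauss_series d 0 = 1"
  by (simp add: gauss_series_def multidegrees_0)

lemma gauss_series_forms_0: "gauss_series 0 i = 1"
  by (simp add: gauss_series_def multidegrees_forms_0)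

text \<open>
  Split the exponents by whether the last coordinate occurs.
\<close>

lemma gauss_series_Suc:
  "gauss_series (Suc d) (Suc i) = gauss_series d (Suc i) + fps_X ^ (2 * Suc d) * gauss_series (Suc d) i"
proof -
  define A where "A = {s \<in> multidegrees (Suc d) (Suc i). s (Suc d) = 0}"
  define B where "B = {s \<in> multidegrees (Suc d) (Suc i). s (Suc d) > 0}"
  define up where "up s = s(Suc d := Suc (s (Suc d)))" for s :: "nat \<Rightarrow> nat"
  have AB: "multidegrees (Suc d) (Suc i) = A \<union> B" "A \<inter> B = {}" "finite A" "finite B"
    using finite_multidegrees[of "Suc d" "Suc i"] by (auto simp: A_def B_def)
  have A: "A = multidegrees d (Suc i)"
  proof -
    have "s \<in> exps (Suc d + 1) \<and> s (Suc d) = 0 \<longleftrightarrow> s \<in> exps (d + 1)" for s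
      by (auto simp: exps_def) (metis Suc_leI le_neq_implies_less)
    then show ?thesis unfolding A_def multidegrees_def by fastforce
  qed
  have inj: "inj_on up (multidegrees (Suc d) i)"
  proof (rule inj_onI, rule ext)
    fix s t k assume "up s = up t"
    then have "up s k = up t k" by simp
    then show "s k = t k" by (cases "k = Suc d") (auto simp: up_def)
  qed
  have B: "B = up ` multidegrees (Suc d) i"
  proof
    show "up ` multidegrees (Suc d) i \<subseteq> B"
      by (auto simp: B_def up_def multidegrees_def exps_def)
    show "B \<subseteq> up ` multidegrees (Suc d) i"
    proof
      fix s assume s: "s \<in> B"
      then have "s(Suc d := s (Suc d) - 1) \<in> multidegrees (Suc d) i"
        by (auto simp: B_def multidegrees_def exps_def)
      moreover have "up (s(Suc d := s (Suc d) - 1)) = s"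
        using s by (auto simp: B_def up_def)
      ultimately show "s \<in> up ` multidegrees (Suc d) i" by (metis imageI)
    qed
  qed
  have "(\<Sum>s\<in>A. fps_X ^ (2 * (\<Sum>k\<le>Suc d. k * s k))) = gauss_series d (Suc i)"
    unfolding gauss_series_def A[symmetric] by (intro sum.cong) (auto simp: A_def)
  moreover have "(\<Sum>s\<in>B. fps_X ^ (2 * (\<Sum>k\<le>Suc d. k * s k))) = fps_X ^ (2 * Suc d) * gauss_series (Suc d) i"
    unfolding gauss_series_def B sum.reindex[OF inj] sum_distrib_left
    by (intro sum.cong) (auto simp: up_def algebra_simps simp flip: power_add)
  ultimately show ?thesis
    unfolding gauss_series_def[of "Suc d" "Suc i"] AB(1) using AB by (simp add: sum.union_disjoint)
qed

definition qfact :: "nat \<Rightarrow> complex fps" where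
  "qfact n = (\<Prod>m=1..n. 1 - fps_X ^ (2 * m))"

lemma qfact_Suc: "qfact (Suc n) = qfact n * (1 - fps_X ^ (2 * Suc n))"
  by (simp add: qfact_def)

lemma qfact_nth_0: "fps_nth (qfact n) 0 = 1"
  by (induction n) (auto simp: qfact_def fps_nth_power_0)

lemma qfact_inverse: "qfact n * inverse (qfact n) = 1"
  by (rule inverse_mult_eq_1') (simp add: qfact_nth_0)

lemma qfact_nonzero [simp]: "qfact n \<noteq> 0"
  using qfact_nth_0[of n] by auto

lemma inverse_qfact: "inverse (qfact n) = (1 - fps_X ^ (2 * Suc n)) * inverse (qfact (Suc n))"
proof -
  have "inverse (qfact n) = inverse (qfact n) * (qfact (Suc n) * inverse (qfact (Suc n)))"
    by (simp only: qfact_inverse mult_1_right)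
  also have "\<dots> = (qfact n * inverse (qfact n)) * ((1 - fps_X ^ (2 * Suc n)) * inverse (qfact (Suc n)))"
    by (simp only: qfact_Suc mult_ac)
  finally show ?thesis by (simp only: qfact_inverse mult_1_left)
qed

definition gauss_term :: "nat \<Rightarrow> nat \<Rightarrow> nat \<Rightarrow> complex fps" where
  "gauss_term d i j = (-1) ^ j * fps_X ^ (j * (j + 1) + 2 * i * j) * (inverse (qfact j) * inverse (qfact (d - j)))"

text \<open>
  With \<open>q = X ^ 2\<close>, decompose \<open>1 - q ^ (d + 1) = (1 - q ^ (d + 1 - j)) + q ^ (d + 1 - j) (1 - q ^ j)\<close>.
  The first part turns the \<open>j\<close>-th term for \<open>d + 1\<close> into the \<open>j\<close>-th term for \<open>d\<close>, the second into
  \<open>- q ^ (d + 1)\<close> times the term with index \<open>j - 1\<close>. So the sum for \<open>d + 1\<close> times \<open>1 - q ^ (d + 1)\<close> is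
  the sum for \<open>d\<close> times the same factor.
\<close>

lemma gauss_term_sum_0: "(\<Sum>j\<le>d. gauss_term d 0 j) = 1"
proof (induction d)
  case 0
  then show ?case by (simp add: gauss_term_def qfact_def)
next
  case (Suc d)
  let ?q = "fps_X ^ (2 * Suc d) :: complex fps"
  \<comment> \<open>The two parts into which each term for \<open>Suc d\<close> splits, each set to 0 where it has no partner.\<close>
  define a where "a j = (if j \<le> d then gauss_term d 0 j else 0)" for j
  define b where "b j = (if j = 0 then 0 else - ?q * gauss_term d 0 (j - 1))" for j
  have split: "(1 - ?q) * gauss_term (Suc d) 0 j = a j + b j" if "j \<le> Suc d" for j
  proof -
    have exp: "2 * Suc d = 2 * (Suc d - j) + 2 * j" using that by simp
    have q: "1 - ?q = (1 - fps_X ^ (2 * (Suc d - j))) + fps_X ^ (2 * (Suc d - j)) * (1 - fps_X ^ (2 * j))"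
      unfolding exp power_add by (simp add: algebra_simps)
    have "(1 - fps_X ^ (2 * (Suc d - j))) * gauss_term (Suc d) 0 j = a j"
    proof (cases "j \<le> d")
      case True
      then show ?thesis
        using inverse_qfact[of "d - j"] by (simp add: a_def gauss_term_def Suc_diff_le mult_ac)
    next
      case False
      then have "j = Suc d" using that by simp
      then show ?thesis by (simp add: a_def)
    qed
    moreover have "fps_X ^ (2 * (Suc d - j)) * (1 - fps_X ^ (2 * j)) * gauss_term (Suc d) 0 j = b j"
    proof (cases j)
      case 0
      then show ?thesis by (simp add: b_def)
    next
      case (Suc l)
      have "2 * (Suc d - j) + (j * (j + 1) + 2 * 0 * j) = 2 * Suc d + (l * (l + 1) + 2 * 0 * l)"
        using that Suc by (simp add: algebra_simps)
      then have e: "fps_X ^ (2 * (Suc d - j)) * fps_X ^ (j * (j + 1) + 2 * 0 * j) =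
          ?q * fps_X ^ (l * (l + 1) + 2 * 0 * l)"
        by (simp only: power_add[symmetric])
      have i: "inverse (qfact l) = (1 - fps_X ^ (2 * j)) * inverse (qfact j)"
        using inverse_qfact[of l] Suc by simp
      have "fps_X ^ (2 * (Suc d - j)) * (1 - fps_X ^ (2 * j)) * gauss_term (Suc d) 0 j =
        (-1) ^ j * (fps_X ^ (2 * (Suc d - j)) * fps_X ^ (j * (j + 1) + 2 * 0 * j)) *
          (((1 - fps_X ^ (2 * j)) * inverse (qfact j)) * inverse (qfact (d - l)))"
        unfolding gauss_term_def using Suc by (simp only: mult_ac diff_Suc_Suc)
      also have "\<dots> = b j"
        unfolding e i[symmetric] using Suc by (simp add: b_def gauss_term_def mult_ac)
      finally show ?thesis .
    qed
    ultimately show ?thesis unfolding q distrib_right by simp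
  qed
  have "(1 - ?q) * (\<Sum>j\<le>Suc d. gauss_term (Suc d) 0 j) = (\<Sum>j\<le>Suc d. a j) + (\<Sum>j\<le>Suc d. b j)"
    unfolding sum_distrib_left sum.distrib[symmetric] using split by (intro sum.cong) auto
  also have "(\<Sum>j\<le>Suc d. a j) = 1"
    using Suc by (simp add: a_def)
  also have "(\<Sum>j\<le>Suc d. b j) = - ?q"
    unfolding sum.atMost_Suc_shift using Suc
    by (simp add: b_def sum_distrib_left[symmetric] sum_negf)
  finally have "(1 - ?q) * (\<Sum>j\<le>Suc d. gauss_term (Suc d) 0 j) = (1 - ?q) * 1" by simp
  moreover have "1 - ?q \<noteq> 0"
  proof
    assume "1 - ?q = 0"
    then have "fps_nth (1 - ?q) 0 = 0" by simp
    then show False by (simp add: fps_nth_power_0)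
  qed
  ultimately show ?case by (simp only: mult_cancel_left) simp
qed

lemma gauss_term_Suc:
  assumes "j \<le> Suc d"
  shows "gauss_term (Suc d) (Suc i) j =
    (if j \<le> d then gauss_term d (Suc i) j else 0) + fps_X ^ (2 * Suc d) * gauss_term (Suc d) i j"
proof -
  have x: "fps_X ^ (2 * Suc d) = fps_X ^ (2 * j) * (fps_X ^ (2 * (Suc d - j)) :: complex fps)"
  proof -
    have "2 * Suc d = 2 * j + 2 * (Suc d - j)" using assms by simp
    then show ?thesis by (simp only: power_add)
  qed
  have y: "fps_X ^ (j * (j + 1) + 2 * Suc i * j) = fps_X ^ (2 * j) * (fps_X ^ (j * (j + 1) + 2 * i * j) :: complex fps)"
  proof -
    have "j * (j + 1) + 2 * Suc i * j = 2 * j + (j * (j + 1) + 2 * i * j)" by (simp add: algebra_simps)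
    then show ?thesis by (simp only: power_add)
  qed
  show ?thesis
  proof (cases "j \<le> d")
    case True
    then have i: "inverse (qfact (d - j)) = (1 - fps_X ^ (2 * (Suc d - j))) * inverse (qfact (Suc d - j))"
      using inverse_qfact[of "d - j"] by (simp add: Suc_diff_le)
    have split: "s * (A * C) * (J * I) = s * (A * C) * (J * ((1 - B) * I)) + A * B * (s * C * (J * I))"
      for s A B C I J :: "complex fps" by (simp add: algebra_simps)
    show ?thesis using True by (simp only: if_True gauss_term_def x y i) (rule split)
  next
    case False
    then have "j = Suc d" using assms by simp
    then show ?thesis unfolding gauss_term_def x y by (simp add: mult_ac)
  qed
qed

text \<open>
  The partial fraction expansion of the Gaussian binomial coefficient. Each term satisfies the recursion
  of \<open>gauss_series\<close> by itself, so only the initial values need the sum.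
\<close>

lemma gauss_series_eq: "gauss_series d i = (\<Sum>j\<le>d. gauss_term d i j)"
proof (induction d arbitrary: i)
  case 0
  then show ?case by (simp add: gauss_series_forms_0 gauss_term_def qfact_def)
next
  case (Suc d)
  show ?case
  proof (induction i)
    case 0
    then show ?case by (simp only: gauss_series_0 gauss_term_sum_0)
  next
    case (Suc i)
    have "(\<Sum>j\<le>Suc d. gauss_term (Suc d) (Suc i) j) =
       (\<Sum>j\<le>Suc d. if j \<le> d then gauss_term d (Suc i) j else 0) +
         fps_X ^ (2 * Suc d) * (\<Sum>j\<le>Suc d. gauss_term (Suc d) i j)"
      unfolding sum_distrib_left sum.distrib[symmetric] by (intro sum.cong gauss_term_Suc) auto
    also have "(\<Sum>j\<le>Suc d. if j \<le> d then gauss_term d (Suc i) j else 0) = (\<Sum>j\<le>d. gauss_term d (Suc i) j)"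
      by simp
    finally show ?case
      using \<open>\<And>i. gauss_series d i = (\<Sum>j\<le>d. gauss_term d i j)\<close>[of "Suc i"] Suc
      by (simp only: gauss_series_Suc)
  qed
qed

text \<open>
  The weight of \<open>s\<close> is \<open>d * i\<close> minus the exponent of \<open>X\<close> that \<open>s\<close> contributes. The summand \<open>1\<close> of the factor
  \<open>1 + X\<close> picks out the weight \<open>0\<close>, and the summand \<open>X\<close> picks out the weight \<open>1\<close>.
\<close>

lemma card_eq_gauss_coeff:
  "of_nat (card {s \<in> multidegrees d i. form_weight d s \<in> {0, 1}}) =
    fps_nth ((1 + fps_X) * gauss_series d i) (d * i)"
proof -
  have w: "form_weight d s = int (d * i) - 2 * int (\<Sum>k\<le>d. k * s k)" if "s \<in> multidegrees d i" for s
  proof -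
    have "form_weight d s = int d * int (\<Sum>k\<le>d. s k) - 2 * int (\<Sum>k\<le>d. k * s k)"
      by (simp add: form_weight_def left_diff_distrib sum_subtractf sum_distrib_left mult.assoc)
    moreover have "(\<Sum>k\<le>d. s k) = i" using that by (simp add: multidegrees_def)
    ultimately show ?thesis by (simp only: of_nat_mult)
  qed
  have "(1 + fps_X) * gauss_series d i =
      (\<Sum>s\<in>multidegrees d i. fps_X ^ (2 * (\<Sum>k\<le>d. k * s k)) + fps_X ^ Suc (2 * (\<Sum>k\<le>d. k * s k)))"
    by (simp add: gauss_series_def sum_distrib_left algebra_simps)
  moreover have "fps_nth (fps_X ^ (2 * m) + fps_X ^ Suc (2 * m)) n =
      (if int n - 2 * int m \<in> {0, 1} then 1 else 0 :: complex)" for m n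
    by (auto simp: fps_X_power_nth simp del: power_Suc)
  ultimately have "fps_nth ((1 + fps_X) * gauss_series d i) (d * i) =
      (\<Sum>s\<in>multidegrees d i. if int (d * i) - 2 * int (\<Sum>k\<le>d. k * s k) \<in> {0, 1} then 1 else 0)"
    by (simp only: fps_sum_nth)
  also have "\<dots> = (\<Sum>s\<in>multidegrees d i. if form_weight d s \<in> {0, 1} then 1 else 0)"
    by (intro sum.cong refl) (simp only: w)
  also have "\<dots> = of_nat (card {s \<in> multidegrees d i. form_weight d s \<in> {0, 1}})"
    by (simp add: sum.If_cases finite_multidegrees Int_def)
  finally show ?thesis by simp
qed

definition springer_series :: "nat \<Rightarrow> nat \<Rightarrow> complex fps" where
  "springer_series d j =
     (-1) ^ j * (1 + fps_X) * fps_X ^ (j * (j + 1)) * (inverse (qfact j) * inverse (qfact (d - j)))"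

text \<open>
  The \<open>j\<close>-th partial fraction is divisible by \<open>X ^ (2 i j)\<close>. If \<open>2 j < d\<close>, this shifts the index \<open>d * i\<close> to
  \<open>(d - 2 j) * i\<close>. Otherwise \<open>2 i j \<ge> d i\<close>, and there is no contribution, because the numerator has the
  further factor \<open>X ^ (j (j + 1))\<close> with \<open>j > 0\<close>.
\<close>

lemma poincare_series_nth:
  assumes "d \<ge> 1"
  shows "fps_nth (poincare_series d) i =
    (\<Sum>j | 2 * j < d. fps_nth (springer_series d j) ((d - 2 * j) * i))"
proof -
  have "fps_nth (poincare_series d) i = fps_nth ((1 + fps_X) * gauss_series d i) (d * i)"
    unfolding poincare_series_def
    by (simp only: Abs_fps_inverse fps_nth_Abs_fps dim_covariants_component card_eq_gauss_coeff)
  also have "(1 + fps_X) * gauss_series d i = (\<Sum>j\<le>d. fps_X ^ (2 * i * j) * springer_series d j)"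
    unfolding gauss_series_eq sum_distrib_left
    by (intro sum.cong) (auto simp: gauss_term_def springer_series_def power_add mult_ac)
  also have "fps_nth (\<Sum>j\<le>d. fps_X ^ (2 * i * j) * springer_series d j) (d * i) =
      (\<Sum>j\<le>d. fps_nth (fps_X ^ (2 * i * j) * springer_series d j) (d * i))"
    by (rule fps_sum_nth)
  also have "\<dots> = (\<Sum>j\<in>{j. 2 * j < d}. fps_nth (fps_X ^ (2 * i * j) * springer_series d j) (d * i))"
  proof (intro sum.mono_neutral_right ballI)
    fix j assume "j \<in> {..d} - {j. 2 * j < d}"
    then have j: "2 * j \<ge> d" "j > 0" using assms by auto
    have "d * i \<le> 2 * i * j" using mult_right_mono[OF j(1), of i] by (simp add: mult_ac)
    moreover have "fps_nth (springer_series d j) 0 = 0"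
      using j(2) by (simp add: springer_series_def fps_nth_power_0)
    ultimately show "fps_nth (fps_X ^ (2 * i * j) * springer_series d j) (d * i) = 0"
      by (auto simp: fps_X_power_mult_nth)
  qed auto
  also have "\<dots> = (\<Sum>j | 2 * j < d. fps_nth (springer_series d j) ((d - 2 * j) * i))"
  proof (intro sum.cong refl)
    fix j assume "j \<in> {j. 2 * j < d}"
    then have "\<not> d * i < 2 * i * j" "d * i - 2 * i * j = (d - 2 * j) * i"
      by (auto simp: algebra_simps diff_mult_distrib not_less intro: mult_right_mono)
    then show "fps_nth (fps_X ^ (2 * i * j) * springer_series d j) (d * i) =
        fps_nth (springer_series d j) ((d - 2 * j) * i)"
      by (simp only: fps_X_power_mult_nth if_False)
  qed
  finally show ?thesis .
qed


definition thin :: "nat \<Rightarrow> complex fps \<Rightarrow> complex fps" where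
  "thin n f = Abs_fps (\<lambda>i. fps_nth f (n * i))"

definition thin_poly :: "nat \<Rightarrow> complex poly \<Rightarrow> complex poly" where
  "thin_poly n p = (\<Sum>i\<le>degree p. monom (coeff p (n * i)) i)"

lemma coeff_thin_poly:
  assumes "n > 0"
  shows "coeff (thin_poly n p) i = coeff p (n * i)"
proof (cases "i \<le> degree p")
  case True
  then show ?thesis
    by (simp add: thin_poly_def coeff_sum if_distrib sum.delta cong: if_cong)
next
  case False
  then have "degree p < n * i" using assms by (metis le_less_trans less_le_trans mult_le_mono1 nat_mult_1 not_le Suc_leI One_nat_def)
  then have "coeff p (n * i) = 0" by (rule coeff_eq_0)
  then show ?thesis using False
    by (simp add: thin_poly_def coeff_sum if_distrib sum.delta cong: if_cong)
qed

lemma fps_of_thin_poly: "n > 0 \<Longrightarrow> fps_of_poly (thin_poly n p) = thin n (fps_of_poly p)"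
  by (simp add: fps_eq_iff thin_def coeff_thin_poly)

text \<open>
  Taking every \<open>n\<close>-th coefficient is linear over the power series in \<open>X ^ n\<close>.
\<close>

lemma thin_mult:
  assumes "n > 0"
  shows "thin n (f * (1 - fps_X ^ (n * k))) = thin n f * (1 - fps_X ^ k)"
proof (rule fps_ext)
  fix i
  have "f * (1 - fps_X ^ (n * k)) = f - fps_X ^ (n * k) * f" "thin n f * (1 - fps_X ^ k) = thin n f - fps_X ^ k * thin n f"
    by (simp_all add: algebra_simps)
  then show "fps_nth (thin n (f * (1 - fps_X ^ (n * k)))) i = fps_nth (thin n f * (1 - fps_X ^ k)) i"
    using assms by (simp add: thin_def fps_X_power_mult_nth diff_mult_distrib2)
qed

lemma thin_mult_prod:
  assumes "n > 0"
  shows "thin n (f * (\<Prod>m=1..c. 1 - fps_X ^ (n * (2 * m)))) = thin n f * qfact c"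
proof (induction c arbitrary: f)
  case (Suc c)
  have "(\<Prod>m=1..Suc c. 1 - fps_X ^ (n * (2 * m))) =
      (\<Prod>m=1..c. 1 - fps_X ^ (n * (2 * m))) * (1 - fps_X ^ (n * (2 * Suc c)) :: complex fps)"
    by simp
  then have "thin n (f * (\<Prod>m=1..Suc c. 1 - fps_X ^ (n * (2 * m)))) =
      thin n ((f * (\<Prod>m=1..c. 1 - fps_X ^ (n * (2 * m)))) * (1 - fps_X ^ (n * (2 * Suc c))))"
    by (simp only: mult.assoc)
  also have "\<dots> = thin n f * qfact c * (1 - fps_X ^ (2 * Suc c))"
    unfolding thin_mult[OF assms] Suc ..
  finally show ?case by (simp only: qfact_Suc mult.assoc)
qed (simp add: qfact_def)

definition geom_poly :: "nat \<Rightarrow> nat \<Rightarrow> complex poly" where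
  "geom_poly n m = (\<Sum>k<n. monom 1 (m * k))"

lemma poly_geom_poly: "poly (geom_poly n m) z = (\<Sum>k<n. z ^ (m * k))"
  by (simp add: geom_poly_def poly_sum poly_monom)

lemma geom_poly_mult: "(1 - monom 1 m) * geom_poly n m = 1 - monom 1 (n * m)"
proof -
  have "geom_poly n m = (\<Sum>k<n. monom 1 m ^ k)"
    by (simp add: geom_poly_def monom_power)
  then show ?thesis
    using one_diff_power_eq[of "monom 1 m :: complex poly" n] by (simp add: monom_power mult.commute)
qed

definition qfact_poly :: "nat \<Rightarrow> complex poly" where
  "qfact_poly c = (\<Prod>m=1..c. 1 - monom 1 (2 * m))"

definition geom_prod :: "nat \<Rightarrow> nat \<Rightarrow> complex poly" where
  "geom_prod n c = (\<Prod>m=1..c. geom_poly n (2 * m))"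

text \<open>
  What remains of \<open>qfact_poly c\<close> when the factors \<open>1 - z\<close> are removed.
\<close>

definition qfact_cofactor :: "nat \<Rightarrow> complex poly" where
  "qfact_cofactor c = (\<Prod>m=1..c. geom_poly (2 * m) 1)"

lemma fps_of_qfact_poly: "fps_of_poly (qfact_poly c) = qfact c"
  by (simp add: qfact_poly_def qfact_def fps_of_poly_prod fps_of_poly_diff fps_of_poly_monom)

lemma poly_qfact_poly: "poly (qfact_poly c) z = (1 - z) ^ c * poly (qfact_cofactor c) z"
proof -
  have "1 - z ^ (2 * m) = (1 - z) * poly (geom_poly (2 * m) 1) z" for m
    using one_diff_power_eq[of z "2 * m"] by (simp add: poly_geom_poly)
  then show ?thesis
    by (simp add: qfact_poly_def qfact_cofactor_def poly_prod poly_monom prod.distrib)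
qed

lemma qfact_geom_prod:
  "(\<Prod>m=1..c. 1 - fps_X ^ (n * (2 * m))) = qfact c * fps_of_poly (geom_prod n c)"
proof -
  have "1 - fps_X ^ (n * (2 * m)) = (1 - fps_X ^ (2 * m)) * fps_of_poly (geom_poly n (2 * m))" for m
  proof -
    have eq: "fps_of_poly (1 - monom 1 k) = 1 - (fps_X ^ k :: complex fps)" for k
      by (simp add: fps_of_poly_diff fps_of_poly_monom)
    show ?thesis by (simp only: eq[symmetric] geom_poly_mult[symmetric] fps_of_poly_mult)
  qed
  then show ?thesis
    by (simp only: qfact_def geom_prod_def fps_of_poly_prod prod.distrib)
qed

text \<open>
  The numerator of \<open>springer_series d j\<close> after extending each denominator \<open>1 - X ^ (2 m)\<close> to
  \<open>1 - X ^ (2 m n)\<close>, where \<open>n = d - 2 j\<close>; a power series in \<open>X ^ n\<close> can then be taken out of \<open>thin n\<close>.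
\<close>

definition springer_numerator :: "nat \<Rightarrow> nat \<Rightarrow> complex poly" where
  "springer_numerator d j = smult ((-1) ^ j) ([:1, 1:] * monom 1 (j * (j + 1)) *
     (geom_prod (d - 2 * j) j * geom_prod (d - 2 * j) (d - j)))"

lemma thin_springer_series:
  assumes "2 * j < d"
  shows "thin (d - 2 * j) (springer_series d j) * (qfact j * qfact (d - j)) =
    fps_of_poly (thin_poly (d - 2 * j) (springer_numerator d j))"
proof -
  define n where "n = d - 2 * j"
  have n: "n > 0" using assms by (simp add: n_def)
  have "thin n (springer_series d j) * (qfact j * qfact (d - j)) =
      thin n (springer_series d j * (\<Prod>m=1..j. 1 - fps_X ^ (n * (2 * m))) * (\<Prod>m=1..d - j. 1 - fps_X ^ (n * (2 * m))))"
    unfolding thin_mult_prod[OF n] by (simp only: mult.assoc)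
  also have "springer_series d j * (\<Prod>m=1..j. 1 - fps_X ^ (n * (2 * m))) * (\<Prod>m=1..d - j. 1 - fps_X ^ (n * (2 * m))) =
      (-1) ^ j * ((1 + fps_X) * fps_X ^ (j * (j + 1)) * (fps_of_poly (geom_prod n j) * fps_of_poly (geom_prod n (d - j)))) *
      ((qfact j * inverse (qfact j)) * (qfact (d - j) * inverse (qfact (d - j))))"
    unfolding qfact_geom_prod springer_series_def by (simp only: mult_ac)
  also have "\<dots> = fps_of_poly (springer_numerator d j)"
  proof -
    have m1: "(-1 :: complex fps) ^ j = fps_const ((-1) ^ j)"
      by (simp flip: fps_const_neg fps_const_power)
    have "fps_of_poly [:1, 1 :: complex:] = 1 + fps_X" by (simp add: fps_of_poly_pCons)
    then show ?thesis
      unfolding qfact_inverse m1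
      by (simp add: springer_numerator_def fps_of_poly_smult fps_of_poly_mult fps_of_poly_monom
          n_def mult.assoc)
  qed
  finally show ?thesis
    using fps_of_thin_poly[OF n] by (simp add: n_def)
qed

lemma poincare_series_eq:
  assumes "d \<ge> 1"
  shows "poincare_series d = (\<Sum>j | 2 * j < d. thin (d - 2 * j) (springer_series d j))"
  by (simp add: fps_eq_iff poincare_series_nth[OF assms] fps_sum_nth thin_def)

text \<open>
  Dividing by the greatest common divisor gives one coprime representation, and any two are proportional.
  A zero of the denominator \<open>Q\<close> may be cancelled in \<open>poincare_fun\<close>, which is why it is excluded.
\<close>

lemma poincare_fun_eqI:
  assumes PQ: "poincare_series d * fps_of_poly Q = fps_of_poly N" and "Q \<noteq> 0" and z: "poly Q z \<noteq> 0"
  shows "poincare_fun d z = poly N z / poly Q z"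
proof -
  define rat where "rat p q \<longleftrightarrow> q \<noteq> 0 \<and> coprime p q \<and>
    poincare_series d * fps_of_poly q = fps_of_poly p" for p q
  have cross: "p * Q' = N' * q"
    if "poincare_series d * fps_of_poly q = fps_of_poly p"
      "poincare_series d * fps_of_poly Q' = fps_of_poly N'" for p q N' Q'
  proof -
    have "fps_of_poly (p * Q') = fps_of_poly (N' * q)"
      unfolding fps_of_poly_mult that[symmetric] by (simp only: mult_ac)
    then show ?thesis by (simp only: fps_of_poly_eq_iff)
  qed
  define g where "g = gcd N Q"
  define p q where "p = N div g" and "q = Q div g"
  have g: "g \<noteq> 0" "N = p * g" "Q = q * g" using assms(2) by (auto simp: g_def p_def q_def)
  have "rat p q"
  proof -
    have "(poincare_series d * fps_of_poly q) * fps_of_poly g = fps_of_poly p * fps_of_poly g"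
      using PQ unfolding g(2,3) fps_of_poly_mult by (simp only: mult.assoc)
    moreover have "fps_of_poly g \<noteq> 0" using g(1) by (metis fps_of_poly_0 fps_of_poly_eq_iff)
    moreover have "coprime p q"
      unfolding p_def q_def g_def using assms(2) by (intro div_gcd_coprime) auto
    ultimately show ?thesis using assms(2) g(3) by (auto simp: rat_def)
  qed
  have uniq: "(\<lambda>z. poly p' z / poly q' z) = (\<lambda>z. poly p z / poly q z)" if "rat p' q'" for p' q'
  proof -
    have eq: "p' * q = p * q'" using cross \<open>rat p q\<close> that unfolding rat_def by blast
    have "q dvd q'"
    proof -
      have "q dvd p * q'" using eq by (metis dvd_triv_right)
      then show ?thesis using \<open>rat p q\<close> by (simp add: rat_def coprime_dvd_mult_right_iff coprime_commute)
    qed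
    moreover have "q' dvd q"
    proof -
      have "q' dvd p' * q" using eq by (metis dvd_triv_right)
      then show ?thesis using that by (simp add: rat_def coprime_dvd_mult_right_iff coprime_commute)
    qed
    ultimately obtain r where r: "q' = q * r" "q' dvd q" by (metis dvdE)
    have q0: "q \<noteq> 0" "q' \<noteq> 0" using \<open>rat p q\<close> that by (auto simp: rat_def)
    have "degree q' \<le> degree q" using r(2) q0 by (intro dvd_imp_degree_le)
    then have "degree r = 0" using r(1) q0 by (simp add: degree_mult_eq)
    then obtain c where "r = [:c:]" by (metis degree_eq_zeroE)
    then have c: "q' = smult c q" "c \<noteq> 0" using r(1) q0 by auto
    then have "q * p' = q * smult c p" using eq by (simp add: mult_ac)
    then have "p' = smult c p" using q0(1) by (simp only: mult_cancel_left) simp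
    then show ?thesis using c by (auto simp: fun_eq_iff)
  qed
  have "poincare_fun d = (\<lambda>z. poly p z / poly q z)"
    unfolding poincare_fun_def
  proof (rule the_equality)
    show "\<exists>p' q'. q' \<noteq> 0 \<and> coprime p' q' \<and> poincare_series d * fps_of_poly q' = fps_of_poly p' \<and>
        (\<lambda>z. poly p z / poly q z) = (\<lambda>z. poly p' z / poly q' z)"
      using \<open>rat p q\<close> unfolding rat_def by blast
  next
    fix R assume "\<exists>p q. q \<noteq> 0 \<and> coprime p q \<and> poincare_series d * fps_of_poly q = fps_of_poly p \<and>
        R = (\<lambda>z. poly p z / poly q z)"
    then show "R = (\<lambda>z. poly p z / poly q z)" using uniq unfolding rat_def by metis
  qed
  then show ?thesis using z by (simp add: g(2,3))
qed

definition pole_numerator :: "nat \<Rightarrow> complex \<Rightarrow> complex" where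
  "pole_numerator d z = (\<Sum>j | 2 * j < d. poly (thin_poly (d - 2 * j) (springer_numerator d j)) z /
     (poly (qfact_cofactor j) z * poly (qfact_cofactor (d - j)) z))"

lemma finite_half: "finite {j. 2 * j < (d::nat)}"
  by (rule finite_subset[of _ "{..d}"]) auto

text \<open>
  The summand with index \<open>j\<close> has the denominator \<open>qfact_poly j * qfact_poly (d - j)\<close>, a product of \<open>d\<close>
  factors that each have a simple zero at \<open>1\<close>.
\<close>

lemma poincare_fun_near_1:
  assumes "d \<ge> 1"
  shows "eventually (\<lambda>z. poincare_fun d z = pole_numerator d z / (1 - z) ^ d) (at 1)"
proof -
  define J where "J = {j. 2 * j < d}"
  define g where "g j = thin_poly (d - 2 * j) (springer_numerator d j)" for j
  define D where "D j = qfact_poly j * qfact_poly (d - j)" for j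
  define Q where "Q = (\<Prod>j\<in>J. D j)"
  define N where "N = (\<Sum>j\<in>J. g j * (\<Prod>l\<in>J - {j}. D l))"
  have J: "finite J" unfolding J_def by (rule finite_half)
  have "qfact_poly c \<noteq> 0" for c
    using fps_of_qfact_poly[of c] by (metis fps_of_poly_0 qfact_nonzero)
  then have Q0: "Q \<noteq> 0" by (simp add: Q_def D_def J)
  have "poincare_series d * fps_of_poly Q = fps_of_poly N"
  proof -
    have "thin (d - 2 * j) (springer_series d j) * fps_of_poly Q = fps_of_poly (g j * (\<Prod>l\<in>J - {j}. D l))"
      if "j \<in> J" for j
    proof -
      have "thin (d - 2 * j) (springer_series d j) * fps_of_poly (D j) = fps_of_poly (g j)"
        using thin_springer_series[of j d] that
        by (simp add: D_def g_def J_def fps_of_poly_mult fps_of_qfact_poly)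
      then show ?thesis
        using prod.remove[OF J that, of D] by (simp add: Q_def fps_of_poly_mult mult.assoc[symmetric])
    qed
    then show ?thesis
      unfolding poincare_series_eq[OF assms] J_def[symmetric] sum_distrib_right N_def fps_of_poly_sum
      by (intro sum.cong) auto
  qed
  note eq = poincare_fun_eqI[OF this Q0]
  have "eventually (\<lambda>z. poly Q z \<noteq> 0) (at 1)"
    using islimpt_finite[OF poly_roots_finite[OF Q0]] by (simp add: islimpt_iff_eventually)
  moreover have "poincare_fun d z = pole_numerator d z / (1 - z) ^ d" if "poly Q z \<noteq> 0" for z
  proof -
    have D0: "poly (D j) z \<noteq> 0" if "j \<in> J" for j
      using \<open>poly Q z \<noteq> 0\<close> that J by (auto simp: Q_def poly_prod)
    have "poly N z / poly Q z = (\<Sum>j\<in>J. poly (g j) z / poly (D j) z)"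
      unfolding N_def poly_sum sum_divide_distrib
    proof (intro sum.cong refl)
      fix j assume j: "j \<in> J"
      have "poly Q z = poly (D j) z * poly (\<Prod>l\<in>J - {j}. D l) z"
        unfolding Q_def using prod.remove[OF J j, of D] by simp
      then show "poly (g j * (\<Prod>l\<in>J - {j}. D l)) z / poly Q z = poly (g j) z / poly (D j) z"
        using that by (simp del: poly_prod)
    qed
    also have "\<dots> = (\<Sum>j\<in>J. (poly (g j) z / (poly (qfact_cofactor j) z * poly (qfact_cofactor (d - j)) z)) / (1 - z) ^ d)"
    proof (intro sum.cong refl)
      fix j assume "j \<in> J"
      then have "(1 - z) ^ d = (1 - z) ^ j * (1 - z) ^ (d - j)"
        by (simp add: J_def flip: power_add)
      then show "poly (g j) z / poly (D j) z =
          (poly (g j) z / (poly (qfact_cofactor j) z * poly (qfact_cofactor (d - j)) z)) / (1 - z) ^ d"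
        by (simp add: D_def poly_qfact_poly mult_ac)
    qed
    also have "\<dots> = pole_numerator d z / (1 - z) ^ d"
      by (simp add: pole_numerator_def J_def g_def sum_divide_distrib)
    finally show ?thesis using eq[OF that] by simp
  qed
  ultimately show ?thesis by (auto elim: eventually_mono)
qed


section \<open>The leading Laurent coefficients\<close>

text \<open>
  Multiplication by a primitive root of unity permutes the roots of unity and multiplies the sum by the
  \<open>k\<close>-th power of that root, which differs from \<open>1\<close> unless \<open>n\<close> divides \<open>k\<close>.
\<close>

lemma sum_roots_unity_power:
  assumes "n > 0"
  shows "(\<Sum>z | z ^ n = (1::complex). z ^ k) = (if n dvd k then of_nat n else (0 :: complex))"
proof -
  define w where "w = exp (2 * of_real pi * \<i> * of_nat 1 / of_nat n)"
  have w_pow: "w ^ l = exp (2 * of_real pi * \<i> * of_nat l / of_nat n)" for l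
    unfolding w_def by (simp add: exp_of_nat_mult[symmetric] mult_ac)
  have wn: "w ^ n = 1" and wk: "w ^ k = 1 \<longleftrightarrow> n dvd k"
    unfolding w_pow using complex_root_unity_eq_1[of n n] complex_root_unity_eq_1[of n k] assms by auto
  show ?thesis
  proof (cases "n dvd k")
    case True
    then obtain l where "k = n * l" by (auto elim: dvdE)
    then have "(\<Sum>z | z ^ n = (1::complex). z ^ k) = (\<Sum>z | z ^ n = (1::complex). 1)"
      by (intro sum.cong) (auto simp: power_mult)
    also have "\<dots> = of_nat n" using assms by (simp add: card_roots_unity_eq)
    finally show ?thesis using True by simp
  next
    case False
    have w0: "w \<noteq> 0" by (simp add: w_def)
    have "(\<Sum>z | z ^ n = (1::complex). z ^ k) = (\<Sum>z | z ^ n = 1. (w * z) ^ k)"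
      using w0 wn by (intro sum.reindex_bij_witness[of _ "\<lambda>z. w * z" "\<lambda>z. z / w"])
        (auto simp: power_mult_distrib power_divide)
    then have "(1 - w ^ k) * (\<Sum>z | z ^ n = (1::complex). z ^ k) = 0"
      by (simp add: power_mult_distrib sum_distrib_left[symmetric] left_diff_distrib)
    then show ?thesis using False wk by simp
  qed
qed

lemma poly_thin_poly_1:
  assumes "n > 0"
  shows "of_nat n * poly (thin_poly n p) 1 = (\<Sum>z | z ^ n = (1::complex). poly p z)"
proof -
  have "(\<Sum>z | z ^ n = (1::complex). poly p z) = (\<Sum>k\<le>degree p. coeff p k * (\<Sum>z | z ^ n = (1::complex). z ^ k))"
    unfolding poly_altdef sum_distrib_left by (rule sum.swap)
  also have "\<dots> = (\<Sum>k\<in>{k \<in> {..degree p}. n dvd k}. of_nat n * coeff p k)"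
    unfolding sum_roots_unity_power[OF assms] by (simp add: sum.If_cases if_distrib Int_def mult.commute cong: if_cong)
  also have "\<dots> = (\<Sum>k\<in>(\<lambda>i. n * i) ` {..degree p}. of_nat n * coeff p k)"
  proof (intro sum.mono_neutral_left)
    show "{k \<in> {..degree p}. n dvd k} \<subseteq> (\<lambda>i. n * i) ` {..degree p}"
    proof
      fix k assume k: "k \<in> {k \<in> {..degree p}. n dvd k}"
      then obtain i where i: "k = n * i" by (auto elim: dvdE)
      then have "i \<le> k" using assms by simp
      then have "i \<in> {..degree p}" using k by auto
      then show "k \<in> (\<lambda>i. n * i) ` {..degree p}" unfolding i by (rule imageI)
    qed
  qed (auto intro: le_degree)
  also have "\<dots> = (\<Sum>i\<le>degree p. of_nat n * coeff p (n * i))"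
    using assms by (subst sum.reindex) (auto simp: inj_on_def)
  also have "\<dots> = of_nat n * poly (thin_poly n p) 1"
    by (simp add: thin_poly_def poly_sum poly_monom sum_distrib_left)
  finally show ?thesis by simp
qed

text \<open>
  The Euler operator \<open>z d/dz\<close> multiplies the \<open>k\<close>-th coefficient by \<open>k\<close>. So it commutes with \<open>thin_poly n\<close>
  up to the factor \<open>n\<close>, and the previous formula applies.
\<close>

lemma poly_pderiv_thin_poly_1:
  assumes "n > 0"
  shows "of_nat n ^ 2 * poly (pderiv (thin_poly n p)) 1 = (\<Sum>z | z ^ n = 1. z * poly (pderiv p) z)"
proof -
  have euler: "coeff ([:0, 1:] * pderiv q) k = of_nat k * coeff q k" for q :: "complex poly" and k
    by (cases k) (simp_all add: coeff_pderiv del: of_nat_Suc)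
  have "thin_poly n ([:0, 1:] * pderiv p) = smult (of_nat n) ([:0, 1:] * pderiv (thin_poly n p))"
    by (rule poly_eqI) (simp only: coeff_thin_poly[OF assms] euler coeff_smult of_nat_mult mult.assoc)
  then show ?thesis
    using poly_thin_poly_1[OF assms, of "[:0, 1:] * pderiv p"] by (simp add: power2_eq_square mult_ac)
qed

lemma geom_poly_root:
  assumes "z ^ n = 1" "z ^ m \<noteq> 1"
  shows "[:-z, 1:] dvd geom_poly n m"
proof -
  have "(z ^ m) ^ n = 1" using assms(1) by (metis power_mult mult.commute power_one)
  then have "(1 - z ^ m) * poly (geom_poly n m) z = 0"
    using arg_cong[OF geom_poly_mult[of m n], of "\<lambda>p. poly p z"]
    by (simp add: poly_monom power_mult[symmetric] mult.commute)
  then show ?thesis using assms(2) by (simp add: poly_eq_0_iff_dvd)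
qed

text \<open>
  The polynomial \<open>geom_poly n (2 m)\<close> vanishes at an \<open>n\<close>-th root of unity \<open>z\<close> unless \<open>z ^ (2 m) = 1\<close>. The
  hypothesis \<open>z ^ 2 \<noteq> 1\<close> makes the factor with \<open>m = 1\<close> vanish. For \<open>j > 0\<close> it occurs in both products;
  for \<open>j = 0\<close> the factor with \<open>m = 2\<close> or \<open>m = 3\<close> vanishes too, and \<open>d = n \<ge> 3\<close> ensures that it is there.
\<close>

lemma springer_numerator_double_root:
  assumes "2 * j < d" "z ^ (d - 2 * j) = 1" "z ^ 2 \<noteq> 1"
  shows "poly (springer_numerator d j) z = 0" "poly (pderiv (springer_numerator d j)) z = 0"
proof -
  define n where "n = d - 2 * j"
  have zn: "z ^ n = 1" using assms(2) n_def by simp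
  have n3: "n \<ge> 3"
  proof (rule ccontr)
    assume "\<not> n \<ge> 3"
    then consider "n = 0" | "n = 1" | "n = 2" by linarith
    then show False using zn assms(1,3) by cases (auto simp: n_def)
  qed
  have root: "[:-z, 1:] dvd geom_poly n (2 * m)" if "z ^ (2 * m) \<noteq> 1" for m
    using geom_poly_root[OF zn that] .
  have "[:-z, 1:] * [:-z, 1:] dvd geom_prod n j * geom_prod n (d - j)"
  proof (cases "j = 0")
    case False
    have "geom_poly n (2 * 1) dvd geom_prod n c" if "c > 0" for c
      unfolding geom_prod_def by (rule dvd_prodI) (use that in auto)
    then have "[:-z, 1:] dvd geom_prod n c" if "c > 0" for c
      using root[of 1] assms(3) that by (metis dvd_trans mult.right_neutral)
    then show ?thesis using False assms(1) by (intro mult_dvd_mono) auto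
  next
    case True
    \<comment> \<open>If both the fourth and the sixth power were 1, so would be their quotient, the square.\<close>
    obtain m where m: "m \<in> {2, 3}" "z ^ (2 * m) \<noteq> 1"
    proof (cases "z ^ 4 = 1")
      case True
      have "z ^ 6 = z ^ 4 * z ^ 2" by (simp flip: power_add)
      then show thesis using that[of 3] True assms(3) by simp
    qed (use that[of 2] in simp)
    have "geom_poly n (2 * 1) * geom_poly n (2 * m) = (\<Prod>l\<in>{1, m}. geom_poly n (2 * l))"
      using m(1) by auto
    also have "\<dots> dvd geom_prod n d"
      unfolding geom_prod_def using m(1) n3 True by (intro prod_dvd_prod_subset) (auto simp: n_def)
    finally have "geom_poly n (2 * 1) * geom_poly n (2 * m) dvd geom_prod n d" .
    moreover have "[:-z, 1:] * [:-z, 1:] dvd geom_poly n (2 * 1) * geom_poly n (2 * m)"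
      using root[of 1] root[OF m(2)] assms(3) by (intro mult_dvd_mono) auto
    ultimately have "[:-z, 1:] * [:-z, 1:] dvd geom_prod n d" by (rule dvd_trans[rotated])
    then show ?thesis using True by (simp add: geom_prod_def)
  qed
  then have "[:-z, 1:] * [:-z, 1:] dvd springer_numerator d j"
    unfolding springer_numerator_def n_def[symmetric] by (rule dvd_smult[OF dvd_mult])
  then obtain r where r: "springer_numerator d j = [:-z, 1:] * ([:-z, 1:] * r)"
    by (metis dvdE mult.assoc)
  have "poly [:-z, 1:] z = 0" by simp
  then show "poly (springer_numerator d j) z = 0" "poly (pderiv (springer_numerator d j)) z = 0"
    unfolding r by (simp_all only: pderiv_mult poly_add poly_mult mult_zero_left mult_zero_right add_0)
qed

lemma geom_prod_Suc: "geom_prod n (Suc c) = geom_prod n c * geom_poly n (2 * Suc c)"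
  by (simp add: geom_prod_def)

lemma geom_prod_at_square_1:
  assumes "z ^ 2 = 1"
  shows "poly (geom_prod n c) z = of_nat n ^ c"
proof -
  have "poly (geom_poly n (2 * m)) z = of_nat n" for m
    using assms by (simp add: poly_geom_poly power_mult)
  then show ?thesis by (simp add: geom_prod_def poly_prod)
qed

lemma geom_poly_1: "poly (geom_poly n m) 1 = of_nat n"
  by (simp add: poly_geom_poly)

lemma geom_poly_pderiv_1: "2 * poly (pderiv (geom_poly n m)) 1 = of_nat m * of_nat n * (of_nat n - 1)"
proof (induction n)
  case 0
  then show ?case by (simp add: geom_poly_def)
next
  case (Suc n)
  have "poly (pderiv (monom 1 k)) 1 = (of_nat k :: complex)" for k
    by (cases k) (auto simp: pderiv_monom poly_monom)
  then have "poly (pderiv (geom_poly (Suc n) m)) 1 = poly (pderiv (geom_poly n m)) 1 + of_nat (m * n)"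
    by (simp add: geom_poly_def pderiv_add)
  then show ?case using Suc by (simp add: algebra_simps)
qed

lemma geom_prod_pderiv_1:
  "2 * poly (pderiv (geom_prod n c)) 1 = of_nat n ^ c * (of_nat n - 1) * of_nat (c * (c + 1))"
proof (induction c)
  case 0
  then show ?case by (simp add: geom_prod_def)
next
  case (Suc c)
  have "2 * poly (pderiv (geom_prod n (Suc c))) 1 =
      of_nat n ^ c * (2 * poly (pderiv (geom_poly n (2 * Suc c))) 1) +
      of_nat n * (2 * poly (pderiv (geom_prod n c)) 1)"
    by (simp add: geom_prod_Suc pderiv_mult geom_prod_at_square_1 geom_poly_1 algebra_simps)
  then show ?case unfolding Suc geom_poly_pderiv_1 by (simp add: algebra_simps)
qed

lemma qfact_cofactor_Suc: "qfact_cofactor (Suc c) = qfact_cofactor c * geom_poly (2 * Suc c) 1"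
  by (simp add: qfact_cofactor_def)

lemma qfact_cofactor_1: "poly (qfact_cofactor c) 1 = 2 ^ c * fact c"
  by (induction c) (simp_all add: qfact_cofactor_Suc geom_poly_1 qfact_cofactor_def[of 0] algebra_simps del: mult_Suc_right)

lemma qfact_cofactor_pderiv_1:
  "2 * poly (pderiv (qfact_cofactor c)) 1 = 2 ^ c * fact c * of_nat c ^ 2"
proof (induction c)
  case 0
  then show ?case by (simp add: qfact_cofactor_def)
next
  case (Suc c)
  have "2 * poly (pderiv (qfact_cofactor (Suc c))) 1 =
      2 ^ c * fact c * (2 * poly (pderiv (geom_poly (2 * Suc c) 1)) 1) +
      of_nat (2 * Suc c) * (2 * poly (pderiv (qfact_cofactor c)) 1)"
    by (simp only: qfact_cofactor_Suc pderiv_mult geom_poly_1 qfact_cofactor_1 poly_add poly_mult)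
      (simp add: algebra_simps)
  then show ?case unfolding Suc geom_poly_pderiv_1 by (simp add: algebra_simps power2_eq_square)
qed

text \<open>
  Among the roots of unity only \<open>1\<close> contributes: at \<open>-1\<close> the factor \<open>1 + z\<close> vanishes.
\<close>

lemma thin_springer_numerator_1:
  assumes "2 * j < d"
  shows "poly (thin_poly (d - 2 * j) (springer_numerator d j)) 1 = (-1) ^ j * 2 * of_nat (d - 2 * j) ^ (d - 1)"
proof -
  define n where "n = d - 2 * j"
  have n: "n > 0" using assms by (simp add: n_def)
  have "of_nat n * poly (thin_poly n (springer_numerator d j)) 1 = (\<Sum>z | z ^ n = (1::complex). poly (springer_numerator d j) z)"
    by (rule poly_thin_poly_1[OF n])
  also have "\<dots> = (\<Sum>z\<in>{1}. poly (springer_numerator d j) z)"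
  proof (intro sum.mono_neutral_right ballI)
    fix z :: complex assume z: "z \<in> {z. z ^ n = 1} - {1}"
    show "poly (springer_numerator d j) z = 0"
    proof (cases "z ^ 2 = 1")
      case True
      then have "z = -1" using z by (simp add: power2_eq_1_iff)
      then show ?thesis by (simp add: springer_numerator_def)
    next
      case False
      then show ?thesis using springer_numerator_double_root[OF assms] z by (simp add: n_def)
    qed
  qed (use n in \<open>auto simp: finite_roots_unity\<close>)
  also have "\<dots> = (-1) ^ j * 2 * of_nat n ^ (j + (d - j))"
    by (simp add: springer_numerator_def poly_monom geom_prod_at_square_1 power_add flip: n_def)
  also have "of_nat n ^ (j + (d - j)) = (of_nat n * of_nat n ^ (d - 1) :: complex)"
    using assms by (simp flip: power_Suc)
  finally show ?thesis using n by (simp add: n_def)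
qed

text \<open>
  The roots of unity \<open>1\<close> and \<open>-1\<close> contribute; the latter occurs for even \<open>d\<close>, where it cancels the derivative
  of the factor \<open>1 + z\<close> at \<open>1\<close>.
\<close>

lemma thin_springer_numerator_pderiv_1:
  assumes "2 * j < d"
  defines "n \<equiv> d - 2 * j"
  shows "of_nat n ^ 2 * poly (pderiv (thin_poly n (springer_numerator d j))) 1 = (-1) ^ j * of_nat n ^ d *
    ((if even d then 0 else 1) + 2 * of_nat (j * (j + 1)) +
       (of_nat n - 1) * (of_nat (j * (j + 1)) + of_nat ((d - j) * (d - j + 1))))"
proof -
  have n: "n > 0" using assms by (simp add: n_def)
  define G where "G = springer_numerator d j"
  define A B where "A = geom_prod n j" and "B = geom_prod n (d - j)"
  define M where "M = (monom 1 (j * (j + 1)) :: complex poly)"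
  define L where "L = [:1, 1 :: complex:]"
  have G: "G = smult ((-1) ^ j) (L * M * (A * B))"
    unfolding G_def springer_numerator_def A_def B_def n_def M_def L_def ..
  have L: "poly L 1 = 2" "poly L (-1) = 0" "poly (pderiv L) z = 1" for z
    by (simp_all add: L_def pderiv_pCons)
  have nd: "of_nat n ^ j * of_nat n ^ (d - j) = (of_nat n ^ d :: complex)"
    using assms(1) by (simp flip: power_add)
  have M1: "poly M 1 = 1" "poly M (-1) = 1" by (simp_all add: M_def poly_monom)
  have M': "poly (pderiv M) 1 = of_nat (j * (j + 1))"
    unfolding M_def by (cases "j * (j + 1)") (auto simp: pderiv_monom poly_monom)
  have AB: "poly A z = of_nat n ^ j" "poly B z = of_nat n ^ (d - j)" if "z ^ 2 = 1" for z
    using that by (simp_all add: A_def B_def geom_prod_at_square_1)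
  have at_minus_1: "poly (pderiv G) (-1) = (-1) ^ j * of_nat n ^ d"
    unfolding G by (simp add: pderiv_smult pderiv_mult L M1 AB nd)
  have AB': "2 * poly (pderiv A) 1 = of_nat n ^ j * (of_nat n - 1) * of_nat (j * (j + 1))"
    "2 * poly (pderiv B) 1 = of_nat n ^ (d - j) * (of_nat n - 1) * of_nat ((d - j) * (d - j + 1))"
    unfolding A_def B_def by (rule geom_prod_pderiv_1)+
  have "poly (pderiv G) 1 = (-1) ^ j * (poly A 1 * poly B 1 * (1 + 2 * of_nat (j * (j + 1))) +
      poly A 1 * (2 * poly (pderiv B) 1) + (2 * poly (pderiv A) 1) * poly B 1)"
    unfolding G by (simp add: pderiv_smult pderiv_mult L M1 M' algebra_simps del: of_nat_mult of_nat_add)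
  also have "\<dots> = (-1) ^ j * ((of_nat n ^ j * of_nat n ^ (d - j)) * (1 + 2 * of_nat (j * (j + 1)) +
       (of_nat n - 1) * (of_nat (j * (j + 1)) + of_nat ((d - j) * (d - j + 1)))))"
    unfolding AB' by (simp add: AB algebra_simps del: of_nat_mult of_nat_add)
  finally have at_1: "poly (pderiv G) 1 = (-1) ^ j * of_nat n ^ d * (1 + 2 * of_nat (j * (j + 1)) +
       (of_nat n - 1) * (of_nat (j * (j + 1)) + of_nat ((d - j) * (d - j + 1))))"
    unfolding nd by (simp only: mult.assoc)
  have even: "(-1 :: complex) ^ n = 1 \<longleftrightarrow> even d"
    using assms(1) by (cases "even d") (auto simp: n_def)
  have "of_nat n ^ 2 * poly (pderiv (thin_poly n G)) 1 = (\<Sum>z | z ^ n = 1. z * poly (pderiv G) z)"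
    by (rule poly_pderiv_thin_poly_1[OF n])
  also have "\<dots> = (\<Sum>z\<in>(if even d then {1, -1} else {1}). z * poly (pderiv G) z)"
  proof (intro sum.mono_neutral_right ballI)
    fix z :: complex assume z: "z \<in> {z. z ^ n = 1} - (if even d then {1, -1} else {1})"
    then have "z ^ 2 \<noteq> 1" using even by (auto simp: power2_eq_1_iff split: if_splits)
    then show "z * poly (pderiv G) z = 0"
      using springer_numerator_double_root[OF assms(1)] z by (simp add: n_def G_def)
  qed (use n even in \<open>auto simp: finite_roots_unity\<close>)
  also have "\<dots> = poly (pderiv G) 1 - (if even d then poly (pderiv G) (-1) else 0)"
    by simp
  finally have eq: "of_nat n ^ 2 * poly (pderiv (thin_poly n G)) 1 =
      poly (pderiv G) 1 - (if even d then poly (pderiv G) (-1) else 0)" .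
  have parity: "c * (1 + X + Y) - (if even d then c else 0) = c * ((if even d then 0 else 1) + X + Y)"
    for c X Y :: complex by (simp add: algebra_simps)
  show ?thesis
    unfolding eq[unfolded at_1 at_minus_1, unfolded G_def] by (rule parity)
qed


text \<open>
  Up to the factor \<open>k!\<close>, the sum is the coefficient of \<open>t ^ k\<close> in \<open>(exp t - exp (- t)) ^ d\<close>, a power
  series that is divisible by \<open>t ^ d\<close>.
\<close>

lemma alternating_binomial_power_sum:
  assumes "k < d"
  shows "(\<Sum>j\<le>d. (-1) ^ j * of_nat (d choose j) * (of_nat d - 2 * of_nat j :: complex) ^ k) = 0"
proof -
  define f where "f = - fps_exp (-1 :: complex) + fps_exp 1"
  have "f ^ d = (\<Sum>j\<le>d. of_nat (d choose j) * (- fps_exp (-1)) ^ j * fps_exp 1 ^ (d - j))"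
    unfolding f_def by (rule binomial_ring)
  also have "\<dots> = (\<Sum>j\<le>d. fps_const ((-1) ^ j * of_nat (d choose j)) * fps_exp (of_nat d - 2 * of_nat j))"
  proof (intro sum.cong refl)
    fix j assume "j \<in> {..d}"
    then have "fps_exp (of_nat d - 2 * of_nat j :: complex) = fps_exp (-1) ^ j * fps_exp 1 ^ (d - j)"
      by (simp add: fps_exp_power_mult of_nat_diff flip: fps_exp_add_mult)
    moreover have "(- fps_exp (-1 :: complex)) ^ j = fps_const ((-1) ^ j) * fps_exp (-1) ^ j"
      by (simp add: power_minus[of "fps_exp (-1)"] flip: fps_const_power fps_const_neg)
    ultimately show "of_nat (d choose j) * (- fps_exp (-1 :: complex)) ^ j * fps_exp 1 ^ (d - j) =
        fps_const ((-1) ^ j * of_nat (d choose j)) * fps_exp (of_nat d - 2 * of_nat j)"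
      by (simp add: fps_of_nat[symmetric] mult_ac flip: fps_const_mult)
  qed
  finally have "fps_nth (f ^ d) k =
      (\<Sum>j\<le>d. (-1) ^ j * of_nat (d choose j) * ((of_nat d - 2 * of_nat j) ^ k / fact k))"
    by (simp add: fps_sum_nth)
  moreover have "fps_nth (f ^ d) k = 0"
    using startsby_zero_power_prefix[of f d] assms by (simp add: f_def)
  ultimately have "(\<Sum>j\<le>d. (-1) ^ j * of_nat (d choose j) * (of_nat d - 2 * of_nat j :: complex) ^ k) / fact k = 0"
    by (simp add: sum_divide_distrib)
  then show ?thesis by simp
qed

text \<open>
  For odd \<open>d\<close> the summand is invariant under \<open>j\<close> to \<open>d - j\<close>, so this is half of the sum over all \<open>j\<close>.
\<close>

lemma alternating_half_sum:
  assumes "odd d" "d \<ge> 2"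
  shows "(\<Sum>j | 2 * j < d. (-1) ^ j * of_nat (d choose j) * (of_nat d - 2 * of_nat j :: complex) ^ (d - 2)) = 0"
proof -
  define t where "t j = (-1) ^ j * of_nat (d choose j) * (of_nat d - 2 * of_nat j :: complex) ^ (d - 2)" for j
  have t: "t (d - j) = t j" if "j \<le> d" for j
  proof -
    have neg: "of_nat d - 2 * of_nat (d - j) = (-1 :: complex) * (of_nat d - 2 * of_nat j)"
      using that by (simp add: of_nat_diff)
    have sign: "(-1 :: complex) ^ (d - j) * (-1) ^ (d - 2) = (-1) ^ j"
      using assms that by (cases "even j") (auto simp: even_diff_nat minus_one_power_iff)
    have sym: "d choose (d - j) = d choose j" by (rule binomial_symmetric[OF that, symmetric])
    have "t (d - j) = ((-1) ^ (d - j) * (-1) ^ (d - 2)) * of_nat (d choose j) * (of_nat d - 2 * of_nat j) ^ (d - 2)"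
      unfolding t_def neg sym power_mult_distrib by (simp only: mult_ac)
    then show ?thesis unfolding sign t_def .
  qed
  have half: "2 * (d - j) < d \<longleftrightarrow> \<not> 2 * j < d" if "j \<le> d" for j
    using assms(1) that by presburger
  have "(\<Sum>j\<in>{..d} - {j. 2 * j < d}. t j) = (\<Sum>j | 2 * j < d. t j)"
    by (intro sum.reindex_bij_witness[of _ "\<lambda>j. d - j" "\<lambda>j. d - j"]) (auto simp: half t)
  moreover have "(\<Sum>j\<le>d. t j) = 0"
    unfolding t_def using assms by (intro alternating_binomial_power_sum) auto
  moreover have "(\<Sum>j\<le>d. t j) = (\<Sum>j\<in>{..d} - {j. 2 * j < d}. t j) + (\<Sum>j | 2 * j < d. t j)"
    by (rule sum.subset_diff) auto
  ultimately show ?thesis by (simp add: t_def)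
qed

lemma cofactor_product_1:
  assumes "j \<le> d"
  shows "poly (qfact_cofactor j * qfact_cofactor (d - j)) 1 = 2 ^ d * (fact d / of_nat (d choose j))"
proof -
  have "poly (qfact_cofactor j * qfact_cofactor (d - j)) 1 = 2 ^ (j + (d - j)) * (fact j * fact (d - j))"
    by (simp only: poly_mult qfact_cofactor_1 power_add mult_ac)
  moreover have "(fact j * fact (d - j) :: complex) = fact d / of_nat (d choose j)"
    using assms by (simp add: binomial_fact)
  ultimately show ?thesis using assms by simp
qed

lemma cofactor_product_pderiv_1:
  "2 * poly (pderiv (qfact_cofactor j * qfact_cofactor (d - j))) 1 =
     poly (qfact_cofactor j * qfact_cofactor (d - j)) 1 * (of_nat j ^ 2 + of_nat (d - j) ^ 2)"
proof -
  have "2 * poly (pderiv (qfact_cofactor j * qfact_cofactor (d - j))) 1 =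
      poly (qfact_cofactor j) 1 * (2 * poly (pderiv (qfact_cofactor (d - j))) 1) +
      (2 * poly (pderiv (qfact_cofactor j)) 1) * poly (qfact_cofactor (d - j)) 1"
    by (simp add: pderiv_mult algebra_simps)
  also have "\<dots> = poly (qfact_cofactor j * qfact_cofactor (d - j)) 1 * (of_nat j ^ 2 + of_nat (d - j) ^ 2)"
    unfolding qfact_cofactor_pderiv_1 poly_mult qfact_cofactor_1 by (simp only: distrib_left mult_ac add.commute)
  finally show ?thesis .
qed

lemma pole_numerator_1:
  "pole_numerator d 1 = (\<Sum>j | 2 * j < d. (-1) ^ j * of_nat (d choose j) *
     (2 * (of_nat d - 2 * of_nat j) ^ (d - 1)) / (2 ^ d * fact d))"
  unfolding pole_numerator_def
proof (intro sum.cong refl)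
  fix j assume "j \<in> {j. 2 * j < d}"
  then have j: "2 * j < d" "j \<le> d" by auto
  then have n: "of_nat (d - 2 * j) = (of_nat d - 2 * of_nat j :: complex)" by (simp add: of_nat_diff)
  show "poly (thin_poly (d - 2 * j) (springer_numerator d j)) 1 /
      (poly (qfact_cofactor j) 1 * poly (qfact_cofactor (d - j)) 1) =
     (-1) ^ j * of_nat (d choose j) * (2 * (of_nat d - 2 * of_nat j) ^ (d - 1)) / (2 ^ d * fact d)"
    unfolding poly_mult[symmetric] cofactor_product_1[OF j(2)] thin_springer_numerator_1[OF j(1)] n
    by (simp add: field_simps)
qed

lemma pole_numerator_analytic: "pole_numerator d analytic_on {1}"
proof -
  have "(\<lambda>z. poly p z) analytic_on A" for p :: "complex poly" and A
    by (induction p) (auto intro!: analytic_intros)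
  moreover have "poly (qfact_cofactor c) 1 \<noteq> 0" for c
    by (simp add: qfact_cofactor_1)
  ultimately show ?thesis
    unfolding pole_numerator_def
    by (intro analytic_on_sum analytic_on_divide analytic_on_mult) auto
qed

text \<open>
  Let \<open>n = d - 2 j\<close>. In the \<open>j\<close>-th summand of \<open>2 h'(1)\<close> the quadratic expressions in \<open>j\<close> and \<open>d - j\<close>
  that come from the numerator and from the cofactors combine to \<open>- n\<close>, which yields \<open>- 1\<close> times the
  summand of \<open>h(1)\<close>. What is left is present only for odd \<open>d\<close> and is proportional to
  \<open>(-1) ^ j (d choose j) n ^ (d - 2)\<close>, so it sums to \<open>0\<close>.
\<close>

lemma deriv_pole_numerator_1:
  assumes "d \<ge> 2"
  shows "- deriv (pole_numerator d) 1 = 1 / 2 * pole_numerator d 1"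
proof -
  define g where "g j = thin_poly (d - 2 * j) (springer_numerator d j)" for j
  define C where "C j = qfact_cofactor j * qfact_cofactor (d - j)" for j
  define u where "u j = (-1) ^ j * of_nat (d choose j) / (2 ^ d * fact d :: complex)" for j
  define N where "N j = (of_nat d - 2 * of_nat j :: complex)" for j
  have C1: "poly (C j) 1 \<noteq> 0" for j by (simp add: C_def qfact_cofactor_1)
  have pole: "pole_numerator d = (\<lambda>z. \<Sum>j | 2 * j < d. poly (g j) z / poly (C j) z)"
    by (simp add: fun_eq_iff pole_numerator_def g_def C_def)
  have "(pole_numerator d has_field_derivative
      (\<Sum>j | 2 * j < d. (poly (pderiv (g j)) 1 * poly (C j) 1 - poly (g j) 1 * poly (pderiv (C j)) 1) /
         (poly (C j) 1 * poly (C j) 1))) (at 1)"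
    unfolding pole
    by (intro DERIV_sum DERIV_divide poly_DERIV C1)
  then have "2 * deriv (pole_numerator d) 1 =
      (\<Sum>j | 2 * j < d. 2 * ((poly (pderiv (g j)) 1 * poly (C j) 1 - poly (g j) 1 * poly (pderiv (C j)) 1) /
         (poly (C j) 1 * poly (C j) 1)))"
    by (simp add: DERIV_imp_deriv sum_distrib_left)
  also have "\<dots> = (\<Sum>j | 2 * j < d. 2 * (if even d then 0 else 1) * (u j * N j ^ (d - 2)) -
      u j * (2 * N j ^ (d - 1)))"
  proof (intro sum.cong refl)
    fix j assume "j \<in> {j. 2 * j < d}"
    then have j: "2 * j < d" "j \<le> d" by auto
    have N: "of_nat (d - 2 * j) = N j" using j by (simp add: N_def of_nat_diff)
    have "of_nat (d - 2 * j) \<noteq> (0 :: complex)" using j(1) by (simp only: of_nat_eq_0_iff)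
    then have N0: "N j \<noteq> 0" unfolding N .
    define e :: complex where "e = (if even d then 0 else 1)"
    define J D :: complex where "J = of_nat j" and "D = of_nat (d - j)"
    have ND: "N j = D - J" using j by (simp add: N_def J_def D_def of_nat_diff)
    have C': "2 * poly (pderiv (C j)) 1 = poly (C j) 1 * (J ^ 2 + D ^ 2)"
      unfolding C_def J_def D_def by (rule cofactor_product_pderiv_1)
    have g1: "poly (g j) 1 = (-1) ^ j * 2 * N j ^ (d - 1)"
      unfolding g_def thin_springer_numerator_1[OF j(1)] N ..
    have g': "N j ^ 2 * poly (pderiv (g j)) 1 =
        (-1) ^ j * N j ^ d * (e + 2 * (J * (J + 1)) + (N j - 1) * (J * (J + 1) + D * (D + 1)))"
      using thin_springer_numerator_pderiv_1[OF j(1)]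
      unfolding g_def N e_def J_def D_def by (simp only: of_nat_mult of_nat_add of_nat_1)
    have pow: "N j ^ d = N j ^ 2 * N j ^ (d - 2)" "N j ^ (d - 1) = N j * N j ^ (d - 2)"
      using assms by (simp_all flip: power_add power_Suc add: Suc_diff_Suc numeral_2_eq_2)
    have "N j ^ 2 * poly (pderiv (g j)) 1 = N j ^ 2 * ((-1) ^ j * N j ^ (d - 2) *
        (e + 2 * (J * (J + 1)) + (N j - 1) * (J * (J + 1) + D * (D + 1))))"
      unfolding g' pow(1) by (simp only: mult_ac)
    then have g'': "poly (pderiv (g j)) 1 = (-1) ^ j * N j ^ (d - 2) *
        (e + 2 * (J * (J + 1)) + (N j - 1) * (J * (J + 1) + D * (D + 1)))"
      using N0 by simp
    have "2 * ((poly (pderiv (g j)) 1 * poly (C j) 1 - poly (g j) 1 * poly (pderiv (C j)) 1) /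
         (poly (C j) 1 * poly (C j) 1)) =
       (2 * poly (pderiv (g j)) 1 * poly (C j) 1 - poly (g j) 1 * (2 * poly (pderiv (C j)) 1)) /
         (poly (C j) 1 * poly (C j) 1)"
      by (simp add: algebra_simps)
    also have "\<dots> = (2 * poly (pderiv (g j)) 1 - poly (g j) 1 * (J ^ 2 + D ^ 2)) / poly (C j) 1"
      unfolding C' using C1[of j] by (simp add: field_simps)
    also have "2 * poly (pderiv (g j)) 1 - poly (g j) 1 * (J ^ 2 + D ^ 2) =
       (-1) ^ j * N j ^ (d - 2) * (2 * (e - N j))"
    proof -
      \<comment> \<open>Only \<open>N j = D - J\<close> is used; the quadratic terms cancel.\<close>
      have bracket: "e + 2 * (J * (J + 1)) + (N j - 1) * (J * (J + 1) + D * (D + 1)) - N j * (J ^ 2 + D ^ 2) = e - N j"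
        unfolding ND by algebra
      have expand: "2 * poly (pderiv (g j)) 1 - poly (g j) 1 * (J ^ 2 + D ^ 2) =
        (-1) ^ j * N j ^ (d - 2) * (2 * (e + 2 * (J * (J + 1)) + (N j - 1) * (J * (J + 1) + D * (D + 1)) - N j * (J ^ 2 + D ^ 2)))"
        unfolding g'' g1 pow(2) by (simp only: right_diff_distrib mult_ac)
      show ?thesis unfolding expand bracket ..
    qed
    also have "(-1) ^ j * N j ^ (d - 2) * (2 * (e - N j)) / poly (C j) 1 =
        u j * N j ^ (d - 2) * (2 * (e - N j))"
      unfolding C_def cofactor_product_1[OF j(2)] u_def by (simp add: field_simps)
    also have "\<dots> = 2 * e * (u j * N j ^ (d - 2)) - u j * (2 * N j ^ (d - 1))"
      unfolding pow(2) by (simp add: algebra_simps)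
    finally show "2 * ((poly (pderiv (g j)) 1 * poly (C j) 1 - poly (g j) 1 * poly (pderiv (C j)) 1) /
         (poly (C j) 1 * poly (C j) 1)) =
       2 * (if even d then 0 else 1) * (u j * N j ^ (d - 2)) - u j * (2 * N j ^ (d - 1))"
      unfolding e_def .
  qed
  also have "\<dots> = 2 * (if even d then 0 else 1) * (\<Sum>j | 2 * j < d. u j * N j ^ (d - 2)) -
      (\<Sum>j | 2 * j < d. u j * (2 * N j ^ (d - 1)))"
    by (simp only: sum_subtractf sum_distrib_left)
  also have "(\<Sum>j | 2 * j < d. u j * (2 * N j ^ (d - 1))) = pole_numerator d 1"
    by (simp add: pole_numerator_1 u_def N_def)
  also have "2 * (if even d then 0 else 1) * (\<Sum>j | 2 * j < d. u j * N j ^ (d - 2)) = 0"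
  proof (cases "even d")
    case False
    have "(\<Sum>j | 2 * j < d. u j * N j ^ (d - 2)) =
        (\<Sum>j | 2 * j < d. (-1) ^ j * of_nat (d choose j) * N j ^ (d - 2)) / (2 ^ d * fact d)"
      by (simp add: u_def sum_divide_distrib)
    then show ?thesis
      using alternating_half_sum[OF False assms] by (simp add: N_def)
  qed simp
  finally have "2 * deriv (pole_numerator d) 1 = - pole_numerator d 1" by simp
  then show ?thesis by (metis minus_mult_right mult.commute nonzero_mult_div_cancel_left times_divide_eq_left mult_1 zero_neq_numeral minus_minus)
qed

lemma pole_numerator_1_eq:
  assumes "d \<ge> 1"
  shows "pole_numerator d 1 = 1 / fact d * (\<Sum>j | real j < real d / 2.
              (-1) ^ j * of_nat (d choose j) * (of_nat d / 2 - of_nat j) ^ (d - 1))"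
proof -
  have set: "{j. real j < real d / 2} = {j. 2 * j < d}" by auto
  show ?thesis
    unfolding pole_numerator_1 set sum_distrib_left
  proof (intro sum.cong refl)
    fix j
    have "(of_nat d / 2 - of_nat j :: complex) = (of_nat d - 2 * of_nat j) / 2" by simp
    then have "(of_nat d / 2 - of_nat j :: complex) ^ (d - 1) = (of_nat d - 2 * of_nat j) ^ (d - 1) / 2 ^ (d - 1)"
      by (simp only: power_divide)
    moreover have "(2 :: complex) ^ d = 2 * 2 ^ (d - 1)" using assms by (simp flip: power_Suc)
    ultimately show "(-1) ^ j * of_nat (d choose j) * (2 * (of_nat d - 2 * of_nat j) ^ (d - 1)) / (2 ^ d * fact d) =
        1 / fact d * ((-1) ^ j * of_nat (d choose j) * (of_nat d / 2 - of_nat j :: complex) ^ (d - 1))"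
      by (simp add: mult_ac)
  qed
qed

text \<open>
  The Laurent series is the Taylor series of \<open>h (1 - t)\<close> divided by \<open>t ^ d\<close>. The inner derivative of
  \<open>1 - t\<close> is the source of the sign of \<open>psi\<close>.
\<close>

lemma laurent_coefficients:
  assumes "d \<ge> 1"
  shows "deg_cov d = pole_numerator d 1" "psi_cov d = - deriv (pole_numerator d) 1"
proof -
  define h where "h t = pole_numerator d (1 - t)" for t
  have "(pole_numerator d \<circ> (\<lambda>t. 1 - t)) analytic_on {0}"
    by (intro analytic_on_compose analytic_intros) (simp add: pole_numerator_analytic)
  then have h: "h analytic_on {0}" by (simp add: h_def[abs_def] o_def)
  define F where "F = fps_expansion h 0"
  have F: "h has_fps_expansion F"
    unfolding F_def using analytic_at_imp_has_fps_expansion_0[OF h] .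
  have "(pole_numerator d has_field_derivative deriv (pole_numerator d) 1) (at (1 - 0))"
    using pole_numerator_analytic[of d] by (simp add: analytic_on_imp_differentiable_at field_differentiable_derivI)
  then have "(h has_field_derivative deriv (pole_numerator d) 1 * (-1)) (at 0)"
    unfolding h_def[abs_def] by (rule DERIV_chain2) (auto intro!: derivative_eq_intros)
  then have F01: "fps_nth F 0 = pole_numerator d 1" "fps_nth F 1 = - deriv (pole_numerator d) 1"
    by (simp_all add: F_def fps_expansion_def h_def DERIV_imp_deriv)
  have "eventually (\<lambda>t. poincare_fun d (1 - t) = pole_numerator d (1 - t) / (1 - (1 - t)) ^ d) (at 0)"
  proof -
    have "filterlim (\<lambda>t::complex. 1 - t) (at 1) (at 0)"
      by (auto simp: filterlim_at eventually_at_filter intro!: tendsto_eq_intros)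
    from eventually_compose_filterlim[OF poincare_fun_near_1[OF assms] this] show ?thesis .
  qed
  then have near: "eventually (\<lambda>t. poincare_fun d (1 - t) = h t * (inverse t) ^ d) (at 0)"
    by eventually_elim (simp add: h_def field_simps)
  have "(\<lambda>t. h t * (inverse t) ^ d) has_laurent_expansion fps_to_fls F * (inverse fls_X) ^ d"
    by (intro laurent_expansion_intros has_laurent_expansion_fps F)
  then have "(\<lambda>t. poincare_fun d (1 - t)) has_laurent_expansion fps_to_fls F * (inverse fls_X) ^ d"
    using has_laurent_expansion_cong[OF near refl] by blast
  then have "poincare_laurent d = fps_to_fls F * (inverse fls_X) ^ d"
    unfolding poincare_laurent_def by (intro laurent_expansion_eqI) simp
  also have "\<dots> = fls_shift (int d) (fps_to_fls F)"
    by (simp add: fls_inverse_X fls_X_inv_power_times_conv_shift)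
  finally have L: "poincare_laurent d = fls_shift (int d) (fps_to_fls F)" .
  show "deg_cov d = pole_numerator d 1" "psi_cov d = - deriv (pole_numerator d) 1"
    unfolding deg_cov_def psi_cov_def L by (simp_all add: F01[unfolded One_nat_def])
qed

theorem theorem2p2:
  fixes d :: nat
  assumes "d \<ge> 1"
  shows "((\<lambda>z. (1 - z) ^ d * poincare_fun d z) \<longlongrightarrow> deg_cov d) (at 1) \<and>
         deg_cov d = 1 / fact d *
           (\<Sum>j | real j < real d / 2.
              (-1) ^ j * of_nat (d choose j) * (of_nat d / 2 - of_nat j) ^ (d - 1)) \<and>
         ((\<lambda>z. deriv (\<lambda>w. - ((1 - w) ^ d * poincare_fun d w)) z) \<longlongrightarrow> psi_cov d) (at 1) \<and>
         (d \<ge> 2 \<longrightarrow> psi_cov d = 1 / 2 * deg_cov d)"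
proof (intro conjI impI)
  note coeffs = laurent_coefficients[OF assms]
  have near: "eventually (\<lambda>z. (1 - z) ^ d * poincare_fun d z = pole_numerator d z) (at 1)"
    using poincare_fun_near_1[OF assms] eventually_at_filter[of "\<lambda>z. z \<noteq> 1" "1::complex" UNIV]
    by (auto elim: eventually_elim2)
  have cont: "isCont (pole_numerator d) 1"
    using pole_numerator_analytic by (simp add: analytic_at_imp_isCont)
  show "((\<lambda>z. (1 - z) ^ d * poincare_fun d z) \<longlongrightarrow> deg_cov d) (at 1)"
    using cont unfolding coeffs isCont_def by (subst tendsto_cong[OF near])
  show "deg_cov d = 1 / fact d * (\<Sum>j | real j < real d / 2.
      (-1) ^ j * of_nat (d choose j) * (of_nat d / 2 - of_nat j) ^ (d - 1))"
    unfolding coeffs by (rule pole_numerator_1_eq[OF assms])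
  let ?f = "\<lambda>w. - ((1 - w) ^ d * poincare_fun d w)"
  have "eventually (\<lambda>z. z \<noteq> 1 \<longrightarrow> ?f z = - pole_numerator d z) (nhds 1)"
    using near by (auto simp: eventually_at_filter elim: eventually_mono)
  then have "eventually (\<lambda>z. eventually (\<lambda>w. w \<noteq> 1 \<longrightarrow> ?f w = - pole_numerator d w) (nhds z)) (nhds 1)"
    by (simp add: eventually_eventually)
  then have near': "eventually (\<lambda>z. deriv ?f z = deriv (\<lambda>w. - pole_numerator d w) z) (at 1)"
    unfolding eventually_at_filter
  proof (rule eventually_mono, intro impI)
    fix z :: complex
    assume ev: "eventually (\<lambda>w. w \<noteq> 1 \<longrightarrow> ?f w = - pole_numerator d w) (nhds z)" and z: "z \<noteq> 1"
    have "eventually (\<lambda>w. ?f w = - pole_numerator d w) (nhds z)"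
      using ev t1_space_nhds[OF z] by eventually_elim simp
    then show "deriv ?f z = deriv (\<lambda>w. - pole_numerator d w) z" by (rule deriv_cong_ev) simp
  qed
  have analytic: "(\<lambda>w. - pole_numerator d w) analytic_on {1}"
    by (intro analytic_intros pole_numerator_analytic)
  have "isCont (deriv (\<lambda>w. - pole_numerator d w)) 1"
    by (intro analytic_at_imp_isCont analytic_deriv analytic)
  moreover have "deriv (\<lambda>w. - pole_numerator d w) 1 = psi_cov d"
    unfolding coeffs using analytic_on_imp_differentiable_at[OF pole_numerator_analytic] by simp
  ultimately show "((\<lambda>z. deriv ?f z) \<longlongrightarrow> psi_cov d) (at 1)"
    unfolding isCont_def by (subst tendsto_cong[OF near']) simp
  show "psi_cov d = 1 / 2 * deg_cov d" if "d \<ge> 2"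
    unfolding coeffs by (rule deriv_pole_numerator_1[OF that])
qed

end
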